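(* Let $M$ be a monoid. The following conditions are equivalent: (1) Valence grammars over $M$ generate only context-free languages. (2) Valence automata over $M$ accept only regular languages. (3) Valence automata over $M$ can be determinized, i.e., for every valence automaton over $M$ there is a deterministic valence automaton over $M$ accepting the same language. (4) Valence transducers over $M$ perform only rational transductions. (5) $\mathfrak{R}(N)$ is finite for every finitely generated submonoid $N$ of $M$. (6) $\mathfrak{L}(N)$ is finite for every finitely generated submonoid $N$ of $M$. (7) $\mathfrak{E}(N)$ is finite for every finitely generated submonoid $N$ of $M$.
   Context: For a monoid $N$ (operation written by juxtaposition, neutral element $1$), put $\mathfrak{R}(N)=\{a\in N\mid \exists b\in N: ab=1\}$, $\mathfrak{L}(N)=\{a\in N\mid \exists b\in N: ba=1\}$, $\mathfrak{E}(N)=\{a\in N\mid \exists b,c\in N: bac=1\}$. Submonoids contain the neutral element of the ambient monoid. Let $\mathbf{1}$ denote the trivial monoid. An alphabet is a finite set of symbols; $X^*$ is the free monoid of words over $X$, and $\lambda$ is the empty word. An automaton over a monoid $K$ is a tuple $A=(K,Q,E,q_0,F)$ with $Q$ a finite set of states, $E$ a finite subset of $Q\times K\times Q$ (edges), $q_0\in Q$ the initial state, $F\subseteq Q$ the final states. Its step relation on $Q\times K$ is: $(p,a)\Rightarrow_A(q,b)$ iff there is an edge $(p,c,q)\in E$ with $b=ac$. Let $S(A)=\{a\in K\mid \exists q\in F: (q_0,1)\Rightarrow_A^*(q,a)\}$. A valence automaton over $M$ is an automaton $A$ over $X^*\times M$, where $X$ is an alphabet; it accepts the language $L(A)=\{w\in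 X^*\mid (w,1)\in S(A)\}$. It is deterministic if all its edges are in $Q\times(X\times M)\times Q$ and for each $(q,x)\in Q\times X$ there is at most one edge $(q,(x,m),p)$ with $m\in M$, $p\in Q$. Regular languages are those accepted by valence automata over $\mathbf{1}$ (finite automata). A valence transducer over $M$ is an automaton $A$ over $X^*\times Y^*\times M$, where $X,Y$ are alphabets; it performs the transduction $T(A)=\{(x,y)\in X^*\times Y^*\mid (x,y,1)\in S(A)\}$. Rational transductions are those performed by valence transducers over $\mathbf{1}$ (finite state transducers). A valence grammar over $M$ is a tuple $G=(N,T,M,P,S)$, where $N$ (nonterminals) and $T$ (terminals) are disjoint alphabets, $P\subseteq N\times(N\cup T)^*\times M$ is a finite set of productions (written $(A\to w;m)$), and $S\in N$ is the start symbol. The derivation relation on $(N\cup T)^*\times M$ is: $(u,a)\Rightarrow_G(v,b)$ iff there are $(A\to w;c)\in P$ and $r,s\in(N\cup T)^*$ with $u=rAs$, $v=rws$, $b=ac$. The generated language is $L(G)=\{w\in T^*\mid (S,1)\Rightarrow_G^*(w,1)\}$. Context-free languages are those generated by valence grammars over $\mathbf{1}$ (context-free grammars). *)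

theory Defs
  imports "HOL-Algebra.Elementary_Groups" "HOL.Hull"
begin

definition right_invertibles :: "('m, 'r) monoid_scheme \<Rightarrow> 'm set" where
  "right_invertibles N = {a \<in> carrier N. \<exists>b \<in> carrier N. a \<otimes>\<^bsub>N\<^esub> b = \<one>\<^bsub>N\<^esub>}"

definition left_invertibles :: "('m, 'r) monoid_scheme \<Rightarrow> 'm set" where
  "left_invertibles N = {a \<in> carrier N. \<exists>b \<in> carrier N. b \<otimes>\<^bsub>N\<^esub> a = \<one>\<^bsub>N\<^esub>}"

definition two_sided_factors :: "('m, 'r) monoid_scheme \<Rightarrow> 'm set" where
  "two_sided_factors N =
     {a \<in> carrier N. \<exists>b \<in> carrier N. \<exists>c \<in> carrier N. b \<otimes>\<^bsub>N\<^esub> a \<otimes>\<^bsub>N\<^esub> c = \<one>\<^bsub>N\<^esub>}"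

definition finitely_generated_submonoid :: "'m set \<Rightarrow> ('m, 'r) monoid_scheme \<Rightarrow> bool" where
  "finitely_generated_submonoid H M \<longleftrightarrow>
     (\<exists>B. finite B \<and> B \<subseteq> carrier M \<and> H = (\<lambda>K. submonoid K M) hull B)"

definition free_monoid :: "'a set \<Rightarrow> 'a list monoid" where
  "free_monoid X = \<lparr>carrier = lists X, monoid.mult = (@), one = []\<rparr>"

lemma monoid_free_monoid: "monoid (free_monoid X)"
  by (rule monoidI) (auto simp: free_monoid_def)

abbreviation trivial_monoid :: "unit monoid" where
  "trivial_monoid \<equiv> singleton_group ()"

text \<open>
  Symbols and states are drawn from a fixed countably infinite supply; alphabets and state
  sets are its finite subsets, so up to renaming every finite set is available.
\<close>

type_synonym symbol = nat
type_synonym word = "symbol list"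
type_synonym state = nat

record 'k automaton =
  states :: "state set"
  edges :: "(state \<times> 'k \<times> state) set"
  initial :: state
  finals :: "state set"

definition automaton_over :: "('k, 'r) monoid_scheme \<Rightarrow> 'k automaton \<Rightarrow> bool" where
  "automaton_over K A \<longleftrightarrow>
     finite (states A) \<and>
     finite (edges A) \<and> edges A \<subseteq> states A \<times> carrier K \<times> states A \<and>
     initial A \<in> states A \<and>
     finals A \<subseteq> states A"

definition automaton_step ::
  "('k, 'r) monoid_scheme \<Rightarrow> 'k automaton \<Rightarrow> ((state \<times> 'k) \<times> (state \<times> 'k)) set" where
  "automaton_step K A =
     {((p, a), (q, b)). p \<in> states A \<and> q \<in> states A \<and> a \<in> carrier K \<and>
        (\<exists>c. (p, c, q) \<in> edges A \<and> b = a \<otimes>\<^bsub>K\<^esub> c)}"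

definition accepted_elements :: "('k, 'r) monoid_scheme \<Rightarrow> 'k automaton \<Rightarrow> 'k set" where
  "accepted_elements K A =
     {a \<in> carrier K. \<exists>q \<in> finals A.
        ((initial A, \<one>\<^bsub>K\<^esub>), (q, a)) \<in> (automaton_step K A)\<^sup>*}"

definition valence_automaton ::
  "symbol set \<Rightarrow> ('m, 'r) monoid_scheme \<Rightarrow> (word \<times> 'm) automaton \<Rightarrow> bool" where
  "valence_automaton X M A \<longleftrightarrow> finite X \<and> automaton_over (free_monoid X \<times>\<times> M) A"

definition automaton_language ::
  "symbol set \<Rightarrow> ('m, 'r) monoid_scheme \<Rightarrow> (word \<times> 'm) automaton \<Rightarrow> word set" where
  "automaton_language X M A =
     {w \<in> lists X. (w, \<one>\<^bsub>M\<^esub>) \<in> accepted_elements (free_monoid X \<times>\<times> M) A}"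

definition deterministic_valence_automaton ::
  "symbol set \<Rightarrow> ('m, 'r) monoid_scheme \<Rightarrow> (word \<times> 'm) automaton \<Rightarrow> bool" where
  "deterministic_valence_automaton X M A \<longleftrightarrow>
     valence_automaton X M A \<and>
     edges A \<subseteq> states A \<times> ((\<lambda>x. [x]) ` X \<times> carrier M) \<times> states A \<and>
     (\<forall>q \<in> states A. \<forall>x \<in> X. \<forall>m p m' p'.
        (q, ([x], m), p) \<in> edges A \<and> (q, ([x], m'), p') \<in> edges A \<longrightarrow> m = m' \<and> p = p')"

definition regular_language :: "word set \<Rightarrow> bool" where
  "regular_language L \<longleftrightarrow>
     (\<exists>X A. valence_automaton X trivial_monoid A \<and> L = automaton_language X trivial_monoid A)"

definition valence_transducer ::
  "symbol set \<Rightarrow> symbol set \<Rightarrow> ('m, 'r) monoid_scheme \<Rightarrow> (word \<times> word \<times> 'm) automaton \<Rightarrow> bool"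
where
  "valence_transducer X Y M A \<longleftrightarrow>
     finite X \<and> finite Y \<and> automaton_over (free_monoid X \<times>\<times> free_monoid Y \<times>\<times> M) A"

definition transduction ::
  "symbol set \<Rightarrow> symbol set \<Rightarrow> ('m, 'r) monoid_scheme \<Rightarrow> (word \<times> word \<times> 'm) automaton
     \<Rightarrow> (word \<times> word) set" where
  "transduction X Y M A =
     {(x, y) \<in> lists X \<times> lists Y.
        (x, y, \<one>\<^bsub>M\<^esub>) \<in> accepted_elements (free_monoid X \<times>\<times> free_monoid Y \<times>\<times> M) A}"

definition rational_transduction :: "(word \<times> word) set \<Rightarrow> bool" where
  "rational_transduction T \<longleftrightarrow>
     (\<exists>X Y A. valence_transducer X Y trivial_monoid A \<and> T = transduction X Y trivial_monoid A)"

record 'm grammar =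
  nonterminals :: "symbol set"
  terminals :: "symbol set"
  productions :: "(symbol \<times> word \<times> 'm) set"
  start_symbol :: symbol

definition valence_grammar :: "('m, 'r) monoid_scheme \<Rightarrow> 'm grammar \<Rightarrow> bool" where
  "valence_grammar M G \<longleftrightarrow>
     finite (nonterminals G) \<and> finite (terminals G) \<and> nonterminals G \<inter> terminals G = {} \<and>
     finite (productions G) \<and>
     productions G \<subseteq> nonterminals G \<times> lists (nonterminals G \<union> terminals G) \<times> carrier M \<and>
     start_symbol G \<in> nonterminals G"

definition grammar_step ::
  "('m, 'r) monoid_scheme \<Rightarrow> 'm grammar \<Rightarrow> ((word \<times> 'm) \<times> (word \<times> 'm)) set" where
  "grammar_step M G =
     {((u, a), (v, b)). a \<in> carrier M \<and>
        (\<exists>A w c. (A, w, c) \<in> productions G \<and>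
           (\<exists>r \<in> lists (nonterminals G \<union> terminals G).
            \<exists>s \<in> lists (nonterminals G \<union> terminals G).
              u = r @ [A] @ s \<and> v = r @ w @ s \<and> b = a \<otimes>\<^bsub>M\<^esub> c))}"

definition grammar_language :: "('m, 'r) monoid_scheme \<Rightarrow> 'm grammar \<Rightarrow> word set" where
  "grammar_language M G =
     {w \<in> lists (terminals G).
        (([start_symbol G], \<one>\<^bsub>M\<^esub>), (w, \<one>\<^bsub>M\<^esub>)) \<in> (grammar_step M G)\<^sup>*}"

definition context_free_language :: "word set \<Rightarrow> bool" where
  "context_free_language L \<longleftrightarrow>
     (\<exists>G. valence_grammar trivial_monoid G \<and> L = grammar_language trivial_monoid G)"

definition all_equivalent :: "bool list \<Rightarrow> bool" where
  "all_equivalent Ps \<longleftrightarrow> (\<forall>P \<in> set Ps. \<forall>Q \<in> set Ps. P \<longleftrightarrow> Q)"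

end

theory Submission
  imports Defs "HOL-Library.Sublist"
begin

text \<open>If \<open>R(N)\<close> is finite then it is the group of units of \<open>N\<close> and coincides with
\<open>L(N)\<close> and \<open>E(N)\<close>: two powers of a right invertible element agree, so it is invertible. On a path whose valence is
\<open>\<one>\<close>, each prefix has a right invertible valence, so a finite automaton can store it; this yields (2) and (4), and
residuals turn a finite automaton into a deterministic one without using valences.

Conversely, it suffices to find finitely many elements that provide a right inverse for every element of \<open>R(N)\<close>.
Suitable languages consist of words \<open>u v\<close> that name the factors of \<open>\<one>\<close>. For determinization one adds all words \<open>u\<close>
to the language, which forces the valence after \<open>u\<close> to be \<open>\<one>\<close> and leaves only a state. For grammars one appends
\<open>\<bar>u\<bar>\<close> copies of a new letter and applies the pumping lemma to a shortest right inverse \<open>v\<close>.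

The hard direction is (1). The valences used in a derivation with product \<open>\<one>\<close> lie in a finite group \<open>H\<close>, but the order
in which independent subtrees are expanded matters. The possible valence sequences of a derivation tree form a
language \<open>K\<close> over \<open>H\<close>, built from those of the subtrees by shuffling and by prefixing a letter. All that matters of
\<open>K\<close> is which values the shuffles of its words with an arbitrary word \<open>x\<close> can have. Inserting factors of value \<open>\<one>\<close>,
into a word of \<open>K\<close> or into \<open>x\<close>, preserves these values. By Higman's lemma insertion is a well-quasi-order, so only
finitely many behaviours exist, and they can be stored in the nonterminals of a context-free grammar.\<close>

section \<open>One-sided inverses\<close>

text \<open>Finitely generated submonoids enter because a device has finitely many labels: all its
  valences lie in the submonoid \<open>N\<close> that these generate. For the converse, right
  inverses are bounded instead of right invertible elements, because a finite set of states or a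
  pumping constant limits the continuations that have to be considered. The values of
  \<open>K\<close> alone would be too little to store, since the group need not be commutative and
  the value of an interleaving depends on both words. Testing against every \<open>x\<close> gives a
  congruence for shuffling and prefixing: a test of a shuffle is a family of tests of one factor.
  The price is an infinite set of tests. Inserting factors only enlarges a behaviour, so the
  well-quasi-order on words gives ascending chains, not yet finiteness; it is used a second time, on
  the test words, to stop these chains. Subword embedding ignores values, hence Higman's lemma is
  applied to words whose letters also carry the product before them; cancellation then forces the
  material between matched letters to have value \<one>.\<close>

lemma monoid_trivial_monoid: "monoid trivial_monoid"
  by (rule group.is_monoid) simp

context monoid
begin

lemma right_invertible_powers:
  assumes "a \<in> carrier G" "b \<in> carrier G" "a \<otimes> b = \<one>"
  shows "a [^] (n::nat) \<otimes> b [^] n = \<one>"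
proof (induction n)
  case 0 then show ?case by simp
next
  case (Suc n)
  have "a [^] Suc n \<otimes> b [^] Suc n = a [^] n \<otimes> (a \<otimes> b) \<otimes> b [^] n"
    using assms(1,2) by (metis m_assoc m_closed nat_pow_Suc nat_pow_Suc2 nat_pow_closed)
  then show ?case using assms Suc by simp
qed

text \<open>A coincidence of right inverses is not yet a relation between powers; inserting
  \<open>a [^] i \<otimes> c\<close> behind \<open>a [^] (j - i)\<close> turns it into one.\<close>

lemma pow_diff_eq_one:
  assumes "a \<in> carrier G" "c \<in> carrier G" "i < j"
    and "a [^] (i::nat) \<otimes> c = \<one>" "a [^] j \<otimes> c = \<one>"
  shows "a [^] (j - i) = \<one>"
proof -
  have "a [^] (j - i) = a [^] (j - i) \<otimes> (a [^] i \<otimes> c)" using assms(1,4) by simp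
  also have "\<dots> = (a [^] (j - i) \<otimes> a [^] i) \<otimes> c" using assms by (simp add: m_assoc)
  also have "\<dots> = a [^] j \<otimes> c" using assms by (simp add: nat_pow_mult)
  finally show ?thesis using assms by simp
qed

lemma pow_one_inverse:
  assumes "a \<in> carrier G" "a [^] (n::nat) = \<one>" "n > 0"
  shows "a [^] (n - 1) \<otimes> a = \<one>" "a \<otimes> a [^] (n - 1) = \<one>"
proof -
  obtain k where "n = Suc k" using assms(3) gr0_implies_Suc by blast
  then show "a [^] (n - 1) \<otimes> a = \<one>" "a \<otimes> a [^] (n - 1) = \<one>"
    using assms(2) nat_pow_Suc2[OF assms(1), of k] by simp_all
qed

lemma left_right_inverse_unique:
  assumes "a \<in> carrier G" "b \<in> carrier G" "c \<in> carrier G" "a \<otimes> b = \<one>" "c \<otimes> a = \<one>"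
  shows "b = c"
proof -
  have "c = c \<otimes> (a \<otimes> b)" using assms(3,4) by simp
  also have "\<dots> = (c \<otimes> a) \<otimes> b" by (rule m_assoc[symmetric]) fact+
  finally show ?thesis using assms(2,5) by simp
qed

text \<open>The powers of \<open>a\<close> are right invertible, so two of them share an inverse
  from the finite set \<open>C\<close>. Hence a positive power of \<open>a\<close> is
  \<open>\<one>\<close>, which gives \<open>a\<close> a left inverse, and this equals
  \<open>b\<close>.\<close>

lemma right_inverse_commutes_if_finite_inverses:
  assumes C: "finite C" "C \<subseteq> carrier G" "\<forall>a \<in> right_invertibles G. \<exists>c \<in> C. a \<otimes> c = \<one>"
    and ab: "a \<in> carrier G" "b \<in> carrier G" "a \<otimes> b = \<one>"
  shows "b \<otimes> a = \<one>"
proof -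
  have "a [^] n \<in> right_invertibles G" for n :: nat
    using right_invertible_powers[OF ab] ab by (auto simp: right_invertibles_def)
  then have "\<forall>n::nat. \<exists>c. c \<in> C \<and> a [^] n \<otimes> c = \<one>" using C by blast
  then obtain f where f: "\<And>n::nat. f n \<in> C" "\<And>n. a [^] n \<otimes> f n = \<one>" by metis
  have "\<not> inj f"
    using C(1) f(1) finite_subset[of "range f" C] by (auto dest: finite_imageD)
  then obtain i j where "i < j" "f i = f j"
    by (metis inj_onI linorder_neqE_nat)
  then have "a [^] (j - i) = \<one>"
    using pow_diff_eq_one[of a "f i" i j] f(1)[of i] f(2)[of i] f(2)[of j] C(2) ab(1) by auto
  then have "a [^] (j - i - 1) \<otimes> a = \<one>" using pow_one_inverse(1)[of a "j - i"] ab \<open>i < j\<close> by simp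
  then show ?thesis using left_right_inverse_unique[of a b "a [^] (j - i - 1)"] ab by simp
qed

text \<open>The criterion through which determinization and grammars yield finiteness. Choosing an
  inverse in \<open>C\<close> is injective because these inverses are two-sided.\<close>

lemma finite_right_invertibles_if_finite_inverses:
  assumes C: "finite C" "C \<subseteq> carrier G" "\<forall>a \<in> right_invertibles G. \<exists>c \<in> C. a \<otimes> c = \<one>"
  shows "finite (right_invertibles G)"
proof -
  obtain f where f: "\<And>a. a \<in> right_invertibles G \<Longrightarrow> f a \<in> C \<and> a \<otimes> f a = \<one>"
    using C(3) by metis
  have "inj_on f (right_invertibles G)"
  proof (rule inj_onI)
    fix a a' assume a: "a \<in> right_invertibles G" "a' \<in> right_invertibles G" "f a = f a'"
    have car: "a \<in> carrier G" "a' \<in> carrier G" using a by (auto simp: right_invertibles_def)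
    have "f a \<otimes> a = \<one>"
      using right_inverse_commutes_if_finite_inverses[OF C] f a car C(2) by blast
    then show "a = a'" using left_right_inverse_unique[of "f a" a a'] f a car C(2) by fastforce
  qed
  then show ?thesis using C(1) f by (metis (mono_tags) finite_imageD finite_subset image_subsetI)
qed

lemma finite_right_invertibles_commute:
  assumes "finite (right_invertibles G)" "a \<in> carrier G" "b \<in> carrier G" "a \<otimes> b = \<one>"
  shows "b \<otimes> a = \<one>"
proof -
  have "\<forall>a \<in> right_invertibles G. \<exists>b. b \<in> carrier G \<and> a \<otimes> b = \<one>"
    by (auto simp: right_invertibles_def)
  then obtain f where f: "\<And>a. a \<in> right_invertibles G \<Longrightarrow> f a \<in> carrier G \<and> a \<otimes> f a = \<one>"
    by metis
  show ?thesis
    by (rule right_inverse_commutes_if_finite_inverses[of "f ` right_invertibles G"]) (use assms f in auto)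
qed

text \<open>As right inverses commute, \<open>b \<otimes> (a \<otimes> c) = \<one>\<close> can be
  rotated to \<open>(a \<otimes> c) \<otimes> b = \<one>\<close>, which exhibits
  \<open>c \<otimes> b\<close> as a right inverse of \<open>a\<close>.\<close>

lemma two_sided_factors_eq_right_invertibles:
  assumes "finite (right_invertibles G)"
  shows "two_sided_factors G = right_invertibles G"
proof
  show "two_sided_factors G \<subseteq> right_invertibles G"
  proof
    fix a assume "a \<in> two_sided_factors G"
    then obtain b c where c: "a \<in> carrier G" "b \<in> carrier G" "c \<in> carrier G" "b \<otimes> a \<otimes> c = \<one>"
      by (auto simp: two_sided_factors_def)
    then have "(a \<otimes> c) \<otimes> b = \<one>"
      using finite_right_invertibles_commute[OF assms, of b "a \<otimes> c"] by (simp add: m_assoc)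
    then show "a \<in> right_invertibles G"
      using c unfolding right_invertibles_def by (auto simp: m_assoc intro!: bexI[of _ "c \<otimes> b"])
  qed
  show "right_invertibles G \<subseteq> two_sided_factors G"
  proof
    fix a assume "a \<in> right_invertibles G"
    then obtain b where "a \<in> carrier G" "b \<in> carrier G" "\<one> \<otimes> a \<otimes> b = \<one>"
      by (auto simp: right_invertibles_def)
    then show "a \<in> two_sided_factors G" unfolding two_sided_factors_def by blast
  qed
qed

lemma left_invertibles_subset_two_sided_factors: "left_invertibles G \<subseteq> two_sided_factors G"
proof
  fix a assume "a \<in> left_invertibles G"
  then obtain b where "a \<in> carrier G" "b \<in> carrier G" "b \<otimes> a \<otimes> \<one> = \<one>"
    by (auto simp: left_invertibles_def)
  then show "a \<in> two_sided_factors G" unfolding two_sided_factors_def by blast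
qed

text \<open>The pigeonhole principle runs over the powers of the inverse \<open>b\<close>, which are
  left invertible. Cancelling with a power of \<open>a\<close> shows that a positive power of
  \<open>b\<close> is \<open>\<one>\<close>, so \<open>b\<close> has a right inverse, and this
  equals \<open>a\<close>.\<close>

lemma right_invertibles_subset_left_invertibles:
  assumes "finite (left_invertibles G)"
  shows "right_invertibles G \<subseteq> left_invertibles G"
proof
  fix a assume "a \<in> right_invertibles G"
  then obtain b where ab: "a \<in> carrier G" "b \<in> carrier G" "a \<otimes> b = \<one>"
    by (auto simp: right_invertibles_def)
  have pows: "a [^] n \<otimes> b [^] n = \<one>" for n :: nat by (rule right_invertible_powers[OF ab])
  then have "range (\<lambda>n::nat. b [^] n) \<subseteq> left_invertibles G"
    using ab by (auto simp: left_invertibles_def)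
  then have "\<not> inj (\<lambda>n::nat. b [^] n)"
    using assms finite_subset by (auto dest: finite_imageD)
  then obtain i j :: nat where ij: "i < j" "b [^] i = b [^] j"
    by (metis inj_onI linorder_neqE_nat)
  have "\<one> = a [^] i \<otimes> b [^] (i + (j - i))" using ij(1) ij(2)[symmetric] pows[of i] by simp
  also have "\<dots> = a [^] i \<otimes> b [^] i \<otimes> b [^] (j - i)"
    using ab by (simp add: nat_pow_mult[symmetric] m_assoc)
  finally have "b [^] (j - i) = \<one>" using pows ab by simp
  then have "b \<otimes> b [^] (j - i - 1) = \<one>" using pow_one_inverse(2)[of b "j - i"] ab ij by simp
  then have "b \<otimes> a = \<one>" using left_right_inverse_unique[of b "b [^] (j - i - 1)" a] ab by simp
  then show "a \<in> left_invertibles G" using ab by (auto simp: left_invertibles_def)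
qed

section \<open>Finitely generated submonoids\<close>

definition mprod :: "'a list \<Rightarrow> 'a" where
  "mprod l = foldr (\<otimes>) l \<one>"

lemma mprod_simps [simp]: "mprod [] = \<one>" "mprod (x # l) = x \<otimes> mprod l"
  by (simp_all add: mprod_def)

lemma mprod_closed [simp]: "set l \<subseteq> carrier G \<Longrightarrow> mprod l \<in> carrier G"
  by (induction l) auto

lemma mprod_append: "set l \<subseteq> carrier G \<Longrightarrow> set l' \<subseteq> carrier G \<Longrightarrow> mprod (l @ l') = mprod l \<otimes> mprod l'"
  by (induction l) (auto simp: m_assoc)

lemma mprod_in_submonoid: "submonoid K G \<Longrightarrow> set l \<subseteq> K \<Longrightarrow> mprod l \<in> K"
  by (induction l) (auto intro: submonoid.m_closed submonoid.one_closed)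

lemma submonoid_mprod_lists:
  assumes "B \<subseteq> carrier G"
  shows "submonoid (mprod ` lists B) G"
proof
  show "mprod ` lists B \<subseteq> carrier G" using assms by (auto simp: lists_eq_set)
  show "\<one> \<in> mprod ` lists B" by (force intro: rev_image_eqI[of "[]"])
next
  fix x y assume "x \<in> mprod ` lists B" "y \<in> mprod ` lists B"
  then obtain l l' where "l \<in> lists B" "l' \<in> lists B" "x = mprod l" "y = mprod l'" by blast
  then show "x \<otimes> y \<in> mprod ` lists B"
    using assms by (intro rev_image_eqI[of "l @ l'"]) (auto simp: lists_eq_set mprod_append subset_trans)
qed

lemma subset_mprod_lists:
  assumes "B \<subseteq> carrier G"
  shows "insert \<one> B \<subseteq> mprod ` lists B"
proof
  fix x assume "x \<in> insert \<one> B"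
  then consider "x = mprod []" | "x \<in> B" "x = mprod [x]" using assms by auto
  then show "x \<in> mprod ` lists B"
  proof cases
    case 1 then show ?thesis by (rule image_eqI) simp
  next
    case 2
    have "mprod [x] \<in> mprod ` lists B" by (rule imageI) (use 2(1) in simp)
    with 2(2) show ?thesis by metis
  qed
qed

lemma submonoid_hull_eq:
  assumes "B \<subseteq> carrier G"
  shows "(\<lambda>K. submonoid K G) hull B = mprod ` lists B"
proof (rule hull_unique)
  show "B \<subseteq> mprod ` lists B"
    using subset_mprod_lists[OF assms] by blast
  show "submonoid (mprod ` lists B) G" using assms by (rule submonoid_mprod_lists)
  show "\<And>T. B \<subseteq> T \<Longrightarrow> submonoid T G \<Longrightarrow> mprod ` lists B \<subseteq> T"
    using mprod_in_submonoid by (fastforce simp: lists_eq_set)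
qed

lemma finitely_generated_submonoid_iff:
  "finitely_generated_submonoid N G \<longleftrightarrow> (\<exists>B. finite B \<and> B \<subseteq> carrier G \<and> N = mprod ` lists B)"
  unfolding finitely_generated_submonoid_def using submonoid_hull_eq by metis

lemma submonoid_if_finitely_generated: "finitely_generated_submonoid N G \<Longrightarrow> submonoid N G"
  using submonoid_mprod_lists by (auto simp: finitely_generated_submonoid_iff)

end

text \<open>Two disjoint alphabets naming the generators, so that a word \<open>u\<close> over the first followed by a word
  \<open>v\<close> over the second records a factorization of a monoid element.\<close>

lemma (in monoid) generating_alphabets:
  assumes "finitely_generated_submonoid N G"
  obtains X Y :: "symbol set" and ev where "finite X" "finite Y" "X \<inter> Y = {}" "ev ` (X \<union> Y) \<subseteq> N"
    "\<And>a. a \<in> N \<Longrightarrow> \<exists>u \<in> lists X. mprod (map ev u) = a"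
    "\<And>a. a \<in> N \<Longrightarrow> \<exists>v \<in> lists Y. v \<noteq> [] \<and> mprod (map ev v) = a"
proof -
  obtain B where B: "finite B" "B \<subseteq> carrier G" "N = mprod ` lists B"
    using assms by (auto simp: finitely_generated_submonoid_iff)
  \<comment> \<open>\<open>\<one>\<close> gets a letter of its own, which pads words over
    \<open>Y\<close> so that every value has a nonempty word.\<close>
  let ?B = "insert \<one> B"
  obtain f :: "'a \<Rightarrow> nat" where f: "inj_on f ?B"
    using B(1) finite_imp_inj_to_nat_seg[of ?B] by auto
  \<comment> \<open>Halving gives the even and the odd copy of a code the same value; the even
    copies form \<open>X\<close>, the odd ones \<open>Y\<close>.\<close>
  define ev where "ev s = the_inv_into ?B f (s div 2)" for s
  have ev: "ev (2 * f b) = b" "ev (2 * f b + 1) = b" if "b \<in> ?B" for b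
    using that f by (auto simp: ev_def the_inv_into_f_f)
  define X Y where "X = (\<lambda>b. 2 * f b) ` ?B" and "Y = (\<lambda>b. 2 * f b + 1) ` ?B"
  have maps: "map ev (map (\<lambda>b. 2 * f b) l) = l" "map ev (map (\<lambda>b. 2 * f b + 1) l) = l"
    if "l \<in> lists ?B" for l using that ev by (induction l) auto
  show thesis
  proof (rule that[of X Y ev])
    show "finite X" "finite Y" using B(1) by (auto simp: X_def Y_def)
    show "X \<inter> Y = {}" unfolding X_def Y_def by (auto, presburger+)
    have "?B \<subseteq> N" using subset_mprod_lists[OF B(2)] B(3) by simp
    then show "ev ` (X \<union> Y) \<subseteq> N" using ev by (auto simp: X_def Y_def)
    fix a assume "a \<in> N"
    then obtain l where l: "l \<in> lists B" "mprod l = a" using B(3) by blast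
    then have l': "l \<in> lists ?B" "\<one> # l \<in> lists ?B" "mprod (\<one> # l) = a"
      using B(2) by (auto simp: lists_eq_set subset_trans)
    show "\<exists>u \<in> lists X. mprod (map ev u) = a"
      using maps(1)[OF l'(1)] l(2) l'(1) by (intro bexI[of _ "map (\<lambda>b. 2 * f b) l"]) (auto simp: X_def lists_eq_set)
    show "\<exists>v \<in> lists Y. v \<noteq> [] \<and> mprod (map ev v) = a"
      using maps(2)[OF l'(2)] l'(3) l'(2)
      by (intro bexI[of _ "map (\<lambda>b. 2 * f b + 1) (\<one> # l)"]) (auto simp: Y_def lists_eq_set)
  qed
qed

section \<open>Automata over monoids\<close>

inductive path :: "('k, 'r) monoid_scheme \<Rightarrow> 'k automaton \<Rightarrow> state \<Rightarrow> 'k \<Rightarrow> state \<Rightarrow> bool" for K A where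
  path_refl: "path K A p \<one>\<^bsub>K\<^esub> p"
| path_snoc: "path K A p a q \<Longrightarrow> (q, c, r) \<in> edges A \<Longrightarrow> path K A p (a \<otimes>\<^bsub>K\<^esub> c) r"

locale monoid_automaton = monoid K for K (structure) +
  fixes A assumes automaton_over: "automaton_over K A"
begin

lemma edgeD:
  assumes "(p, c, q) \<in> edges A"
  shows "p \<in> states A" "c \<in> carrier K" "q \<in> states A"
  using assms automaton_over by (auto simp: automaton_over_def)

lemma path_closed: "path K A p a q \<Longrightarrow> a \<in> carrier K"
  by (induction rule: path.induct) (auto dest: edgeD)

lemma path_state: "path K A p a q \<Longrightarrow> p \<in> states A \<Longrightarrow> q \<in> states A"
  by (induction rule: path.induct) (auto dest: edgeD)

lemma path_edge: "(p, c, q) \<in> edges A \<Longrightarrow> path K A p c q"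
proof -
  assume e: "(p, c, q) \<in> edges A"
  have "path K A p (\<one> \<otimes> c) q" by (rule path_snoc[OF path_refl e])
  then show ?thesis using edgeD[OF e] by simp
qed

lemma path_append:
  assumes "path K A q b r" "path K A p a q" shows "path K A p (a \<otimes> b) r"
  using assms
proof (induction rule: path.induct)
  case (path_refl q) then show ?case using path_closed by simp
next
  case (path_snoc q b r c s)
  then have "path K A p ((a \<otimes> b) \<otimes> c) s" by (auto intro: path.path_snoc)
  moreover have "(a \<otimes> b) \<otimes> c = a \<otimes> (b \<otimes> c)"
    using path_snoc path_closed edgeD(2) by (auto intro!: m_assoc)
  ultimately show ?case by simp
qed

lemma steps_iff_path:
  "((initial A, \<one>), (q, a)) \<in> (automaton_step K A)\<^sup>* \<longleftrightarrow> path K A (initial A) a q"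
proof
  assume "((initial A, \<one>), (q, a)) \<in> (automaton_step K A)\<^sup>*"
  then show "path K A (initial A) a q"
    by (induction rule: rtrancl_induct2)
      (auto simp: automaton_step_def intro: path_refl path_snoc)
next
  assume "path K A (initial A) a q"
  then show "((initial A, \<one>), (q, a)) \<in> (automaton_step K A)\<^sup>*"
  proof (induction "initial A" a q rule: path.induct)
    case path_refl then show ?case by simp
  next
    case (path_snoc a q c r)
    then have "((q, a), (r, a \<otimes> c)) \<in> automaton_step K A"
      using path_closed edgeD by (auto simp: automaton_step_def)
    with path_snoc show ?case by (auto intro: rtrancl_into_rtrancl)
  qed
qed

lemma accepted_elements_eq:
  "accepted_elements K A = {a. \<exists>q \<in> finals A. path K A (initial A) a q}"
  unfolding accepted_elements_def steps_iff_path using path_closed by auto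

end

text \<open>The product of an automaton with the finitely many right invertible values that its paths
  can reach: only these prefixes can be completed to an accepting path.\<close>

lemma (in monoid) automaton_with_finite_memory:
  fixes K :: "('k, 's) monoid_scheme" and K' :: "('l, 't) monoid_scheme"
    and \<pi> :: "'k \<Rightarrow> 'a" and \<rho> :: "'k \<Rightarrow> 'l"
  assumes K: "monoid K" and K': "monoid K'" and A: "automaton_over K A"
    and \<pi>: "\<pi> \<in> hom K G" "\<pi> \<one>\<^bsub>K\<^esub> = \<one>" and \<rho>: "\<rho> \<in> hom K K'" "\<rho> \<one>\<^bsub>K\<^esub> = \<one>\<^bsub>K'\<^esub>"
    and fin: "\<And>N. finitely_generated_submonoid N G \<Longrightarrow> finite (right_invertibles (G\<lparr>carrier := N\<rparr>))"
  obtains B where "automaton_over K' B"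
    "accepted_elements K' B = \<rho> ` {a \<in> accepted_elements K A. \<pi> a = \<one>}"
proof -
  interpret K: monoid_automaton K A using K A by (simp add: monoid_automaton_def monoid_automaton_axioms_def)
  define Lab where "Lab = (\<lambda>(p, c, q). \<pi> c) ` edges A"
  have Lab: "finite Lab" "Lab \<subseteq> carrier G"
    using A \<pi>(1) by (auto simp: Lab_def automaton_over_def hom_def Pi_def)
  define N where "N = mprod ` lists Lab"
  have N: "submonoid N G" and fgN: "finitely_generated_submonoid N G"
    using Lab submonoid_mprod_lists by (auto simp: N_def finitely_generated_submonoid_iff)
  then interpret N: submonoid N G by simp
  have \<pi>_label: "\<pi> c \<in> N" if "(p, c, q) \<in> edges A" for p c q
    proof -
    have "\<pi> c \<in> Lab" using that by (force simp: Lab_def)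
    then show ?thesis using Lab(2) by (auto simp: N_def intro!: rev_image_eqI[of "[\<pi> c]"])
  qed
  define H where "H = right_invertibles (G\<lparr>carrier := N\<rparr>)"
  have finH: "finite H" unfolding H_def by (rule fin[OF fgN])
  have H_iff: "h \<in> H \<longleftrightarrow> h \<in> N \<and> (\<exists>b \<in> N. h \<otimes> b = \<one>)" for h
    by (auto simp: H_def right_invertibles_def)
  have oneH: "\<one> \<in> H" by (auto simp: H_iff intro!: bexI[of _ \<one>])
  have H_prefix: "g \<in> H" if "g \<otimes> h \<in> H" "g \<in> N" "h \<in> N" for g h
  proof -
    obtain b where "b \<in> N" "g \<otimes> h \<otimes> b = \<one>" using \<open>g \<otimes> h \<in> H\<close> unfolding H_iff by blast
    then have "h \<otimes> b \<in> N" "g \<otimes> (h \<otimes> b) = \<one>" using that by (auto simp: m_assoc)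
    then show ?thesis using that by (auto simp: H_iff)
  qed
  have "finite (states A \<times> H)" using finH A by (auto simp: automaton_over_def)
  then obtain enc :: "state \<times> 'a \<Rightarrow> nat" where enc: "inj_on enc (states A \<times> H)"
    using finite_imp_inj_to_nat_seg by blast
  define E where "E = {(enc (p, h), \<rho> c, enc (q, h \<otimes> \<pi> c)) | p h c q.
    (p, c, q) \<in> edges A \<and> h \<in> H \<and> h \<otimes> \<pi> c \<in> H}"
  define B where "B = \<lparr>states = enc ` (states A \<times> H), edges = E, initial = enc (initial A, \<one>),
    finals = enc ` (finals A \<times> {\<one>})\<rparr>"
  have E_sub: "E \<subseteq> (\<lambda>((p, c, q), h). (enc (p, h), \<rho> c, enc (q, h \<otimes> \<pi> c))) ` (edges A \<times> H)"
    unfolding E_def by force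
  have "finite E" by (rule finite_subset[OF E_sub]) (use A finH in \<open>auto simp: automaton_over_def\<close>)
  have B: "automaton_over K' B"
    unfolding automaton_over_def
  proof (intro conjI)
    show "finite (states B)" using A finH by (auto simp: B_def automaton_over_def)
    show "finite (edges B)" using \<open>finite E\<close> by (simp add: B_def)
    show "edges B \<subseteq> states B \<times> carrier K' \<times> states B"
      using \<rho>(1) by (auto simp: B_def E_def hom_def Pi_def dest: K.edgeD)
    show "initial B \<in> states B" "finals B \<subseteq> states B"
      using A oneH by (auto simp: B_def automaton_over_def)
  qed
  interpret B: monoid_automaton K' B using K' B by (simp add: monoid_automaton_def monoid_automaton_axioms_def)
  have \<pi>_mult: "\<pi> (a \<otimes>\<^bsub>K\<^esub> b) = \<pi> a \<otimes> \<pi> b" and \<rho>_mult: "\<rho> (a \<otimes>\<^bsub>K\<^esub> b) = \<rho> a \<otimes>\<^bsub>K'\<^esub> \<rho> b"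
    if "a \<in> carrier K" "b \<in> carrier K" for a b
    using that \<pi>(1) \<rho>(1) by (auto simp: hom_def)
  have init: "initial A \<in> states A" using A by (simp add: automaton_over_def)
  have to_B: "\<pi> a \<in> N \<and> (\<pi> a \<in> H \<longrightarrow> path K' B (initial B) (\<rho> a) (enc (q, \<pi> a)))"
    if "path K A (initial A) a q" for a q
    using that
  proof (induction "initial A" a q rule: path.induct)
    case path_refl
    show ?case using \<pi> \<rho> path.path_refl[of K' B "initial B"] by (auto simp: B_def)
  next
    case (path_snoc a q c r)
    have car: "a \<in> carrier K" "c \<in> carrier K" using path_snoc K.path_closed K.edgeD by auto
    have cN: "\<pi> c \<in> N" using \<pi>_label path_snoc by blast
    have "path K' B (initial B) (\<rho> (a \<otimes>\<^bsub>K\<^esub> c)) (enc (r, \<pi> (a \<otimes>\<^bsub>K\<^esub> c)))" if "\<pi> (a \<otimes>\<^bsub>K\<^esub> c) \<in> H"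
    proof -
      have aH: "\<pi> a \<in> H" using H_prefix[of "\<pi> a" "\<pi> c"] that cN path_snoc \<pi>_mult car by auto
      then have "(enc (q, \<pi> a), \<rho> c, enc (r, \<pi> a \<otimes> \<pi> c)) \<in> edges B"
        using path_snoc that \<pi>_mult[OF car] by (auto simp: B_def E_def)
      then show ?thesis
        using path.path_snoc[of K' B _ "\<rho> a" "enc (q, \<pi> a)" "\<rho> c"] path_snoc aH
        by (simp add: \<pi>_mult[OF car] \<rho>_mult[OF car])
    qed
    then show ?case using path_snoc cN \<pi>_mult[OF car] by auto
  qed
  have from_B: "\<exists>p a. s = enc (p, \<pi> a) \<and> \<pi> a \<in> H \<and> b = \<rho> a \<and> path K A (initial A) a p"
    if "path K' B (initial B) b s" for b s
    using that
  proof (induction "initial B" b s rule: path.induct)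
    case path_refl
    then show ?case using \<pi> \<rho> oneH path.path_refl[of K A "initial A"]
      by (intro exI[of _ "initial A"] exI[of _ "\<one>\<^bsub>K\<^esub>"]) (auto simp: B_def)
  next
    case (path_snoc b s d r)
    then obtain p a where pa: "s = enc (p, \<pi> a)" "\<pi> a \<in> H" "b = \<rho> a" "path K A (initial A) a p"
      by blast
    from path_snoc(3) obtain p' h c q where e: "s = enc (p', h)" "d = \<rho> c" "r = enc (q, h \<otimes> \<pi> c)"
      "(p', c, q) \<in> edges A" "h \<in> H" "h \<otimes> \<pi> c \<in> H"
      by (auto simp: B_def E_def)
    have "p \<in> states A" "p' \<in> states A" using pa e K.path_state init K.edgeD by auto
    then have eq: "p' = p" "h = \<pi> a" using enc e pa by (auto simp: inj_on_def)
    have car: "a \<in> carrier K" "c \<in> carrier K" using pa e K.path_closed K.edgeD by auto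
    have "path K A (initial A) (a \<otimes>\<^bsub>K\<^esub> c) q" using pa e eq by (auto intro: path.path_snoc)
    then show ?case using e eq pa \<pi>_mult[OF car] \<rho>_mult[OF car] by metis
  qed
  have "accepted_elements K' B = \<rho> ` {a \<in> accepted_elements K A. \<pi> a = \<one>}" (is "?l = ?r")
  proof
    show "?l \<subseteq> ?r"
    proof
      fix b assume "b \<in> ?l"
      then obtain f where f: "f \<in> finals A" "path K' B (initial B) b (enc (f, \<one>))"
        unfolding B.accepted_elements_eq by (auto simp: B_def)
      then obtain p a where pa: "enc (f, \<one>) = enc (p, \<pi> a)" "\<pi> a \<in> H" "b = \<rho> a" "path K A (initial A) a p"
        using from_B by blast
      moreover have "p \<in> states A" "f \<in> states A"
        using pa f K.path_state init A by (auto simp: automaton_over_def)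
      ultimately have "p = f" "\<pi> a = \<one>" using enc oneH by (auto simp: inj_on_def)
      then show "b \<in> ?r" using pa f unfolding K.accepted_elements_eq by blast
    qed
    show "?r \<subseteq> ?l"
    proof
      fix b assume "b \<in> ?r"
      then obtain a f where "b = \<rho> a" "\<pi> a = \<one>" "f \<in> finals A" "path K A (initial A) a f"
        unfolding K.accepted_elements_eq by blast
      then show "b \<in> ?l" using to_B[of a f] oneH unfolding B.accepted_elements_eq by (auto simp: B_def)
    qed
  qed
  with B that show thesis by blast
qed

lemma free_monoid_simps [simp]:
  "carrier (free_monoid X) = lists X" "u \<otimes>\<^bsub>free_monoid X\<^esub> v = u @ v" "\<one>\<^bsub>free_monoid X\<^esub> = []"
  by (simp_all add: free_monoid_def)

lemma (in monoid) rational_transduction: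
  assumes fin: "\<And>N. finitely_generated_submonoid N G \<Longrightarrow> finite (right_invertibles (G\<lparr>carrier := N\<rparr>))"
    and A: "valence_transducer X Y G A"
  shows "rational_transduction (transduction X Y G A)"
proof -
  let ?K = "free_monoid X \<times>\<times> free_monoid Y \<times>\<times> G" and ?K' = "free_monoid X \<times>\<times> free_monoid Y \<times>\<times> trivial_monoid"
  have over: "finite X" "finite Y" "automaton_over ?K A" using A by (auto simp: valence_transducer_def)
  obtain B where B: "automaton_over ?K' B"
    "accepted_elements ?K' B = (\<lambda>(x, y, m). (x, y, ())) ` {a \<in> accepted_elements ?K A. snd (snd a) = \<one>}"
    by (rule automaton_with_finite_memory[where \<pi> = "\<lambda>a. snd (snd a)" and \<rho> = "\<lambda>(x, y, m). (x, y, ())",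
          OF _ _ over(3) _ _ _ _ fin])
      (auto simp: hom_def DirProd_monoid monoid_free_monoid monoid_trivial_monoid monoid_axioms)
  have "transduction X Y G A = transduction X Y trivial_monoid B"
    unfolding transduction_def B(2) by force
  moreover have "valence_transducer X Y trivial_monoid B" using over B by (simp add: valence_transducer_def)
  ultimately show ?thesis unfolding rational_transduction_def by blast
qed

text \<open>With the trivial monoid as memory, \<open>automaton_with_finite_memory\<close> merely
  relabels the edges along the homomorphism \<open>\<rho>\<close>; here \<open>\<rho>\<close> erases
  the output.\<close>

lemma regular_language_domain:
  assumes "rational_transduction T"
  shows "regular_language (fst ` T)"
proof -
  obtain X Y A where A: "valence_transducer X Y trivial_monoid A" and T: "T = transduction X Y trivial_monoid A"
    using assms by (auto simp: rational_transduction_def)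
  let ?K = "free_monoid X \<times>\<times> free_monoid Y \<times>\<times> trivial_monoid" and ?K' = "free_monoid X \<times>\<times> trivial_monoid"
  have over: "finite X" "automaton_over ?K A" using A by (auto simp: valence_transducer_def)
  obtain B where B: "automaton_over ?K' B"
    "accepted_elements ?K' B = (\<lambda>(x, y, m). (x, m)) ` {a \<in> accepted_elements ?K A. snd (snd a) = ()}"
    by (rule monoid.automaton_with_finite_memory[OF monoid_trivial_monoid, where \<pi> = "\<lambda>a. snd (snd a)"
          and \<rho> = "\<lambda>(x, y, m). (x, m)", OF _ _ over(2)])
      (auto simp: hom_def DirProd_monoid monoid_free_monoid monoid_trivial_monoid)
  have "accepted_elements ?K A \<subseteq> lists X \<times> lists Y \<times> UNIV"
    by (auto simp: accepted_elements_def)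
  then have "fst ` T = automaton_language X trivial_monoid B"
    unfolding automaton_language_def B(2) T transduction_def by (force simp: image_iff)
  moreover have "valence_automaton X trivial_monoid B" using over B by (simp add: valence_automaton_def)
  ultimately show ?thesis unfolding regular_language_def by blast
qed

text \<open>An automaton is a transducer over the empty output alphabet; the relabelling by
  \<open>\<rho>\<close> adds the empty output word and keeps the valence.\<close>

lemma (in monoid) regular_if_transductions_rational:
  assumes rat: "\<And>X Y A. valence_transducer X Y G A \<Longrightarrow> rational_transduction (transduction X Y G A)"
    and A: "valence_automaton X G A"
  shows "regular_language (automaton_language X G A)"
proof -
  let ?K = "free_monoid X \<times>\<times> G" and ?K' = "free_monoid X \<times>\<times> free_monoid ({} :: symbol set) \<times>\<times> G"
  have over: "finite X" "automaton_over ?K A" using A by (auto simp: valence_automaton_def)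
  obtain B where B: "automaton_over ?K' B"
    "accepted_elements ?K' B = (\<lambda>(x, m). (x, [], m)) ` {a \<in> accepted_elements ?K A. () = ()}"
    by (rule monoid.automaton_with_finite_memory[OF monoid_trivial_monoid, where \<pi> = "\<lambda>a. ()"
          and \<rho> = "\<lambda>(x, m). (x, [], m)", OF _ _ over(2), of ?K'])
      (auto simp: hom_def DirProd_monoid monoid_free_monoid monoid_trivial_monoid monoid_axioms)
  have "automaton_language X G A = fst ` transduction X {} G B"
    unfolding automaton_language_def transduction_def B(2) by (force simp: image_iff)
  moreover have "valence_transducer X {} G B" using over B by (simp add: valence_transducer_def)
  ultimately show ?thesis using rat regular_language_domain by metis
qed

section \<open>Determinization\<close>

definition residual :: "'a list set \<Rightarrow> 'a list \<Rightarrow> 'a list set" where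
  "residual L u = {w. u @ w \<in> L}"

lemma residual_Nil [simp]: "residual L [] = L"
  by (simp add: residual_def)

lemma residual_append: "residual L (u @ v) = residual (residual L u) v"
  by (simp add: residual_def)

text \<open>After reading \<open>u\<close> the automaton is in the middle of some edge; the pairs of the target state and
  the unread rest of the label determine the residual.\<close>

lemma finite_residuals_of_regular:
  assumes "regular_language L"
  shows "finite (range (residual L))" "\<exists>X. finite X \<and> L \<subseteq> lists X"
proof -
  obtain X A where A: "valence_automaton X trivial_monoid A" and L: "L = automaton_language X trivial_monoid A"
    using assms by (auto simp: regular_language_def)
  let ?K = "free_monoid X \<times>\<times> trivial_monoid"
  have X: "finite X" and over: "automaton_over ?K A" using A by (auto simp: valence_automaton_def)
  show "\<exists>X. finite X \<and> L \<subseteq> lists X" using X L by (auto simp: automaton_language_def)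
  interpret monoid_automaton ?K A
    using over by (simp add: monoid_automaton_def monoid_automaton_axioms_def DirProd_monoid
        monoid_free_monoid monoid_trivial_monoid)
  define Mid where "Mid = states A \<times> (insert [] (\<Union>(p, c, q) \<in> edges A. set (suffixes (fst c))))"
  have "finite Mid" using over by (auto simp: Mid_def automaton_over_def)
  define C where "C u = {(q, s) \<in> Mid. path ?K A (initial A) (u @ s, ()) q}" for u
  define R where "R S = {s @ w | s w q f. (q, s) \<in> S \<and> f \<in> finals A \<and> path ?K A q (w, ()) f}" for S
  have init: "initial A \<in> states A" using over by (simp add: automaton_over_def)
  have L_iff: "w \<in> L \<longleftrightarrow> (\<exists>f \<in> finals A. path ?K A (initial A) (w, ()) f)" for w
    using path_closed by (fastforce simp: L automaton_language_def accepted_elements_eq)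
  have split: "\<exists>q s w'. w = s @ w' \<and> (q, s) \<in> C u \<and> path ?K A q (w', ()) f"
    if "path ?K A (initial A) (u @ w, ()) f" for u w f
    using that
  proof (induction "initial A" "(u @ w, ())" f arbitrary: w rule: path.induct)
    case path_refl
    moreover have "path ?K A (initial A) ([], ()) (initial A)" using path.path_refl[of ?K A "initial A"] by simp
    ultimately show ?case using init
      by (intro exI[of _ "initial A"] exI[of _ "[]"]) (auto simp: C_def Mid_def)
  next
    case (path_snoc a q c r)
    obtain z x where zx: "a = (z, ())" "c = (x, ())" by (metis prod.exhaust_sel unit.exhaust)
    then have "z @ x = u @ w" using path_snoc(4) by simp
    \<comment> \<open>Labels are words, so the cut after \<open>u\<close> lies either before the
      last label or inside it; in the second case \<open>Mid\<close> records the rest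
      \<open>w\<close> of that label.\<close>
    then consider y where "z = u @ y" "w = y @ x" | y where "u = z @ y" "x = y @ w"
      by (auto simp: append_eq_append_conv2)
    then show ?case
    proof cases
      case 1
      then obtain q' s w' where "y = s @ w'" "(q', s) \<in> C u" "path ?K A q' (w', ()) q"
        using path_snoc(2)[of y] zx by auto
      then show ?thesis using path.path_snoc[OF _ path_snoc(3), of ?K q' "(w', ())"] 1 zx by auto
    next
      case 2
      have "(r, w) \<in> Mid" using path_snoc(3) edgeD(3) zx 2 by (force simp: Mid_def suffix_def)
      moreover have "path ?K A (initial A) (u @ w, ()) r"
        using path.path_snoc[OF path_snoc(1,3)] zx 2 by simp
      ultimately have "(r, w) \<in> C u" by (simp add: C_def)
      moreover have "path ?K A r ([], ()) r" using path.path_refl[of ?K A r] by simp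
      ultimately show ?thesis by (metis append_Nil2)
    qed
  qed
  have "residual L u = R (C u)" for u
  proof
    show "residual L u \<subseteq> R (C u)"
      unfolding residual_def R_def using L_iff split by blast
    show "R (C u) \<subseteq> residual L u"
    proof
      fix z assume "z \<in> R (C u)"
      then obtain s w q f where "z = s @ w" "path ?K A (initial A) (u @ s, ()) q" "f \<in> finals A"
        "path ?K A q (w, ()) f" by (auto simp: R_def C_def)
      then show "z \<in> residual L u" using path_append[of q "(w, ())" f "initial A" "(u @ s, ())"] L_iff
        by (auto simp: residual_def)
    qed
  qed
  then have "range (residual L) \<subseteq> R ` Pow Mid" by (auto simp: C_def)
  then show "finite (range (residual L))" using \<open>finite Mid\<close> by (meson finite_Pow_iff finite_imageI finite_subset)
qed

text \<open>The Myhill-Nerode construction with residuals as states; every edge carries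
  \<open>\<one>\<close>, so it works over any monoid.\<close>

lemma (in monoid) deterministic_automaton_of_regular:
  assumes "regular_language L"
  shows "\<exists>Y B. deterministic_valence_automaton Y G B \<and> automaton_language Y G B = L"
proof -
  obtain X where X: "finite X" "L \<subseteq> lists X" using finite_residuals_of_regular(2)[OF assms] by blast
  have fin: "finite (range (residual L))" by (rule finite_residuals_of_regular(1)[OF assms])
  then obtain enc :: "word set \<Rightarrow> nat" where enc: "inj_on enc (range (residual L))"
    using finite_imp_inj_to_nat_seg[OF fin] by metis
  let ?K = "free_monoid X \<times>\<times> G"
  define E where "E = (\<lambda>(R, x). (enc R, ([x], \<one>), enc (residual R [x]))) ` (range (residual L) \<times> X)"
  define B where "B = \<lparr>states = enc ` range (residual L), edges = E, initial = enc L,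
    finals = enc ` {R \<in> range (residual L). [] \<in> R}\<rparr>"
  have closed: "residual R v \<in> range (residual L)" if "R \<in> range (residual L)" for R v
  proof -
    obtain u where "R = residual L u" using \<open>R \<in> range (residual L)\<close> by blast
    then show ?thesis by (metis rangeI residual_append)
  qed
  have L_mem: "L \<in> range (residual L)" using rangeI[of "residual L" "[]"] by simp
  have over: "automaton_over ?K B"
    unfolding automaton_over_def
  proof (intro conjI)
    show "finite (states B)" "finite (edges B)" using fin X(1) by (simp_all add: B_def E_def)
    show "edges B \<subseteq> states B \<times> carrier ?K \<times> states B" using closed by (auto simp: B_def E_def)
    show "initial B \<in> states B" "finals B \<subseteq> states B" using L_mem by (auto simp: B_def)
  qed
  interpret B: monoid_automaton ?K B
    using over by (simp add: monoid_automaton_def monoid_automaton_axioms_def DirProd_monoid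
        monoid_free_monoid monoid_axioms)
  have det: "deterministic_valence_automaton X G B"
    unfolding deterministic_valence_automaton_def valence_automaton_def
  proof (intro conjI ballI allI impI)
    show "finite X" "automaton_over ?K B" by fact+
    show "edges B \<subseteq> states B \<times> ((\<lambda>x. [x]) ` X \<times> carrier G) \<times> states B"
      using closed by (auto simp: B_def E_def)
  next
    fix q x m p m' p'
    assume "(q, ([x], m), p) \<in> edges B \<and> (q, ([x], m'), p') \<in> edges B"
    then obtain R R' where "R \<in> range (residual L)" "R' \<in> range (residual L)" "enc R = enc R'"
      "m = \<one>" "m' = \<one>" "p = enc (residual R [x])" "p' = enc (residual R' [x])"
      unfolding B_def E_def by auto
    moreover from this(1-3) have "R = R'" using enc by (simp only: inj_on_eq_iff)
    ultimately show "m = m'" "p = p'" by simp_all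
  qed
  have path_iff: "path ?K B (initial B) (w, m) s \<longleftrightarrow> w \<in> lists X \<and> m = \<one> \<and> s = enc (residual L w)" for w m s
  proof
    assume "path ?K B (initial B) (w, m) s"
    then show "w \<in> lists X \<and> m = \<one> \<and> s = enc (residual L w)"
    proof (induction "initial B" "(w, m)" s arbitrary: w m rule: path.induct)
      case path_refl then show ?case by (auto simp: B_def)
    next
      case (path_snoc a q c r)
      obtain z k where a: "a = (z, k)" by fastforce
      obtain R x where R: "q = enc R" "c = ([x], \<one>)" "r = enc (residual R [x])" "R \<in> range (residual L)" "x \<in> X"
        using path_snoc(3) by (auto simp: B_def E_def)
      have z: "z \<in> lists X" "k = \<one>" "q = enc (residual L z)" using path_snoc(2)[OF a] by auto
      then have "R = residual L z" using enc R by (auto simp: inj_on_def)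
      then show ?case using path_snoc(4) R z a by (auto simp: residual_append)
    qed
  next
    assume asm: "w \<in> lists X \<and> m = \<one> \<and> s = enc (residual L w)"
    then have "w \<in> lists X" by simp
    then have "path ?K B (initial B) (w, \<one>) (enc (residual L w))"
    proof (induction w rule: rev_induct)
      case Nil then show ?case using path.path_refl[of ?K B "initial B"] by (simp add: B_def)
    next
      case (snoc x w)
      have "(enc (residual L w), ([x], \<one>), enc (residual L (w @ [x]))) \<in> edges B"
        using snoc by (force simp: B_def E_def residual_append)
      then show ?case using path.path_snoc[of ?K B "initial B" "(w, \<one>)" "enc (residual L w)" "([x], \<one>)"] snoc
        by auto
    qed
    with asm show "path ?K B (initial B) (w, m) s" by simp
  qed
  have "w \<in> automaton_language X G B \<longleftrightarrow> w \<in> L" for w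
  proof -
    have "w \<in> automaton_language X G B \<longleftrightarrow> w \<in> lists X \<and> enc (residual L w) \<in> finals B"
      by (auto simp: automaton_language_def B.accepted_elements_eq path_iff)
    also have "\<dots> \<longleftrightarrow> w \<in> lists X \<and> [] \<in> residual L w"
      using enc by (auto simp: B_def inj_on_def)
    also have "\<dots> \<longleftrightarrow> w \<in> L" using X(2) by (auto simp: residual_def)
    finally show ?thesis .
  qed
  with det show ?thesis by blast
qed

text \<open>A deterministic automaton accepting \<open>{w. mprod (map ev w) = \<one>} \<union> X*\<close> must have valence \<open>\<one>\<close>
  after each word over \<open>X\<close>, so only the state is left to remember the value of this word.\<close>

lemma (in monoid) finite_right_invertibles_if_determinizable:
  assumes det: "\<And>X A. valence_automaton X G A \<Longrightarrow>
      \<exists>Y B. deterministic_valence_automaton Y G B \<and> automaton_language Y G B = automaton_language X G A"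
    and N: "finitely_generated_submonoid N G"
  shows "finite (right_invertibles (G\<lparr>carrier := N\<rparr>))"
proof -
  interpret N: submonoid N G by (rule submonoid_if_finitely_generated[OF N])
  obtain X Y :: "symbol set" and ev where fin: "finite X" "finite Y" and disj: "X \<inter> Y = {}"
    and ev: "ev ` (X \<union> Y) \<subseteq> N"
    and X_word: "\<And>a. a \<in> N \<Longrightarrow> \<exists>u \<in> lists X. mprod (map ev u) = a"
    and Y_word: "\<And>a. a \<in> N \<Longrightarrow> \<exists>v \<in> lists Y. v \<noteq> [] \<and> mprod (map ev v) = a"
    using generating_alphabets[OF N] by metis
  have ev_N: "ev x \<in> N" "ev x \<in> carrier G" if "x \<in> X \<union> Y" for x using that ev N.subset by auto
  let ?K = "free_monoid (X \<union> Y) \<times>\<times> G"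
  \<comment> \<open>State \<open>0\<close> evaluates the input by \<open>ev\<close>; the empty label
    leads to state \<open>1\<close>, which reads letters of \<open>X\<close> at no cost. Thus all of
    \<open>lists X\<close> is accepted.\<close>
  define A where "A = \<lparr>states = {0, 1 :: nat},
    edges = (\<lambda>x. (0, ([x], ev x), 0)) ` (X \<union> Y) \<union> {(0, ([], \<one>), 1)} \<union> (\<lambda>x. (1, ([x], \<one>), 1)) ` X,
    initial = 0, finals = {0, 1}\<rparr>"
  have A: "valence_automaton (X \<union> Y) G A"
    using fin ev_N by (auto simp: valence_automaton_def automaton_over_def A_def)
  interpret A: monoid_automaton ?K A
    using A by (simp add: monoid_automaton_def monoid_automaton_axioms_def DirProd_monoid
        monoid_free_monoid monoid_axioms valence_automaton_def)
  have map_closed: "set (map ev w) \<subseteq> carrier G" if "w \<in> lists (X \<union> Y)" for w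
    using that ev_N by auto
  have mprod_car: "mprod (map ev w) \<in> carrier G" if "w \<in> lists (X \<union> Y)" for w
    using mprod_closed map_closed that by blast
  have mprod_snoc: "mprod (map ev w @ [ev x]) = mprod (map ev w) \<otimes> ev x"
    if "w \<in> lists (X \<union> Y)" "x \<in> X \<union> Y" for w x
    using mprod_append[OF map_closed, OF that(1), of "[ev x]"] ev_N that(2) by simp
  have path_0: "w \<in> lists (X \<union> Y) \<Longrightarrow> path ?K A 0 (w, mprod (map ev w)) 0" for w
  proof (induction w rule: rev_induct)
    case Nil then show ?case using path.path_refl[of ?K A 0] by simp
  next
    case (snoc x w)
    have "(0, ([x], ev x), 0) \<in> edges A" using snoc by (auto simp: A_def)
    with snoc show ?case using path.path_snoc[of ?K A 0 "(w, mprod (map ev w))" 0 "([x], ev x)" 0]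
      by (simp add: mprod_snoc)
  qed
  have path_1: "w \<in> lists X \<Longrightarrow> path ?K A 0 (w, \<one>) 1" for w
  proof (induction w rule: rev_induct)
    case Nil
    have "(0, ([], \<one>), 1) \<in> edges A" by (auto simp: A_def)
    then show ?case using A.path_edge by blast
  next
    case (snoc x w)
    have "(1, ([x], \<one>), 1) \<in> edges A" using snoc by (auto simp: A_def)
    with snoc show ?case using path.path_snoc[of ?K A 0 "(w, \<one>)" 1 "([x], \<one>)" 1] by auto
  qed
  have path_inv: "w \<in> lists (X \<union> Y) \<and> (q = 0 \<and> m = mprod (map ev w) \<or>
      q = 1 \<and> (\<exists>u v. w = u @ v \<and> v \<in> lists X \<and> m = mprod (map ev u)))"
    if "path ?K A 0 (w, m) q" for w m q
    using that
  proof (induction "0 :: nat" "(w, m)" q arbitrary: w m rule: path.induct)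
    case path_refl then show ?case by simp
  next
    case (path_snoc a q c r)
    obtain z k where a: "a = (z, k)" by fastforce
    note IH = path_snoc(2)[OF a]
    from path_snoc(3) consider (1) x where "x \<in> X \<union> Y" "q = 0" "c = ([x], ev x)" "r = 0"
      | (2) "q = 0" "c = ([], \<one>)" "r = 1" | (3) x where "x \<in> X" "q = 1" "c = ([x], \<one>)" "r = 1"
      by (auto simp: A_def)
    then show ?case
    proof cases
      case 1
      then have "z \<in> lists (X \<union> Y)" "k = mprod (map ev z)" using IH by auto
      then show ?thesis using mprod_snoc[of z x] 1 path_snoc(4) a by auto
    next
      case 2
      then have "w = z" "m = mprod (map ev z)" using IH path_snoc(4) a by (auto simp: mprod_car)
      with 2 show ?thesis using IH by (intro conjI disjI2 exI[of _ z] exI[of _ "[]"]) auto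
    next
      case 3
      then obtain u v where "z = u @ v" "v \<in> lists X" "k = mprod (map ev u)" using IH by auto
      then show ?thesis using 3 IH path_snoc(4) a
        by (intro conjI disjI2 exI[of _ u] exI[of _ "v @ [x]"]) (auto simp: mprod_car)
    qed
  qed
  define L where "L = automaton_language (X \<union> Y) G A"
  have "initial A = 0" "finals A = {0, 1}" by (simp_all add: A_def)
  then have L_iff: "w \<in> L \<longleftrightarrow> w \<in> lists (X \<union> Y) \<and> (\<exists>q \<in> {0, 1}. path ?K A 0 (w, \<one>) q)" for w
    unfolding L_def automaton_language_def A.accepted_elements_eq by simp
  have L_X: "u \<in> L" if "u \<in> lists X" for u
  proof -
    have "u \<in> lists (X \<union> Y)" using that by auto
    then show ?thesis using path_1[OF that] unfolding L_iff by blast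
  qed
  \<comment> \<open>State \<open>1\<close> may also be entered after a nonempty word of value
    \<open>\<one>\<close>, so \<open>L\<close> has further members. They do not interfere here: what
    is read in state \<open>1\<close> consists of letters of \<open>X\<close>, hence is empty if the
    input ends in \<open>Y\<close>.\<close>
  have L_Y: "w @ v \<in> L \<longleftrightarrow> mprod (map ev (w @ v)) = \<one>"
    if wv: "w \<in> lists X" "v \<in> lists Y" "v \<noteq> []" for w v
  proof
    assume "w @ v \<in> L"
    then obtain q where "path ?K A 0 (w @ v, \<one>) q"
      unfolding L_iff by blast
    then consider "\<one> = mprod (map ev (w @ v))"
      | u' v' where "w @ v = u' @ v'" "v' \<in> lists X" "\<one> = mprod (map ev u')"
      using path_inv by blast
    then show "mprod (map ev (w @ v)) = \<one>"
    proof cases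
      case 2
      have "v' = []"
      proof (rule ccontr)
        assume "v' \<noteq> []"
        then have "last v' = last v" using 2(1) wv(3) by (metis last_appendR)
        moreover have "last v \<in> Y" "last v' \<in> X"
          using 2(2) wv(2,3) \<open>v' \<noteq> []\<close> last_in_set[of v] last_in_set[of v'] by (auto simp: lists_eq_set)
        ultimately show False using disj by auto
      qed
      then show ?thesis using 2 by simp
    qed simp
  next
    assume "mprod (map ev (w @ v)) = \<one>"
    moreover have "w @ v \<in> lists (X \<union> Y)" using wv by auto
    ultimately show "w @ v \<in> L" using path_0[of "w @ v"] unfolding L_iff by auto
  qed
  obtain Z B where B: "deterministic_valence_automaton Z G B" and L_B: "automaton_language Z G B = L"
    using det[OF A] by (auto simp: L_def)
  let ?Z = "free_monoid Z \<times>\<times> G"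
  interpret B: monoid_automaton ?Z B
    using B by (simp add: monoid_automaton_def monoid_automaton_axioms_def DirProd_monoid
        monoid_free_monoid monoid_axioms valence_automaton_def deterministic_valence_automaton_def)
  have letter: "\<exists>x m. x \<in> Z \<and> m \<in> carrier G \<and> c = ([x], m)" if "(p, c, q) \<in> edges B" for p c q
    using B that unfolding deterministic_valence_automaton_def by fastforce
  have functional: "m = m' \<and> p = p'" if "(q, ([x], m), p) \<in> edges B" "(q, ([x], m'), p') \<in> edges B" for q x m p m' p'
  proof -
    have "q \<in> states B" using B.edgeD[OF that(1)] by simp
    moreover have "x \<in> Z" using letter[OF that(1)] by auto
    ultimately show ?thesis using B that unfolding deterministic_valence_automaton_def by blast
  qed
  \<comment> \<open>Each edge reads exactly one letter, so a word determines its run from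
    \<open>q\<close>, including the valence.\<close>
  have unique: "m = m' \<and> p = p'" if "path ?Z B q (w, m) p" "path ?Z B q (w, m') p'" for q w m m' p p'
    using that
  proof (induction q "(w, m)" p arbitrary: w m m' p' rule: path.induct)
    case (path_refl q)
    from path_refl(2) show ?case using path_refl(1) letter
      by (cases rule: path.cases) fastforce+
  next
    case (path_snoc q a p c r)
    obtain z k where a: "a = (z, k)" by fastforce
    obtain x l where c: "c = ([x], l)" using letter[OF path_snoc(3)] by blast
    note outer = path_snoc
    from path_snoc(5) show ?case
    proof (cases rule: path.cases)
      case path_refl then show ?thesis using outer(4) a c by simp
    next
      case (path_snoc a' p2 c')
      obtain z' k' where a': "a' = (z', k')" by fastforce
      obtain x' l' where c': "c' = ([x'], l')" using letter[OF path_snoc(3)] by blast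
      have "z' = z" "x' = x" using outer(4) path_snoc(1) a c a' c' by auto
      then have "k = k' \<and> p = p2" using outer(2)[OF a] path_snoc(2) a' by blast
      moreover from this have "l = l' \<and> r = p'"
        using functional outer(3) path_snoc(3) c c' \<open>x' = x\<close> by blast
      ultimately show ?thesis using outer(4) path_snoc(1) a c a' c' by simp
    qed
  qed
  have split: "\<exists>p m k. path ?Z B q (u, k) p \<and> path ?Z B p (v, m) f" if "path ?Z B q (u @ v, l) f" for q u v l f
    using that
  proof (induction v arbitrary: l f rule: rev_induct)
    case Nil
    then show ?case using path.path_refl[of ?Z B f] by auto
  next
    case (snoc y v)
    from snoc.prems show ?case
    proof (cases rule: path.cases)
      case (path_snoc a p c)
      obtain z k where a: "a = (z, k)" by fastforce
      obtain x j where c: "c = ([x], j)" using letter[OF path_snoc(3)] by blast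
      have "z = u @ v" "x = y" using path_snoc(1) a c by auto
      then obtain p' m i where "path ?Z B q (u, i) p'" "path ?Z B p' (v, m) p"
        using snoc.IH path_snoc(2) a by blast
      then show ?thesis using path.path_snoc[OF _ path_snoc(3), of ?Z p' "(v, m)"] c \<open>x = y\<close> by auto
    qed simp
  qed
  \<comment> \<open>Acceptance of \<open>u\<close> means a run of valence \<open>\<one>\<close>, and
    the run on \<open>u\<close> is unique; so only the state reached can remember
    \<open>u\<close>.\<close>
  have "\<exists>q. path ?Z B (initial B) (u, \<one>) q" if "u \<in> lists X" for u
    using L_X[OF that] by (auto simp: L_B[symmetric] automaton_language_def B.accepted_elements_eq)
  then obtain st where st: "\<And>u. u \<in> lists X \<Longrightarrow> path ?Z B (initial B) (u, \<one>) (st u)" by metis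
  have transfer: "u' @ v \<in> L" if tr: "u \<in> lists X" "u' \<in> lists X" "st u = st u'" "u @ v \<in> L" for u u' v
  proof -
    obtain f where f: "f \<in> finals B" "path ?Z B (initial B) (u @ v, \<one>) f"
      using tr(4) by (auto simp: L_B[symmetric] automaton_language_def B.accepted_elements_eq)
    obtain p m k where p: "path ?Z B (initial B) (u, k) p" "path ?Z B p (v, m) f" using split[OF f(2)] by blast
    have eq: "k = \<one>" "p = st u" using unique[OF p(1) st[OF tr(1)]] by auto
    have m: "m \<in> carrier G" using B.path_closed[OF p(2)] by simp
    have "path ?Z B (initial B) (u @ v, m) f"
      using B.path_append[OF p(2,1)] eq m by simp
    then have "m = \<one>" using unique f(2) by blast
    then have "path ?Z B (initial B) (u' @ v, \<one>) f"
      using B.path_append[OF p(2), of "initial B" "(u', \<one>)"] st[OF tr(2)] tr(3) eq by simp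
    then show ?thesis using f(1) B.path_closed
      by (fastforce simp: L_B[symmetric] automaton_language_def B.accepted_elements_eq)
  qed
  interpret S: monoid "G\<lparr>carrier := N\<rparr>" by (rule submonoid.submonoid_is_monoid[OF N.submonoid_axioms monoid_axioms])
  have ri: "a \<in> right_invertibles (G\<lparr>carrier := N\<rparr>) \<longleftrightarrow> a \<in> N \<and> (\<exists>b \<in> N. a \<otimes> b = \<one>)" for a
    by (auto simp: right_invertibles_def)
  \<comment> \<open>For each state one element is fixed that is inverse to some word over
    \<open>X\<close> leading there; by \<open>transfer\<close> it is inverse to all of them.\<close>
  define inverse_at where "inverse_at q b \<longleftrightarrow> b \<in> N \<and> (\<exists>u \<in> lists X. st u = q \<and> mprod (map ev u) \<otimes> b = \<one>)" for q b
  define C where "C = (\<lambda>q. SOME b. inverse_at q b) ` {q \<in> states B. \<exists>b. inverse_at q b}"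
  have C_mem: "(SOME b. inverse_at q b) \<in> N" if "\<exists>b. inverse_at q b" for q
    using someI_ex[OF that] by (simp add: inverse_at_def)
  have "finite (states B)" using B.automaton_over by (simp add: automaton_over_def)
  then have "finite C" by (simp add: C_def)
  moreover have "C \<subseteq> carrier (G\<lparr>carrier := N\<rparr>)" using C_mem by (auto simp: C_def)
  moreover have "\<forall>a \<in> right_invertibles (G\<lparr>carrier := N\<rparr>). \<exists>c \<in> C. a \<otimes>\<^bsub>G\<lparr>carrier := N\<rparr>\<^esub> c = \<one>\<^bsub>G\<lparr>carrier := N\<rparr>\<^esub>"
  proof
    fix a assume "a \<in> right_invertibles (G\<lparr>carrier := N\<rparr>)"
    then obtain b where ab: "a \<in> N" "b \<in> N" "a \<otimes> b = \<one>" using ri by blast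
    obtain u where u: "u \<in> lists X" "mprod (map ev u) = a" using X_word ab by blast
    define c where "c = (SOME b. inverse_at (st u) b)"
    have ex: "\<exists>b. inverse_at (st u) b" using ab u by (auto simp: inverse_at_def)
    have "st u \<in> states B" using B.path_state[OF st[OF u(1)]] B.automaton_over by (simp add: automaton_over_def)
    then have cC: "c \<in> C" using ex by (auto simp: C_def c_def)
    have "inverse_at (st u) c" using someI_ex[OF ex] by (simp add: c_def)
    then obtain u' where u': "c \<in> N" "u' \<in> lists X" "st u' = st u" "mprod (map ev u') \<otimes> c = \<one>"
      by (auto simp: inverse_at_def)
    obtain v where v: "v \<in> lists Y" "v \<noteq> []" "mprod (map ev v) = c" using Y_word u'(1) by blast
    have mp: "mprod (map ev (w @ v)) = mprod (map ev w) \<otimes> c" if "w \<in> lists X" for w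
    proof -
      have "w \<in> lists (X \<union> Y)" "v \<in> lists (X \<union> Y)" using that v(1) by auto
      then show ?thesis using mprod_append[of "map ev w" "map ev v"] map_closed v(3) by simp
    qed
    have "u' @ v \<in> L" using L_Y[OF u'(2) v(1,2)] mp[OF u'(2)] u'(4) by simp
    then have "u @ v \<in> L" using transfer u' u by blast
    then have "a \<otimes> c = \<one>" using L_Y[OF u(1) v(1,2)] mp[OF u(1)] u(2) by simp
    then show "\<exists>c \<in> C. a \<otimes>\<^bsub>G\<lparr>carrier := N\<rparr>\<^esub> c = \<one>\<^bsub>G\<lparr>carrier := N\<rparr>\<^esub>" using cC by auto
  qed
  ultimately show ?thesis by (rule S.finite_right_invertibles_if_finite_inverses)
qed

section \<open>Derivations and derivation trees\<close>

lemma Cons_in_shufflesE: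
  assumes "z # zs \<in> shuffles xs ys"
  obtains (left) xs' where "xs = z # xs'" "zs \<in> shuffles xs' ys"
    | (right) ys' where "ys = z # ys'" "zs \<in> shuffles xs ys'"
proof -
  from assms consider "xs \<noteq> []" "hd xs = z" "zs \<in> shuffles (tl xs) ys"
    | "ys \<noteq> []" "hd ys = z" "zs \<in> shuffles xs (tl ys)"
    unfolding Cons_in_shuffles_iff by blast
  then show thesis
  proof cases
    case 1
    then have "xs = z # tl xs" by (metis list.collapse)
    then show thesis using 1(3) by (rule left)
  next
    case 2
    then have "ys = z # tl ys" by (metis list.collapse)
    then show thesis using 2(3) by (rule right)
  qed
qed

lemma shuffles_assoc_ex:
  "z \<in> shuffles y c \<Longrightarrow> y \<in> shuffles a b \<Longrightarrow> \<exists>x \<in> shuffles b c. z \<in> shuffles a x"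
proof (induction z arbitrary: y a b c)
  case Nil then show ?case by simp
next
  case (Cons e z)
  from Cons.prems(1) show ?case
  proof (cases rule: Cons_in_shufflesE)
    case (left y')
    from Cons.prems(2)[unfolded left(1)] show ?thesis
    proof (cases rule: Cons_in_shufflesE)
      case (left a')
      then obtain x where "x \<in> shuffles b c" "z \<in> shuffles a' x"
        using Cons.IH[OF \<open>z \<in> shuffles y' c\<close>, of a' b] by blast
      then show ?thesis unfolding left(1) by (intro bexI[of _ x] Cons_in_shuffles_leftI)
    next
      case (right b')
      then obtain x where "x \<in> shuffles b' c" "z \<in> shuffles a x"
        using Cons.IH[OF \<open>z \<in> shuffles y' c\<close>, of a b'] by blast
      then show ?thesis unfolding right(1)
        by (intro bexI[of _ "e # x"] Cons_in_shuffles_leftI Cons_in_shuffles_rightI)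
    qed
  next
    case (right c')
    then obtain x where "x \<in> shuffles b c'" "z \<in> shuffles a x"
      using Cons.IH[OF right(2) Cons.prems(2)] by blast
    then show ?thesis unfolding right(1)
      by (intro bexI[of _ "e # x"] Cons_in_shuffles_rightI)
  qed
qed

definition Shuffle :: "'a list set \<Rightarrow> 'a list set \<Rightarrow> 'a list set" where
  "Shuffle K L = (\<Union>u \<in> K. \<Union>v \<in> L. shuffles u v)"

lemma Shuffle_iff: "w \<in> Shuffle K L \<longleftrightarrow> (\<exists>u \<in> K. \<exists>v \<in> L. w \<in> shuffles u v)"
  by (auto simp: Shuffle_def)

lemma Shuffle_commute: "Shuffle K L = Shuffle L K"
  unfolding Shuffle_def using shuffles_commutes by blast

lemma Shuffle_Nil [simp]: "Shuffle {[]} K = K"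
  by (auto simp: Shuffle_iff)

lemma Shuffle_assoc: "Shuffle (Shuffle J K) L = Shuffle J (Shuffle K L)"
proof -
  have sub: "Shuffle (Shuffle J K) L \<subseteq> Shuffle J (Shuffle K L)" for J K L :: "'a list set"
  proof
    fix w assume "w \<in> Shuffle (Shuffle J K) L"
    then obtain a b c y where "a \<in> J" "b \<in> K" "c \<in> L" "y \<in> shuffles a b" "w \<in> shuffles y c"
      unfolding Shuffle_def by blast
    moreover from this obtain x where "x \<in> shuffles b c" "w \<in> shuffles a x"
      using shuffles_assoc_ex by blast
    ultimately show "w \<in> Shuffle J (Shuffle K L)" unfolding Shuffle_def by blast
  qed
  have "Shuffle J (Shuffle K L) = Shuffle (Shuffle L K) J" by (simp only: Shuffle_commute)
  also have "\<dots> \<subseteq> Shuffle L (Shuffle K J)" by (rule sub)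
  also have "\<dots> = Shuffle (Shuffle J K) L" by (simp only: Shuffle_commute)
  finally show ?thesis using sub[of J K L] by blast
qed

lemma Shuffle_Cons: "v \<in> Shuffle K L \<Longrightarrow> m # v \<in> Shuffle ((#) m ` K) L"
  by (auto simp: Shuffle_iff intro: Cons_in_shuffles_leftI)

text \<open>Valences are listed in the order of application instead of being multiplied, so that a
  derivation can be compared with the reorderings of its tree. \<open>derives_refl\<close> admits
  terminal words only, hence every derivation is complete.\<close>

inductive derives :: "(symbol \<times> word \<times> 'm) set \<Rightarrow> symbol set \<Rightarrow> word \<Rightarrow> word \<Rightarrow> 'm list \<Rightarrow> bool"
  for P T where
  derives_refl: "w \<in> lists T \<Longrightarrow> derives P T w w []"
| derives_step: "(A, \<gamma>, m) \<in> P \<Longrightarrow> derives P T (r @ \<gamma> @ s) w v \<Longrightarrow> derives P T (r @ A # s) w (m # v)"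

text \<open>\<open>parse P T \<alpha> w K\<close>: some derivation forest with root word \<open>\<alpha>\<close> has yield \<open>w\<close>, and \<open>K\<close> consists of the
  valence sequences of its linearizations, i.e. of the derivations represented by the forest.\<close>

inductive parse :: "(symbol \<times> word \<times> 'm) set \<Rightarrow> symbol set \<Rightarrow> word \<Rightarrow> word \<Rightarrow> 'm list set \<Rightarrow> bool"
  for P T where
  parse_Nil: "parse P T [] [] {[]}"
| parse_terminal: "a \<in> T \<Longrightarrow> parse P T \<alpha> w K \<Longrightarrow> parse P T (a # \<alpha>) (a # w) K"
| parse_nonterminal: "(A, \<gamma>, m) \<in> P \<Longrightarrow> parse P T \<gamma> w\<^sub>1 K\<^sub>1 \<Longrightarrow> parse P T \<alpha> w\<^sub>2 K\<^sub>2 \<Longrightarrow>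
    parse P T (A # \<alpha>) (w\<^sub>1 @ w\<^sub>2) (Shuffle ((#) m ` K\<^sub>1) K\<^sub>2)"

lemma parse_terminals: "w \<in> lists T \<Longrightarrow> parse P T w w {[]}"
  by (induction w) (auto intro: parse.intros)

lemma parse_append:
  assumes "parse P T \<alpha> w\<^sub>1 K\<^sub>1" "parse P T \<beta> w\<^sub>2 K\<^sub>2"
  shows "parse P T (\<alpha> @ \<beta>) (w\<^sub>1 @ w\<^sub>2) (Shuffle K\<^sub>1 K\<^sub>2)"
  using assms
proof (induction rule: parse.induct)
  case parse_Nil then show ?case by simp
next
  case parse_terminal then show ?case by (auto intro: parse.parse_terminal)
next
  case (parse_nonterminal A \<gamma> m w K \<alpha> w' K')
  then show ?case using parse.parse_nonterminal[of A \<gamma> m P T w K "\<alpha> @ \<beta>" "w' @ w\<^sub>2"] by (simp add: Shuffle_assoc)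
qed

lemma parse_appendE:
  assumes "parse P T (\<alpha> @ \<beta>) w K"
  obtains w\<^sub>1 w\<^sub>2 K\<^sub>1 K\<^sub>2 where "w = w\<^sub>1 @ w\<^sub>2" "K = Shuffle K\<^sub>1 K\<^sub>2" "parse P T \<alpha> w\<^sub>1 K\<^sub>1" "parse P T \<beta> w\<^sub>2 K\<^sub>2"
proof -
  have "\<exists>w\<^sub>1 w\<^sub>2 K\<^sub>1 K\<^sub>2. w = w\<^sub>1 @ w\<^sub>2 \<and> K = Shuffle K\<^sub>1 K\<^sub>2 \<and> parse P T \<alpha> w\<^sub>1 K\<^sub>1 \<and> parse P T \<beta> w\<^sub>2 K\<^sub>2"
    using assms
  proof (induction \<alpha> arbitrary: w K)
    case Nil
    then show ?case using parse_Nil[of P T] by (intro exI[of _ "[]"] exI[of _ w] exI[of _ "{[]}"] exI[of _ K]) simp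
  next
    case (Cons a \<alpha>)
    from Cons.prems have "parse P T (a # \<alpha> @ \<beta>) w K" by simp
    then show ?case
    proof (cases rule: parse.cases)
      case (parse_terminal w')
      then obtain w\<^sub>1 w\<^sub>2 K\<^sub>1 K\<^sub>2 where "w' = w\<^sub>1 @ w\<^sub>2" "K = Shuffle K\<^sub>1 K\<^sub>2" "parse P T \<alpha> w\<^sub>1 K\<^sub>1" "parse P T \<beta> w\<^sub>2 K\<^sub>2"
        using Cons.IH by blast
      then show ?thesis using parse_terminal
        by (intro exI[of _ "a # w\<^sub>1"] exI[of _ w\<^sub>2] exI[of _ K\<^sub>1] exI[of _ K\<^sub>2]) (auto intro: parse.parse_terminal)
    next
      case (parse_nonterminal \<gamma> m v J v' J')
      then obtain w\<^sub>1 w\<^sub>2 K\<^sub>1 K\<^sub>2 where w: "v' = w\<^sub>1 @ w\<^sub>2" "J' = Shuffle K\<^sub>1 K\<^sub>2" "parse P T \<alpha> w\<^sub>1 K\<^sub>1" "parse P T \<beta> w\<^sub>2 K\<^sub>2"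
        using Cons.IH by blast
      have "parse P T (a # \<alpha>) (v @ w\<^sub>1) (Shuffle ((#) m ` J) K\<^sub>1)"
        by (rule parse.parse_nonterminal) (use parse_nonterminal w in auto)
      then show ?thesis using parse_nonterminal w
        by (intro exI[of _ "v @ w\<^sub>1"] exI[of _ w\<^sub>2] exI[of _ "Shuffle ((#) m ` J) K\<^sub>1"] exI[of _ K\<^sub>2])
          (auto simp: Shuffle_assoc)
    qed
  qed
  with that show thesis by blast
qed

text \<open>The first step of the derivation puts a root above the trees of \<open>\<gamma>\<close>.
  As its valence \<open>m\<close> comes first, it may precede the interleaving of all three parts of
  the forest.\<close>

lemma parse_of_derives: "derives P T \<alpha> w v \<Longrightarrow> \<exists>K. parse P T \<alpha> w K \<and> v \<in> K"
proof (induction rule: derives.induct)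
  case (derives_refl w)
  then show ?case using parse_terminals by blast
next
  case (derives_step A \<gamma> m r s w v)
  then obtain K where K: "parse P T (r @ \<gamma> @ s) w K" "v \<in> K" by blast
  obtain w\<^sub>1 w\<^sub>2 w\<^sub>3 K\<^sub>1 K\<^sub>2 K\<^sub>3 where p: "w = w\<^sub>1 @ w\<^sub>2 @ w\<^sub>3" "K = Shuffle K\<^sub>1 (Shuffle K\<^sub>2 K\<^sub>3)"
    "parse P T r w\<^sub>1 K\<^sub>1" "parse P T \<gamma> w\<^sub>2 K\<^sub>2" "parse P T s w\<^sub>3 K\<^sub>3"
    using K(1) by (metis parse_appendE)
  have "parse P T (r @ A # s) w (Shuffle K\<^sub>1 (Shuffle ((#) m ` K\<^sub>2) K\<^sub>3))"
    unfolding p(1) by (rule parse_append[OF p(3) parse_nonterminal[OF derives_step(1) p(4,5)]])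
  \<comment> \<open>\<open>K\<^sub>2\<close> is rotated to the left, where
    \<open>Shuffle_Cons\<close> can prefix \<open>m\<close>, and then back.\<close>
  moreover have "v \<in> Shuffle K\<^sub>2 (Shuffle K\<^sub>3 K\<^sub>1)"
    using K(2) p(2) by (metis Shuffle_assoc Shuffle_commute)
  then have "m # v \<in> Shuffle ((#) m ` K\<^sub>2) (Shuffle K\<^sub>3 K\<^sub>1)" by (rule Shuffle_Cons)
  then have "m # v \<in> Shuffle K\<^sub>1 (Shuffle ((#) m ` K\<^sub>2) K\<^sub>3)" by (metis Shuffle_assoc Shuffle_commute)
  ultimately show ?case by blast
qed

text \<open>Induction on the merged sequence: its first letter tells which of the two derivations
  makes the next step.\<close>

lemma derives_append:
  assumes "derives P T \<alpha> w\<^sub>1 v\<^sub>1" "derives P T \<beta> w\<^sub>2 v\<^sub>2" "v \<in> shuffles v\<^sub>1 v\<^sub>2"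
  shows "derives P T (\<alpha> @ \<beta>) (w\<^sub>1 @ w\<^sub>2) v"
  using assms
proof (induction v arbitrary: \<alpha> \<beta> v\<^sub>1 v\<^sub>2)
  case Nil
  then have "derives P T \<alpha> w\<^sub>1 []" "derives P T \<beta> w\<^sub>2 []" by auto
  then have "\<alpha> = w\<^sub>1" "\<beta> = w\<^sub>2" "w\<^sub>1 \<in> lists T" "w\<^sub>2 \<in> lists T" by (auto elim: derives.cases)
  then show ?case using derives_refl[of "w\<^sub>1 @ w\<^sub>2" T P] by simp
next
  case (Cons m v)
  from Cons.prems(3) show ?case
  proof (cases rule: Cons_in_shufflesE)
    case l: (left v')
    from Cons.prems(1) obtain A \<gamma> r s where "(A, \<gamma>, m) \<in> P" "\<alpha> = r @ A # s" "derives P T (r @ \<gamma> @ s) w\<^sub>1 v'"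
      unfolding l(1) by (auto elim: derives.cases)
    then show ?thesis
      using Cons.IH[of "r @ \<gamma> @ s" v' \<beta> v\<^sub>2] Cons.prems(2) l(2) derives_step[of A \<gamma> m P T r "s @ \<beta>"] by auto
  next
    case r: (right v')
    from Cons.prems(2) obtain A \<gamma> t s where "(A, \<gamma>, m) \<in> P" "\<beta> = t @ A # s" "derives P T (t @ \<gamma> @ s) w\<^sub>2 v'"
      unfolding r(1) by (auto elim: derives.cases)
    then show ?thesis
      using Cons.IH[of \<alpha> v\<^sub>1 "t @ \<gamma> @ s" v'] Cons.prems(1) r(2) derives_step[of A \<gamma> m P T "\<alpha> @ t" s] by auto
  qed
qed

lemma derives_of_parse: "parse P T \<alpha> w K \<Longrightarrow> v \<in> K \<Longrightarrow> derives P T \<alpha> w v"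
proof (induction arbitrary: v rule: parse.induct)
  case parse_Nil then show ?case by (auto intro: derives_refl)
next
  case (parse_terminal a \<alpha> w K)
  have "derives P T [a] [a] []" using parse_terminal by (auto intro: derives_refl)
  then show ?case using derives_append[of P T "[a]" "[a]" "[]" \<alpha> w v v] parse_terminal by simp
next
  case (parse_nonterminal A \<gamma> m w\<^sub>1 K\<^sub>1 \<alpha> w\<^sub>2 K\<^sub>2)
  then obtain v\<^sub>1 v\<^sub>2 where v: "v\<^sub>1 \<in> K\<^sub>1" "v\<^sub>2 \<in> K\<^sub>2" "v \<in> shuffles (m # v\<^sub>1) v\<^sub>2" by (auto simp: Shuffle_iff)
  have "derives P T [A] w\<^sub>1 (m # v\<^sub>1)"
    using derives_step[of A \<gamma> m P T "[]" "[]"] parse_nonterminal v by auto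
  then show ?case using derives_append[of P T "[A]" w\<^sub>1 "m # v\<^sub>1" \<alpha> w\<^sub>2 v\<^sub>2 v] parse_nonterminal v by simp
qed

lemma derives_iff_parse: "derives P T \<alpha> w v \<longleftrightarrow> (\<exists>K. parse P T \<alpha> w K \<and> v \<in> K)"
  using parse_of_derives derives_of_parse by blast

lemma parse_nonempty: "parse P T \<alpha> w K \<Longrightarrow> K \<noteq> {}"
proof (induction rule: parse.induct)
  case (parse_nonterminal A \<gamma> m w\<^sub>1 K\<^sub>1 \<alpha> w\<^sub>2 K\<^sub>2)
  then show ?case unfolding Shuffle_def using splice_in_shuffles by fastforce
qed auto

lemma derives_valences: "derives P T \<alpha> w v \<Longrightarrow> set v \<subseteq> (\<lambda>(A, \<gamma>, m). m) ` P"
  by (induction rule: derives.induct) force+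

lemma (in monoid) grammar_language_eq:
  assumes G: "valence_grammar G D"
  shows "grammar_language G D = {w. \<exists>v. derives (productions D) (terminals D) [start_symbol D] w v \<and> mprod v = \<one>}"
proof -
  let ?P = "productions D" and ?T = "terminals D" and ?V = "nonterminals D \<union> terminals D"
  have P: "(A, \<gamma>, m) \<in> ?P \<Longrightarrow> A \<in> nonterminals D \<and> \<gamma> \<in> lists ?V \<and> m \<in> carrier G" for A \<gamma> m
    using G by (auto simp: valence_grammar_def)
  have to: "\<exists>v. derives ?P ?T \<alpha> w v \<and> set v \<subseteq> carrier G \<and> b = a \<otimes> mprod v"
    if "((\<alpha>, a), (w, b)) \<in> (grammar_step G D)\<^sup>*" "a \<in> carrier G" "w \<in> lists ?T" for \<alpha> a w b
    using that
  proof (induction rule: converse_rtrancl_induct2)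
    case refl
    then show ?case by (intro exI[of _ "[]"]) (auto intro: derives_refl)
  next
    case (step \<alpha> a \<beta> c)
    from step(1) obtain A \<gamma> m r s where s: "(A, \<gamma>, m) \<in> ?P" "\<alpha> = r @ A # s" "\<beta> = r @ \<gamma> @ s" "c = a \<otimes> m"
      by (auto simp: grammar_step_def)
    then have m: "m \<in> carrier G" using P by blast
    then obtain v where "derives ?P ?T \<beta> w v" "set v \<subseteq> carrier G" "b = c \<otimes> mprod v" using step s by auto
    then show ?case using s m step(4)
      by (intro exI[of _ "m # v"]) (auto intro: derives_step simp: m_assoc)
  qed
  have from_derives: "((\<alpha>, a), (w, a \<otimes> mprod v)) \<in> (grammar_step G D)\<^sup>*"
    if "derives ?P ?T \<alpha> w v" "\<alpha> \<in> lists ?V" "a \<in> carrier G" for \<alpha> w v a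
    using that
  proof (induction arbitrary: a rule: derives.induct)
    case derives_refl then show ?case by simp
  next
    case (derives_step A \<gamma> m r s w v)
    have m: "m \<in> carrier G" and \<gamma>: "\<gamma> \<in> lists ?V" using P derives_step(1) by auto
    have "set v \<subseteq> carrier G" using derives_valences[OF derives_step(2)] P by auto
    moreover have "((r @ A # s, a), (r @ \<gamma> @ s, a \<otimes> m)) \<in> grammar_step G D"
    proof -
      have "r \<in> lists ?V" "s \<in> lists ?V" using derives_step(4) by auto
      moreover have "r @ A # s = r @ [A] @ s" by simp
      ultimately show ?thesis using derives_step(1,5) unfolding grammar_step_def by blast
    qed
    moreover have "((r @ \<gamma> @ s, a \<otimes> m), (w, a \<otimes> m \<otimes> mprod v)) \<in> (grammar_step G D)\<^sup>*"
      using derives_step \<gamma> m by auto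
    ultimately show ?case using m derives_step(5) by (auto simp: m_assoc intro: converse_rtrancl_into_rtrancl)
  qed
  have yield: "derives ?P ?T \<alpha> w v \<Longrightarrow> w \<in> lists ?T" for \<alpha> w v
    by (induction rule: derives.induct) auto
  have start: "[start_symbol D] \<in> lists ?V" using G by (simp add: valence_grammar_def)
  show ?thesis
  proof (rule Set.set_eqI)
    fix w
    have "w \<in> grammar_language G D \<longleftrightarrow>
        w \<in> lists ?T \<and> (([start_symbol D], \<one>), (w, \<one>)) \<in> (grammar_step G D)\<^sup>*"
      by (simp add: grammar_language_def)
    also have "\<dots> \<longleftrightarrow> (\<exists>v. derives ?P ?T [start_symbol D] w v \<and> mprod v = \<one>)"
    proof
      assume "w \<in> lists ?T \<and> (([start_symbol D], \<one>), (w, \<one>)) \<in> (grammar_step G D)\<^sup>*"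
      then obtain v where "derives ?P ?T [start_symbol D] w v" "set v \<subseteq> carrier G" "\<one> = \<one> \<otimes> mprod v"
        using to by blast
      then show "\<exists>v. derives ?P ?T [start_symbol D] w v \<and> mprod v = \<one>" by auto
    next
      assume "\<exists>v. derives ?P ?T [start_symbol D] w v \<and> mprod v = \<one>"
      then show "w \<in> lists ?T \<and> (([start_symbol D], \<one>), (w, \<one>)) \<in> (grammar_step G D)\<^sup>*"
        using from_derives[OF _ start one_closed] yield by (metis l_one one_closed)
    qed
    finally show "w \<in> grammar_language G D \<longleftrightarrow>
        w \<in> {w. \<exists>v. derives ?P ?T [start_symbol D] w v \<and> mprod v = \<one>}" by simp
  qed
qed

lemma context_free_grammar_language_eq:
  assumes "valence_grammar trivial_monoid D"
  shows "grammar_language trivial_monoid D = {w. \<exists>K. parse (productions D) (terminals D) [start_symbol D] w K}"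
  unfolding monoid.grammar_language_eq[OF monoid_trivial_monoid assms] derives_iff_parse
  using parse_nonempty by fastforce

section \<open>Pumping down\<close>

text \<open>\<open>repetition_free P T V \<alpha> w\<close>: a derivation forest in which no path repeats a nonterminal; \<open>V\<close> is the set of
  its nonterminals.\<close>

inductive repetition_free :: "(symbol \<times> word \<times> 'm) set \<Rightarrow> symbol set \<Rightarrow> symbol set \<Rightarrow> word \<Rightarrow> word \<Rightarrow> bool"
  for P T where
  rf_Nil: "repetition_free P T {} [] []"
| rf_terminal: "a \<in> T \<Longrightarrow> repetition_free P T V \<alpha> w \<Longrightarrow> repetition_free P T V (a # \<alpha>) (a # w)"
| rf_nonterminal: "(A, \<gamma>, m) \<in> P \<Longrightarrow> repetition_free P T V \<gamma> w \<Longrightarrow> A \<notin> V \<Longrightarrow> repetition_free P T V' \<alpha> w' \<Longrightarrow>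
    repetition_free P T (insert A V \<union> V') (A # \<alpha>) (w @ w')"

lemma parse_of_repetition_free: "repetition_free P T V \<alpha> w \<Longrightarrow> \<exists>K. parse P T \<alpha> w K"
  by (induction rule: repetition_free.induct) (blast intro: parse.intros)+

text \<open>Supplies the inner tree that replaces an outer one with the same root \<open>B\<close>;
  since \<open>B \<notin> V'\<close>, the replacement is repetition-free again.\<close>

lemma repetition_free_subtree:
  "repetition_free P T V \<alpha> w \<Longrightarrow> B \<in> V \<Longrightarrow>
    \<exists>x y z \<gamma> m V'. w = x @ y @ z \<and> (B, \<gamma>, m) \<in> P \<and> B \<notin> V' \<and> repetition_free P T V' \<gamma> y"
proof (induction rule: repetition_free.induct)
  case (rf_terminal a V \<alpha> w)
  then obtain x y z \<gamma> m V' where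
    "w = x @ y @ z" "(B, \<gamma>, m) \<in> P" "B \<notin> V'" "repetition_free P T V' \<gamma> y" by blast
  moreover from this have "a # w = (a # x) @ y @ z" by simp
  ultimately show ?case by blast
next
  case (rf_nonterminal A \<gamma> m V w V' \<alpha> w')
  consider "B = A" | "B \<in> V" | "B \<in> V'" using rf_nonterminal by blast
  then show ?case
  proof cases
    case 1
    moreover have "w @ w' = [] @ w @ w'" by simp
    ultimately show ?thesis using rf_nonterminal(1-3) by blast
  next
    case 2
    then obtain x y z \<gamma> m U where
      "w = x @ y @ z" "(B, \<gamma>, m) \<in> P" "B \<notin> U" "repetition_free P T U \<gamma> y"
      using rf_nonterminal by blast
    moreover from this have "w @ w' = x @ y @ (z @ w')" by simp
    ultimately show ?thesis by blast
  next
    case 3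
    then obtain x y z \<gamma> m U where
      "w' = x @ y @ z" "(B, \<gamma>, m) \<in> P" "B \<notin> U" "repetition_free P T U \<gamma> y"
      using rf_nonterminal by blast
    moreover from this have "w @ w' = (w @ x) @ y @ z" by simp
    ultimately show ?thesis by blast
  qed
qed simp

text \<open>The nonterminals on a path are distinct, so the height is at most \<open>card V\<close>,
  and each level multiplies the number of leaves by at most \<open>d\<close>.\<close>

lemma repetition_free_length:
  assumes d: "1 \<le> d" "\<forall>(A, \<gamma>, m) \<in> P. length \<gamma> \<le> d"
  shows "repetition_free P T V \<alpha> w \<Longrightarrow> finite V \<and> V \<subseteq> fst ` P \<and> length w \<le> length \<alpha> * d ^ card V"
proof (induction rule: repetition_free.induct)
  case (rf_terminal a V \<alpha> w)
  have "1 \<le> d ^ card V" using d(1) by simp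
  then show ?case using rf_terminal by auto
next
  case (rf_nonterminal A \<gamma> m V w V' \<alpha> w')
  let ?V = "insert A V \<union> V'"
  have fin: "finite ?V" using rf_nonterminal by simp
  have "length w \<le> length \<gamma> * d ^ card V" using rf_nonterminal by simp
  also have "\<dots> \<le> d * d ^ card V" using d(2) rf_nonterminal(1) by auto
  also have "\<dots> = d ^ card (insert A V)" using rf_nonterminal by simp
  also have "\<dots> \<le> d ^ card ?V" using d(1) fin by (intro power_increasing card_mono) auto
  finally have 1: "length w \<le> d ^ card ?V" .
  have "length w' \<le> length \<alpha> * d ^ card V'" using rf_nonterminal by simp
  also have "\<dots> \<le> length \<alpha> * d ^ card ?V"
    using d(1) fin by (intro mult_le_mono2 power_increasing card_mono) auto
  finally have "length (w @ w') \<le> length (A # \<alpha>) * d ^ card ?V" using 1 by simp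
  moreover have "A \<in> fst ` P" using rf_nonterminal(1) by force
  ultimately show ?case using rf_nonterminal fin by blast
qed simp

definition pumpable :: "(symbol \<times> word \<times> 'm) set \<Rightarrow> symbol set \<Rightarrow> nat \<Rightarrow> word \<Rightarrow> word \<Rightarrow> bool" where
  "pumpable P T k \<alpha> w \<longleftrightarrow> (\<exists>p x y z q K. w = p @ x @ y @ z @ q \<and> x @ z \<noteq> [] \<and> length (x @ y @ z) \<le> k \<and>
     parse P T \<alpha> (p @ y @ q) K)"

text \<open>A lowest repetition is treated: the trees below are repetition-free, and the tree of a
  repeated \<open>A\<close> is replaced by an inner one. The bound is that of
  \<open>repetition_free_length\<close> for a right-hand side, i.e. for a root word of at most
  \<open>d\<close> symbols.\<close>

lemma repetition_free_or_pumpable: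
  assumes P: "finite P" and d: "1 \<le> d" "\<forall>(A, \<gamma>, m) \<in> P. length \<gamma> \<le> d"
  shows "parse P T \<alpha> w K \<Longrightarrow> (\<exists>V. repetition_free P T V \<alpha> w) \<or> pumpable P T (d * d ^ card (fst ` P)) \<alpha> w"
proof (induction rule: parse.induct)
  case parse_Nil then show ?case by (auto intro: rf_Nil)
next
  case (parse_terminal a \<alpha> w K)
  from parse_terminal.IH show ?case
  proof
    assume "pumpable P T (d * d ^ card (fst ` P)) \<alpha> w"
    then obtain p x y z q K where "w = p @ x @ y @ z @ q" "x @ z \<noteq> []"
      "length (x @ y @ z) \<le> d * d ^ card (fst ` P)" "parse P T \<alpha> (p @ y @ q) K"
      unfolding pumpable_def by blast
    moreover from this have "a # w = (a # p) @ x @ y @ z @ q" by simp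
    moreover have "parse P T (a # \<alpha>) ((a # p) @ y @ q) K"
      using parse.parse_terminal[OF parse_terminal(1)] calculation(4) by simp
    ultimately have "pumpable P T (d * d ^ card (fst ` P)) (a # \<alpha>) (a # w)"
      unfolding pumpable_def by blast
    then show ?thesis ..
  qed (use parse_terminal in \<open>auto intro: rf_terminal\<close>)
next
  case (parse_nonterminal A \<gamma> m w\<^sub>1 K\<^sub>1 \<alpha> w\<^sub>2 K\<^sub>2)
  let ?k = "d * d ^ card (fst ` P)"
  have "pumpable P T ?k (A # \<alpha>) (w\<^sub>1 @ w\<^sub>2)" if pump: "pumpable P T ?k \<gamma> w\<^sub>1"
  proof -
    obtain p x y z q K where *: "w\<^sub>1 = p @ x @ y @ z @ q" "x @ z \<noteq> []"
      "length (x @ y @ z) \<le> ?k" "parse P T \<gamma> (p @ y @ q) K"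
      using pump unfolding pumpable_def by blast
    have "w\<^sub>1 @ w\<^sub>2 = p @ x @ y @ z @ (q @ w\<^sub>2)" using *(1) by simp
    moreover have "\<exists>K. parse P T (A # \<alpha>) (p @ y @ (q @ w\<^sub>2)) K"
      using parse.parse_nonterminal[OF parse_nonterminal(1) *(4) parse_nonterminal(3)] by auto
    ultimately show ?thesis unfolding pumpable_def using *(2,3) by blast
  qed
  moreover have "pumpable P T ?k (A # \<alpha>) (w\<^sub>1 @ w\<^sub>2)" if pump: "pumpable P T ?k \<alpha> w\<^sub>2"
  proof -
    obtain p x y z q K where *: "w\<^sub>2 = p @ x @ y @ z @ q" "x @ z \<noteq> []"
      "length (x @ y @ z) \<le> ?k" "parse P T \<alpha> (p @ y @ q) K"
      using pump unfolding pumpable_def by blast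
    have "w\<^sub>1 @ w\<^sub>2 = (w\<^sub>1 @ p) @ x @ y @ z @ q" using *(1) by simp
    moreover have "\<exists>K. parse P T (A # \<alpha>) ((w\<^sub>1 @ p) @ y @ q) K"
      using parse.parse_nonterminal[OF parse_nonterminal(1,2) *(4)] by auto
    ultimately show ?thesis unfolding pumpable_def using *(2,3) by blast
  qed
  moreover have "(\<exists>V. repetition_free P T V (A # \<alpha>) (w\<^sub>1 @ w\<^sub>2)) \<or> pumpable P T ?k (A # \<alpha>) (w\<^sub>1 @ w\<^sub>2)"
    if V: "repetition_free P T V \<gamma> w\<^sub>1" and V': "repetition_free P T V' \<alpha> w\<^sub>2" for V V'
  proof (cases "A \<in> V")
    case False
    then show ?thesis using rf_nonterminal[OF parse_nonterminal(1) V _ V'] by blast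
  next
    case True
    from repetition_free_subtree[OF V True] obtain x y z \<gamma>' m' U where xyz: "w\<^sub>1 = x @ y @ z"
      and A: "(A, \<gamma>', m') \<in> P" "A \<notin> U" and U: "repetition_free P T U \<gamma>' y"
      by blast
    show ?thesis
    proof (cases "x @ z = []")
      \<comment> \<open>The replacement keeps the yield, so nothing is pumped; it leads to a
        repetition-free forest instead.\<close>
      case True
      then have "w\<^sub>1 = y" using xyz by simp
      then have "repetition_free P T (insert A U \<union> V') (A # \<alpha>) (w\<^sub>1 @ w\<^sub>2)"
        using rf_nonterminal[OF A(1) U A(2) V'] by simp
      then show ?thesis by blast
    next
      case False
      have V_bound: "V \<subseteq> fst ` P" "length w\<^sub>1 \<le> length \<gamma> * d ^ card V"
        using repetition_free_length[OF d V] by auto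
      have "length \<gamma> \<le> d" using d(2) parse_nonterminal(1) by auto
      moreover have "d ^ card V \<le> d ^ card (fst ` P)"
        using d(1) P V_bound(1) by (intro power_increasing card_mono) auto
      ultimately have "length w\<^sub>1 \<le> d * d ^ card (fst ` P)"
        using V_bound(2) mult_le_mono order_trans by blast
      moreover from parse_of_repetition_free[OF U] obtain K where "parse P T \<gamma>' y K" by blast
      then have "parse P T (A # \<alpha>) (y @ w\<^sub>2) (Shuffle ((#) m' ` K) K\<^sub>2)"
        by (rule parse.parse_nonterminal[OF A(1) _ parse_nonterminal(3)])
      then have "parse P T (A # \<alpha>) ([] @ y @ w\<^sub>2) (Shuffle ((#) m' ` K) K\<^sub>2)" by simp
      moreover have "w\<^sub>1 @ w\<^sub>2 = [] @ x @ y @ z @ w\<^sub>2" using xyz by simp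
      ultimately have "pumpable P T ?k (A # \<alpha>) (w\<^sub>1 @ w\<^sub>2)"
        using False xyz unfolding pumpable_def by blast
      then show ?thesis ..
    qed
  qed
  ultimately show ?case using parse_nonterminal.IH by blast
qed

lemma context_free_pumping_down:
  assumes "context_free_language L"
  shows "\<exists>k. \<forall>w \<in> L. k < length w \<longrightarrow>
    (\<exists>p x y z q. w = p @ x @ y @ z @ q \<and> x @ z \<noteq> [] \<and> length (x @ y @ z) \<le> k \<and> p @ y @ q \<in> L)"
proof -
  obtain D where D: "valence_grammar trivial_monoid D" "L = grammar_language trivial_monoid D"
    using assms by (auto simp: context_free_language_def)
  let ?P = "productions D" and ?T = "terminals D" and ?S = "[start_symbol D]"
  have L: "L = {w. \<exists>K. parse ?P ?T ?S w K}" using context_free_grammar_language_eq D by simp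
  have P: "finite ?P" using D(1) by (simp add: valence_grammar_def)
  define d where "d = Suc (Max (insert 0 ((\<lambda>(A, \<gamma>, m). length \<gamma>) ` ?P)))"
  have d: "1 \<le> d" "\<forall>(A, \<gamma>, m) \<in> ?P. length \<gamma> \<le> d"
    using P by (auto simp: d_def intro!: le_SucI Max_ge rev_image_eqI)
  define k where "k = d * d ^ card (fst ` ?P)"
  show ?thesis
  proof (intro exI[of _ k] ballI impI)
    fix w assume w: "w \<in> L" "k < length w"
    have "\<not> repetition_free ?P ?T V ?S w" for V
    proof
      assume rf: "repetition_free ?P ?T V ?S w"
      then have "V \<subseteq> fst ` ?P" "length w \<le> d ^ card V"
        using repetition_free_length[OF d rf] by auto
      moreover from this(1) have "d ^ card V \<le> d ^ card (fst ` ?P)"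
        using d(1) P by (intro power_increasing card_mono) auto
      moreover have "d ^ card (fst ` ?P) \<le> k" using d(1) by (simp add: k_def)
      ultimately show False using w(2) by linarith
    qed
    then have "pumpable ?P ?T k ?S w"
      using repetition_free_or_pumpable[OF P d] w(1) unfolding L k_def by blast
    then show "\<exists>p x y z q. w = p @ x @ y @ z @ q \<and> x @ z \<noteq> [] \<and> length (x @ y @ z) \<le> k \<and> p @ y @ q \<in> L"
      unfolding pumpable_def L by blast
  qed
qed

section \<open>Grammars with non-context-free languages\<close>

lemma subseq_appendE:
  assumes "subseq w (u @ v)"
  obtains u' v' where "w = u' @ v'" "subseq u' u" "subseq v' v"
  using assms by (metis subseq_append_iff)

lemma subseq_set_subset: "subseq u v \<Longrightarrow> set u \<subseteq> set v"
  by (blast elim: list_emb_set)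

lemma filter_all: "set w \<subseteq> S \<Longrightarrow> filter (\<lambda>s. s \<in> S) w = w"
  by (induction w) auto

lemma filter_none: "set w \<inter> S = {} \<Longrightarrow> filter (\<lambda>s. s \<in> S) w = []"
  by (induction w) auto

text \<open>The three blocks get the ranks \<open>0\<close>, \<open>1\<close>, \<open>2\<close>,
  which makes the word sorted. A window with letters of rank \<open>0\<close> and \<open>2\<close>
  leaves no letter of rank \<open>1\<close> outside.\<close>

lemma window_between:
  fixes X Y :: "'s set"
  assumes uva: "u @ v @ a = p @ w @ q" "set u \<subseteq> X" "set v \<subseteq> Y" "set a \<subseteq> Z"
    and disj: "X \<inter> Y = {}" "X \<inter> Z = {}" "Y \<inter> Z = {}"
    and touch: "set w \<inter> X \<noteq> {}" "set w \<inter> Z \<noteq> {}"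
  shows "length v \<le> length w"
proof -
  define \<rho> :: "'s \<Rightarrow> nat" where "\<rho> s = (if s \<in> X then 0 else if s \<in> Y then 1 else 2)" for s
  have u: "s \<in> set u \<Longrightarrow> \<rho> s = 0" and v: "s \<in> set v \<Longrightarrow> \<rho> s = 1" and a: "s \<in> set a \<Longrightarrow> \<rho> s = 2" for s
    using uva disj by (auto simp: \<rho>_def)
  have "sorted (map \<rho> u)" "sorted (map \<rho> v)" "sorted (map \<rho> a)"
    using u v a by (simp_all add: sorted_iff_nth_mono)
  then have "sorted (map \<rho> (u @ v @ a))" using u v a by (auto simp: sorted_append)
  then have srt: "sorted (map \<rho> (p @ w @ q))" using uva(1) by simp
  from touch obtain x z where "x \<in> set w" "x \<in> X" "z \<in> set w" "z \<in> Z" by blast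
  with disj have x: "x \<in> set w" "\<rho> x = 0" and z: "z \<in> set w" "\<rho> z = 2" by (auto simp: \<rho>_def)
  have p: "\<rho> s \<noteq> 1" if "s \<in> set p" for s
    using srt x that by (force simp: sorted_append)
  have q: "\<rho> s \<noteq> 1" if "s \<in> set q" for s
    using srt z that by (force simp: sorted_append)
  have "filter (\<lambda>s. \<rho> s = 1) (u @ v @ a) = v"
    using u v a by (auto simp: filter_empty_conv filter_id_conv)
  moreover have "filter (\<lambda>s. \<rho> s = 1) (p @ w @ q) = filter (\<lambda>s. \<rho> s = 1) w"
    using p q by (auto simp: filter_empty_conv)
  ultimately have "v = filter (\<lambda>s. \<rho> s = 1) w" using uva(1) by simp
  then show ?thesis by simp
qed

text \<open>If the values of \<open>u\<close> had long right inverses only, pumping down \<open>u v a\<^sup>|\<^sup>u\<^sup>|\<close> for a shortest \<open>v\<close> inverse to \<open>u\<close> fails: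
  the window of the pumping lemma is too short to change both \<open>u\<close> and the letters \<open>a\<close> that count it.\<close>

lemma (in monoid) finite_right_invertibles_if_context_free:
  assumes cf: "\<And>D. valence_grammar G D \<Longrightarrow> context_free_language (grammar_language G D)"
    and N: "finitely_generated_submonoid N G"
  shows "finite (right_invertibles (G\<lparr>carrier := N\<rparr>))"
proof -
  interpret N: submonoid N G by (rule submonoid_if_finitely_generated[OF N])
  obtain X Y :: "symbol set" and ev where fin: "finite X" "finite Y" and disj: "X \<inter> Y = {}"
    and ev: "ev ` (X \<union> Y) \<subseteq> N"
    and X_word: "\<And>a. a \<in> N \<Longrightarrow> \<exists>u \<in> lists X. mprod (map ev u) = a"
    and Y_word: "\<And>a. a \<in> N \<Longrightarrow> \<exists>v \<in> lists Y. v \<noteq> [] \<and> mprod (map ev v) = a"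
    using generating_alphabets[OF N] by metis
  have ev_N: "ev x \<in> carrier G" if "x \<in> X \<union> Y" for x using that ev N.subset by auto
  have mprod_N: "mprod (map ev w) \<in> N" if "w \<in> lists (X \<union> Y)" for w
    by (rule mprod_in_submonoid) (use that ev N in \<open>auto simp: lists_eq_set intro: submonoid_if_finitely_generated\<close>)
  obtain a where a: "a \<notin> X \<union> Y" using fin by (meson ex_new_if_finite finite_UnI infinite_UNIV_nat)
  obtain S where S: "S \<notin> insert a (X \<union> Y)" using fin by (meson ex_new_if_finite finite_UnI finite_insert infinite_UNIV_nat)
  let ?T = "insert a (X \<union> Y)"
  \<comment> \<open>Each letter of \<open>X\<close> also deposits an \<open>a\<close> to the right
    of \<open>S\<close>, so the copies of \<open>a\<close> count the letters of \<open>X\<close> in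
    the generated word.\<close>
  define P where "P = (\<lambda>x. (S, [x, S, a], ev x)) ` X \<union> (\<lambda>y. (S, [y, S], ev y)) ` Y \<union> {(S, [], \<one>)}"
  define D where "D = \<lparr>nonterminals = {S}, terminals = ?T, productions = P, start_symbol = S\<rparr>"
  have D: "valence_grammar G D"
    using fin S ev_N by (auto simp: valence_grammar_def D_def P_def)
  let ?n = "\<lambda>w. length (filter (\<lambda>s. s \<in> X) w)"
  define L where "L = grammar_language G D"
  have L_iff: "w \<in> L \<longleftrightarrow> (\<exists>v. derives P ?T [S] w v \<and> mprod v = \<one>)" for w
    unfolding L_def grammar_language_eq[OF D] by (simp add: D_def)
  have derives: "\<exists>v. derives P ?T (r @ S # replicate k a) (r @ w @ replicate (?n w + k) a) v \<and> mprod v = mprod (map ev w)"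
    if "w \<in> lists (X \<union> Y)" "r \<in> lists (X \<union> Y)" for w r k
    using that
  proof (induction w arbitrary: r k rule: list.induct)
    case Nil
    have "r @ replicate k a \<in> lists ?T" using Nil by (auto simp: lists_eq_set)
    from derives_refl[OF this, of P]
    have "derives P ?T (r @ [] @ replicate k a) (r @ replicate k a) []" by simp
    then have "derives P ?T (r @ S # replicate k a) (r @ replicate k a) [\<one>]"
      by (rule derives_step[rotated]) (simp add: P_def)
    then show ?case by (intro exI[of _ "[\<one>]"]) simp
  next
    case (Cons x w)
    show ?case
    proof (cases "x \<in> X")
      case True
      obtain v where v: "derives P ?T ((r @ [x]) @ S # replicate (Suc k) a) ((r @ [x]) @ w @ replicate (?n w + Suc k) a) v"
        "mprod v = mprod (map ev w)"
        using Cons.IH[of "r @ [x]" "Suc k"] Cons.prems True by auto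
      have "derives P ?T (r @ [x, S, a] @ replicate k a) (r @ (x # w) @ replicate (?n (x # w) + k) a) v"
        using v(1) True by simp
      then have "derives P ?T (r @ S # replicate k a) (r @ (x # w) @ replicate (?n (x # w) + k) a) (ev x # v)"
        by (rule derives_step[rotated]) (simp add: P_def True)
      then show ?thesis using v(2) by (intro exI[of _ "ev x # v"]) simp
    next
      case False
      then have "x \<in> Y" using Cons.prems by auto
      obtain v where v: "derives P ?T ((r @ [x]) @ S # replicate k a) ((r @ [x]) @ w @ replicate (?n w + k) a) v"
        "mprod v = mprod (map ev w)"
        using Cons.IH[of "r @ [x]" k] Cons.prems \<open>x \<in> Y\<close> by auto
      have "derives P ?T (r @ [x, S] @ replicate k a) (r @ (x # w) @ replicate (?n (x # w) + k) a) v"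
        using v(1) False by simp
      then have "derives P ?T (r @ S # replicate k a) (r @ (x # w) @ replicate (?n (x # w) + k) a) (ev x # v)"
        by (rule derives_step[rotated]) (simp add: P_def \<open>x \<in> Y\<close>)
      then show ?thesis using v(2) by (intro exI[of _ "ev x # v"]) simp
    qed
  qed
  have terminal: "w = \<alpha> \<and> v = []" if "derives P ?T \<alpha> w v" "S \<notin> set \<alpha>" for \<alpha> w v
    using that by (cases rule: derives.cases) (auto simp: P_def)
  have derived: "\<exists>z \<in> lists (X \<union> Y). w = r @ z @ replicate (?n z + k) a \<and> mprod v = mprod (map ev z)"
    if "derives P ?T \<alpha> w v" "\<alpha> = r @ S # replicate k a" "r \<in> lists (X \<union> Y)" for \<alpha> w v r k
    using that
  proof (induction arbitrary: r k rule: derives.induct)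
    case (derives_refl w)
    then show ?case using S by auto
  next
    case (derives_step A \<gamma> m r' s w v)
    have "A = S" using derives_step(1) by (auto simp: P_def)
    have "r' = r \<and> s = replicate k a"
    proof -
      have "S \<notin> set r" "S \<notin> set (replicate k a)" using S derives_step(5) by auto
      then have "takeWhile (\<lambda>s. s \<noteq> S) (r @ S # replicate k a) = r" by (simp add: takeWhile_append)
      moreover have "S \<notin> set s" "S \<notin> set r'"
        using derives_step(4) \<open>A = S\<close> \<open>S \<notin> set r\<close> \<open>S \<notin> set (replicate k a)\<close>
        by (metis append_Cons_eq_iff in_set_conv_decomp)+
      ultimately show ?thesis
        using derives_step(4) \<open>A = S\<close> \<open>S \<notin> set r\<close> \<open>S \<notin> set (replicate k a)\<close>
        by (metis append_Cons_eq_iff)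
    qed
    then have eqs: "r' = r" "s = replicate k a" by auto
    from derives_step(1) consider (x) x where "x \<in> X" "\<gamma> = [x, S, a]" "m = ev x"
      | (y) y where "y \<in> Y" "\<gamma> = [y, S]" "m = ev y" | (empty) "\<gamma> = []" "m = \<one>"
      by (auto simp: P_def)
    then show ?case
    proof cases
      case x
      have "r' @ \<gamma> @ s = (r @ [x]) @ S # replicate (Suc k) a" "r @ [x] \<in> lists (X \<union> Y)"
        using x eqs derives_step(5) by auto
      then obtain z where "z \<in> lists (X \<union> Y)" "w = (r @ [x]) @ z @ replicate (?n z + Suc k) a"
        "mprod v = mprod (map ev z)" using derives_step.IH by blast
      then show ?thesis using x by (intro bexI[of _ "x # z"]) auto
    next
      case y
      have "r' @ \<gamma> @ s = (r @ [y]) @ S # replicate k a" "r @ [y] \<in> lists (X \<union> Y)"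
        using y eqs derives_step(5) by auto
      then obtain z where "z \<in> lists (X \<union> Y)" "w = (r @ [y]) @ z @ replicate (?n z + k) a"
        "mprod v = mprod (map ev z)" using derives_step.IH by blast
      moreover have "y \<notin> X" using y disj by auto
      ultimately show ?thesis using y by (intro bexI[of _ "y # z"]) auto
    next
      case empty
      have "S \<notin> set (r' @ \<gamma> @ s)" using empty eqs derives_step(5) S by auto
      then have "w = r @ replicate k a" "v = []" using terminal[OF derives_step(2)] eqs empty by auto
      then show ?thesis using empty by (intro bexI[of _ "[]"]) auto
    qed
  qed
  \<comment> \<open>Letters of \<open>X\<close> and \<open>Y\<close> may alternate in
    \<open>w\<close>; that a pumped word keeps the block structure will follow from its being a
    subword of the word chosen below.\<close>
  have L_eq: "L = {w @ replicate (?n w) a | w. w \<in> lists (X \<union> Y) \<and> mprod (map ev w) = \<one>}"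
  proof (intro Set.set_eqI iffI)
    fix w assume "w \<in> L"
    then obtain v where v: "derives P ?T [S] w v" "mprod v = \<one>" unfolding L_iff by (elim exE conjE)
    have "[S] = [] @ S # replicate 0 a" by simp
    from derived[OF v(1) this] obtain z where
      "z \<in> lists (X \<union> Y)" "w = [] @ z @ replicate (?n z + 0) a" "mprod v = mprod (map ev z)"
      by (metis lists.Nil)
    with v(2) show "w \<in> {w @ replicate (?n w) a | w. w \<in> lists (X \<union> Y) \<and> mprod (map ev w) = \<one>}"
      by auto
  next
    fix w assume "w \<in> {w @ replicate (?n w) a | w. w \<in> lists (X \<union> Y) \<and> mprod (map ev w) = \<one>}"
    then obtain z where "w = z @ replicate (?n z) a" "z \<in> lists (X \<union> Y)" "mprod (map ev z) = \<one>" by blast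
    moreover from derives[OF this(2) lists.Nil, of 0] obtain v where
      "derives P ?T ([] @ S # replicate 0 a) ([] @ z @ replicate (?n z + 0) a) v" "mprod v = mprod (map ev z)"
      by (elim exE conjE)
    ultimately show "w \<in> L" unfolding L_iff by auto
  qed
  have "context_free_language L" unfolding L_def by (rule cf[OF D])
  from context_free_pumping_down[OF this] obtain k where pump: "\<forall>w \<in> L. k < length w \<longrightarrow>
      (\<exists>p x y z q. w = p @ x @ y @ z @ q \<and> x @ z \<noteq> [] \<and> length (x @ y @ z) \<le> k \<and> p @ y @ q \<in> L)"
    by (elim exE)
  interpret S: monoid "G\<lparr>carrier := N\<rparr>" by (rule submonoid.submonoid_is_monoid[OF N.submonoid_axioms monoid_axioms])
  \<comment> \<open>\<open>k\<close> is the pumping constant. Shortest inverse words over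
    \<open>Y\<close> will turn out to have length at most \<open>k\<close>.\<close>
  define C where "C = (\<lambda>v. mprod (map ev v)) ` {v. set v \<subseteq> Y \<and> length v \<le> k}"
  have "finite C" using finite_lists_length_le[OF fin(2)] by (simp add: C_def)
  moreover have "C \<subseteq> carrier (G\<lparr>carrier := N\<rparr>)" using mprod_N by (auto simp: C_def)
  moreover have "\<forall>b \<in> right_invertibles (G\<lparr>carrier := N\<rparr>). \<exists>c \<in> C. b \<otimes>\<^bsub>G\<lparr>carrier := N\<rparr>\<^esub> c = \<one>\<^bsub>G\<lparr>carrier := N\<rparr>\<^esub>"
  proof
    fix b assume "b \<in> right_invertibles (G\<lparr>carrier := N\<rparr>)"
    then obtain c where bc: "b \<in> N" "c \<in> N" "b \<otimes> c = \<one>" by (auto simp: right_invertibles_def)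
    obtain u where u: "u \<in> lists X" "mprod (map ev u) = b" using X_word bc by blast
    define inv_word where "inv_word v \<longleftrightarrow> v \<in> lists Y \<and> b \<otimes> mprod (map ev v) = \<one>" for v
    have "\<exists>v. inv_word v" using Y_word bc by (auto simp: inv_word_def)
    then obtain v where v: "inv_word v" and shortest: "\<And>v'. inv_word v' \<Longrightarrow> length v \<le> length v'"
      using ex_has_least_nat[of inv_word _ length] by blast
    have vY: "v \<in> lists Y" using v by (simp add: inv_word_def)
    have mp: "mprod (map ev (u @ v')) = b \<otimes> mprod (map ev v')" if "v' \<in> lists Y" for v'
    proof -
      have "set (map ev u) \<subseteq> carrier G" "set (map ev v') \<subseteq> carrier G" using u(1) that ev_N by (auto simp: lists_eq_set)
      then show ?thesis using mprod_append u(2) by simp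
    qed
    have nX: "filter (\<lambda>s. s \<in> X) v' = []" if "v' \<in> lists Y" for v'
      using that disj by (intro filter_none) (auto simp: lists_eq_set)
    have nu: "filter (\<lambda>s. s \<in> X) u' = u'" if "set u' \<subseteq> X" for u' using that by (rule filter_all)
    have "length v \<le> k"
    proof (rule ccontr)
      assume "\<not> length v \<le> k"
      have "mprod (map ev (u @ v)) = \<one>" using mp[OF vY] v by (simp add: inv_word_def)
      moreover have "u @ v \<in> lists (X \<union> Y)" using u(1) vY by auto
      moreover have "?n (u @ v) = length u" using nX[OF vY] nu u(1) by (simp add: lists_eq_set)
      ultimately have mem: "(u @ v) @ replicate (length u) a \<in> L"
        unfolding L_eq mem_Collect_eq by (intro exI[of _ "u @ v"]) simp
      have long: "k < length ((u @ v) @ replicate (length u) a)" using \<open>\<not> length v \<le> k\<close> by simp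
      have "\<exists>p x y z q. (u @ v) @ replicate (length u) a = p @ x @ y @ z @ q \<and> x @ z \<noteq> [] \<and>
          length (x @ y @ z) \<le> k \<and> p @ y @ q \<in> L"
        by (rule pump[THEN bspec, OF mem, THEN HOL.mp, OF long])
      then obtain p x y z q where pq: "(u @ v) @ replicate (length u) a = p @ x @ y @ z @ q" "x @ z \<noteq> []"
        "length (x @ y @ z) \<le> k" "p @ y @ q \<in> L"
        by (elim exE conjE)
      have "subseq (p @ y @ q) (p @ x @ y @ z @ q)"
        by (rule list_emb_append_mono[OF _ list_emb_append2[OF list_emb_append_mono[OF _ list_emb_append2]]]) simp_all
      then have "subseq (p @ y @ q) (u @ v @ replicate (length u) a)" using pq(1) by simp
      then obtain u' v' s' where split: "p @ y @ q = u' @ v' @ s'" "subseq u' u" "subseq v' v"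
        "subseq s' (replicate (length u) a)" by (metis subseq_appendE)
      have sets: "set u' \<subseteq> X" "set v' \<subseteq> Y" "set s' \<subseteq> {a}"
        using split(2-4)[THEN subseq_set_subset] u(1) vY by (auto simp: lists_eq_set)
      from pq(4) obtain w where w: "p @ y @ q = w @ replicate (?n w) a" "w \<in> lists (X \<union> Y)" "mprod (map ev w) = \<one>"
        unfolding L_eq by blast
      have cl: "\<forall>s \<in> set u'. s \<in> X \<and> s \<notin> Y \<and> s \<noteq> a" "\<forall>s \<in> set v'. s \<notin> X \<and> s \<in> Y \<and> s \<noteq> a"
        "\<forall>s \<in> set s'. s \<notin> X \<and> s \<notin> Y" "a \<notin> X" "a \<notin> Y"
        "\<forall>s \<in> set u. s \<in> X \<and> s \<noteq> a" "\<forall>s \<in> set v. s \<notin> X \<and> s \<noteq> a"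
        using sets u(1) vY disj a by (auto simp: lists_eq_set)
      have "filter (\<lambda>s. s \<in> X \<union> Y) (p @ y @ q) = u' @ v'"
        unfolding split(1)
        using cl by simp
      moreover have "filter (\<lambda>s. s \<in> X \<union> Y) (p @ y @ q) = w"
        unfolding w(1)
        using w(2) cl by (auto simp: filter_empty_conv filter_id_conv)
      ultimately have w_eq: "w = u' @ v'" by simp
      \<comment> \<open>Membership in \<open>L\<close> forces the number of letters \<open>a\<close>
        to match the possibly shortened \<open>u'\<close>.\<close>
      have s': "length s' = length u'"
        using w(1) split(1) nX nu sets unfolding w_eq by (simp add: lists_eq_set)
      have shorter: "length (p @ y @ q) < length ((u @ v) @ replicate (length u) a)"
        unfolding pq(1) using pq(2) by auto
      show False
      \<comment> \<open>If \<open>u\<close> survives, so do all letters \<open>a\<close>, and the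
        loss falls on \<open>v\<close>, against its minimality. If \<open>u\<close> shrinks, so does
        the block of letters \<open>a\<close>; then the window meets both and is at least as long as
        \<open>v\<close>.\<close>
      proof (cases "length u' = length u")
        case True
        then have "u' = u" using split(2) subseq_same_length by blast
        then have "inv_word v'" using w(3) mp[of v'] sets(2) by (simp add: w_eq inv_word_def lists_eq_set)
        moreover have "length v' < length v" using shorter True s' unfolding split(1) by simp
        ultimately show False using shortest by force
      next
        case False
        have "filter (\<lambda>s. s \<in> X) (p @ y @ q) = u'"
          unfolding split(1)
            using cl by simp
        moreover have "filter (\<lambda>s. s \<in> X) (p @ x @ y @ z @ q) = u"
          unfolding pq(1)[symmetric] 
            using cl by simp
        ultimately have "set (x @ z) \<inter> X \<noteq> {}"
          using False filter_none[of x X] filter_none[of z X] by (auto simp: Int_Un_distrib2)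
        then have 1: "set (x @ y @ z) \<inter> X \<noteq> {}" by auto
        have "filter (\<lambda>s. s \<in> {a}) (p @ y @ q) = s'"
          unfolding split(1)
            using cl sets(3) by (auto simp: filter_empty_conv filter_id_conv)
        moreover have "filter (\<lambda>s. s \<in> {a}) (p @ x @ y @ z @ q) = replicate (length u) a"
          unfolding pq(1)[symmetric] 
            using cl by simp
        moreover have "length s' \<noteq> length (replicate (length u) a)" using s' False by simp
        ultimately have "filter (\<lambda>s. s \<in> {a}) x \<noteq> [] \<or> filter (\<lambda>s. s \<in> {a}) z \<noteq> []"
          by (metis append_Nil filter_append)
        then have 2: "set (x @ y @ z) \<inter> {a} \<noteq> {}" by (auto simp: filter_empty_conv)
        have "length v \<le> length (x @ y @ z)"
          by (rule window_between[of u v "replicate (length u) a" p "x @ y @ z" q X Y "{a}"])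
            (use pq(1) u(1) vY disj a 1 2 in auto)
        then show False using pq(3) \<open>\<not> length v \<le> k\<close> by linarith
      qed
    qed
    then show "\<exists>c \<in> C. b \<otimes>\<^bsub>G\<lparr>carrier := N\<rparr>\<^esub> c = \<one>\<^bsub>G\<lparr>carrier := N\<rparr>\<^esub>"
      using v by (auto simp: C_def inv_word_def lists_eq_set)
  qed
  ultimately show ?thesis by (rule S.finite_right_invertibles_if_finite_inverses)
qed

section \<open>Higman's lemma for finite alphabets\<close>

definition ascending :: "('a \<Rightarrow> 'a \<Rightarrow> bool) \<Rightarrow> (nat \<Rightarrow> 'a) \<Rightarrow> (nat \<Rightarrow> nat) \<Rightarrow> bool" where
  "ascending R f \<phi> \<longleftrightarrow> strict_mono \<phi> \<and> (\<forall>i j. i < j \<longrightarrow> R (f (\<phi> i)) (f (\<phi> j)))"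

text \<open>Well-quasi-ordering in the form of infinite ascending subsequences, not of single
  comparable pairs: this form passes to products by thinning a sequence repeatedly.\<close>

definition higman :: "'a list set \<Rightarrow> bool" where
  "higman S \<longleftrightarrow> (\<forall>f :: nat \<Rightarrow> 'a list. (\<forall>i. f i \<in> S) \<longrightarrow> (\<exists>\<phi>. ascending subseq f \<phi>))"

lemma ascending_comp:
  assumes "ascending R (f \<circ> \<phi>) \<psi>" "strict_mono \<phi>"
  shows "ascending R f (\<phi> \<circ> \<psi>)"
  using assms by (auto simp: ascending_def strict_mono_def)

lemma infinite_subsequence:
  assumes "infinite (I :: nat set)"
  shows "\<exists>\<phi> :: nat \<Rightarrow> nat. strict_mono \<phi> \<and> (\<forall>i. \<phi> i \<in> I)"
  using enumerate_in_set[OF assms] strict_mono_enumerate[OF assms] by blast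

lemma constant_subsequence:
  fixes t :: "nat \<Rightarrow> 'b"
  assumes "finite (range t)"
  shows "\<exists>(\<phi> :: nat \<Rightarrow> nat) c. strict_mono \<phi> \<and> (\<forall>i. t (\<phi> i) = c)"
proof -
  obtain k where "infinite {i \<in> UNIV. t i = t k}"
    using pigeonhole_infinite[OF infinite_UNIV_nat assms] by blast
  from infinite_subsequence[OF this] show ?thesis by auto
qed

lemma higman_subset: "higman T \<Longrightarrow> S \<subseteq> T \<Longrightarrow> higman S"
  unfolding higman_def by blast

lemma higman_Un:
  assumes "higman S" "higman T"
  shows "higman (S \<union> T)"
  unfolding higman_def
proof (intro allI impI)
  fix f :: "nat \<Rightarrow> 'a list" assume f: "\<forall>i. f i \<in> S \<union> T"
  have "finite (range (\<lambda>i. f i \<in> S))" by (rule finite)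
  from constant_subsequence[OF this] obtain \<phi> :: "nat \<Rightarrow> nat" and c where
    \<phi>: "strict_mono \<phi>" "\<forall>i. (f (\<phi> i) \<in> S) = c" by blast
  have "(\<forall>i. (f \<circ> \<phi>) i \<in> S) \<or> (\<forall>i. (f \<circ> \<phi>) i \<in> T)"
    using \<phi>(2) f by (cases c) auto
  then obtain \<psi> where "ascending subseq (f \<circ> \<phi>) \<psi>" using assms unfolding higman_def by blast
  then show "\<exists>\<phi>. ascending subseq f \<phi>" using ascending_comp \<phi>(1) by blast
qed

lemma higman_append_Cons:
  assumes "higman S" "higman T"
  shows "higman {u @ a # v | u v. u \<in> S \<and> v \<in> T}"
  unfolding higman_def
proof (intro allI impI)
  fix f :: "nat \<Rightarrow> 'a list" assume "\<forall>i. f i \<in> {u @ a # v | u v. u \<in> S \<and> v \<in> T}"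
  then have "\<forall>i. \<exists>u v. f i = u @ a # v \<and> u \<in> S \<and> v \<in> T" by blast
  then obtain u v where uv: "\<And>i. f i = u i @ a # v i" "\<And>i. u i \<in> S" "\<And>i. v i \<in> T" by metis
  obtain \<phi> where \<phi>: "ascending subseq u \<phi>" using assms(1) uv(2) unfolding higman_def by blast
  have "\<forall>i. (v \<circ> \<phi>) i \<in> T" using uv(3) by simp
  then obtain \<psi> where \<psi>: "ascending subseq (v \<circ> \<phi>) \<psi>" using assms(2) unfolding higman_def by blast
  have "ascending subseq f (\<phi> \<circ> \<psi>)"
    unfolding ascending_def
  proof (intro conjI allI impI)
    show "strict_mono (\<phi> \<circ> \<psi>)" using \<phi> \<psi> by (auto simp: ascending_def strict_mono_def)
    fix i j :: nat assume "i < j"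
    then have "\<psi> i < \<psi> j" using \<psi> by (simp add: ascending_def strict_mono_def)
    then have "subseq (u (\<phi> (\<psi> i))) (u (\<phi> (\<psi> j)))" using \<phi> by (simp add: ascending_def)
    moreover have "subseq (v (\<phi> (\<psi> i))) (v (\<phi> (\<psi> j)))" using \<psi> \<open>i < j\<close> by (simp add: ascending_def)
    ultimately show "subseq (f ((\<phi> \<circ> \<psi>) i)) (f ((\<phi> \<circ> \<psi>) j))"
      by (simp add: uv(1) list_emb_append_mono)
  qed
  then show "\<exists>\<phi>. ascending subseq f \<phi>" by blast
qed

text \<open>A word avoiding \<open>a # w\<close> either lacks \<open>a\<close> or, split at its
  first \<open>a\<close>, continues with a word avoiding \<open>w\<close>. Both pieces come from
  sets already known to be well-quasi-ordered.\<close>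

lemma higman_avoiding:
  assumes smaller: "\<And>a. a \<in> A \<Longrightarrow> higman (lists (A - {a}))"
  shows "set w \<subseteq> A \<Longrightarrow> higman {u \<in> lists A. \<not> subseq w u}"
proof (induction w)
  case Nil then show ?case by (simp add: higman_def)
next
  case (Cons a w)
  have "{u \<in> lists A. \<not> subseq (a # w) u} \<subseteq>
      lists (A - {a}) \<union> {u @ a # v | u v. u \<in> lists (A - {a}) \<and> v \<in> {u \<in> lists A. \<not> subseq w u}}"
  proof
    fix z assume z: "z \<in> {u \<in> lists A. \<not> subseq (a # w) u}"
    show "z \<in> lists (A - {a}) \<union> {u @ a # v | u v. u \<in> lists (A - {a}) \<and> v \<in> {u \<in> lists A. \<not> subseq w u}}"
    proof (cases "a \<in> set z")
      case True
      then obtain x y where xy: "z = x @ a # y" "a \<notin> set x" using split_list_first by metis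
      have "\<not> subseq w y"
      proof
        assume "subseq w y"
        then have "subseq (a # w) (x @ a # y)" by (intro list_emb_append2) simp
        then show False using z xy(1) by simp
      qed
      then have "x \<in> lists (A - {a})" "y \<in> {u \<in> lists A. \<not> subseq w u}" using z xy by auto
      then show ?thesis using xy(1) by blast
    qed (use z in auto)
  qed
  moreover have "higman \<dots>"
    by (intro higman_Un higman_append_Cons) (use Cons smaller in simp_all)
  ultimately show ?case using higman_subset by blast
qed

lemma chain_ascending:
  assumes "\<And>n. \<phi> n < \<phi> (Suc n)" "\<And>n. subseq (f (\<phi> n)) (f (\<phi> (Suc n)))"
  shows "ascending subseq f \<phi>"
  unfolding ascending_def
proof (intro conjI allI impI)
  show "strict_mono \<phi>" using assms(1) by (simp add: strict_mono_Suc_iff)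
  fix i j :: nat assume "i < j"
  then show "subseq (f (\<phi> i)) (f (\<phi> j))"
    by (induction i j rule: less_Suc_induct) (use assms(2) subseq_order.order_trans in blast)+
qed

text \<open>Induction on the alphabet. If some \<open>f i\<close> fails to embed into infinitely
  many members, these form a sequence avoiding \<open>f i\<close>; otherwise each member embeds into
  almost all members, and a chain is built greedily.\<close>

lemma higman_lists:
  assumes "finite A"
  shows "higman (lists A)"
  using assms
proof (induction A rule: finite_psubset_induct)
  case (psubset A)
  have avoid: "higman {u \<in> lists A. \<not> subseq w u}" if "w \<in> lists A" for w
    by (rule higman_avoiding) (use psubset that in \<open>auto simp: lists_eq_set\<close>)
  show ?case unfolding higman_def
  proof (intro allI impI)
    fix f :: "nat \<Rightarrow> 'a list" assume f: "\<forall>i. f i \<in> lists A"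
    show "\<exists>\<phi>. ascending subseq f \<phi>"
    proof (cases "\<exists>i. infinite {j. \<not> subseq (f i) (f j)}")
      case True
      then obtain i where "infinite {j. \<not> subseq (f i) (f j)}" by blast
      from infinite_subsequence[OF this] obtain \<phi> :: "nat \<Rightarrow> nat" where
        \<phi>: "strict_mono \<phi>" "\<forall>j. \<phi> j \<in> {j. \<not> subseq (f i) (f j)}" by blast
      have "\<forall>j. (f \<circ> \<phi>) j \<in> {u \<in> lists A. \<not> subseq (f i) u}" using \<phi>(2) f by auto
      then obtain \<psi> where "ascending subseq (f \<circ> \<phi>) \<psi>" using avoid f unfolding higman_def by blast
      then show ?thesis using ascending_comp \<phi>(1) by blast
    next
      case False
      have next_index: "\<exists>k. i < k \<and> subseq (f i) (f k)" for i
      proof -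
        have "finite ({..i} \<union> {j. \<not> subseq (f i) (f j)})" using False by simp
        then obtain k where "k \<notin> {..i} \<union> {j. \<not> subseq (f i) (f j)}"
          using ex_new_if_finite[OF infinite_UNIV_nat] by blast
        then show ?thesis by (intro exI[of _ k]) simp
      qed
      then obtain g where g: "\<And>i. i < g i \<and> subseq (f i) (f (g i))" by metis
      have "ascending subseq f (\<lambda>n. (g ^^ n) 0)"
        by (rule chain_ascending) (use g in simp_all)
      then show ?thesis by blast
    qed
  qed
qed

section \<open>Valence grammars over finite groups\<close>

lemma append_in_shuffles_left: "w \<in> shuffles u v \<Longrightarrow> z @ w \<in> shuffles (z @ u) v"
  by (induction z) (auto intro: Cons_in_shuffles_leftI)

lemma append_in_shuffles_right: "w \<in> shuffles u v \<Longrightarrow> z @ w \<in> shuffles u (z @ v)"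
  using append_in_shuffles_left shuffles_commutes by metis

text \<open>Everything before the first letter of the left word must come from
  \<open>x\<close>.\<close>

lemma shuffles_Cons_split:
  "y \<in> shuffles (a # u) x \<longleftrightarrow> (\<exists>x\<^sub>1 x\<^sub>2 z. x = x\<^sub>1 @ x\<^sub>2 \<and> y = x\<^sub>1 @ a # z \<and> z \<in> shuffles u x\<^sub>2)"
proof
  assume "y \<in> shuffles (a # u) x"
  then show "\<exists>x\<^sub>1 x\<^sub>2 z. x = x\<^sub>1 @ x\<^sub>2 \<and> y = x\<^sub>1 @ a # z \<and> z \<in> shuffles u x\<^sub>2"
  proof (induction y arbitrary: x)
    case Nil then show ?case by simp
  next
    case (Cons b y)
    from Cons.prems show ?case
    proof (cases rule: Cons_in_shufflesE)
      case (left u')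
      then show ?thesis by (intro exI[of _ "[]"] exI[of _ x] exI[of _ y]) simp
    next
      case (right x')
      then obtain x\<^sub>1 x\<^sub>2 z where "x' = x\<^sub>1 @ x\<^sub>2" "y = x\<^sub>1 @ a # z" "z \<in> shuffles u x\<^sub>2"
        using Cons.IH by blast
      then show ?thesis using right(1) by (intro exI[of _ "b # x\<^sub>1"] exI[of _ x\<^sub>2] exI[of _ z]) simp
    qed
  qed
next
  assume "\<exists>x\<^sub>1 x\<^sub>2 z. x = x\<^sub>1 @ x\<^sub>2 \<and> y = x\<^sub>1 @ a # z \<and> z \<in> shuffles u x\<^sub>2"
  then show "y \<in> shuffles (a # u) x"
    by (auto intro: append_in_shuffles_right Cons_in_shuffles_leftI)
qed

text \<open>\<open>H\<close> will be the set of right invertible elements of the submonoid generated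
  by the valences, which is a finite group; \<open>cancel\<close> is the form in which its inverses
  enter.\<close>

locale finite_cancellative_submonoid = monoid G + H: submonoid H G for G (structure) and H +
  assumes finite_H: "finite H"
    and cancel: "p \<in> H \<Longrightarrow> z \<in> H \<Longrightarrow> p \<otimes> z = p \<Longrightarrow> z = \<one>"
begin

lemma H_carrier [simp]: "h \<in> H \<Longrightarrow> h \<in> carrier G"
  using H.subset by blast

lemma words_carrier [simp]: "set u \<subseteq> H \<Longrightarrow> set u \<subseteq> carrier G"
  using H.subset by blast

lemma mprod_H [simp]: "set u \<subseteq> H \<Longrightarrow> mprod u \<in> H"
  by (rule mprod_in_submonoid[OF H.submonoid_axioms])

section \<open>Insertion of factors of value \<open>\<one>\<close>\<close>

inductive inserts :: "'a list \<Rightarrow> 'a list \<Rightarrow> bool" where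
  inserts_Nil: "set z \<subseteq> H \<Longrightarrow> mprod z = \<one> \<Longrightarrow> inserts [] z"
| inserts_Cons: "set z \<subseteq> H \<Longrightarrow> mprod z = \<one> \<Longrightarrow> a \<in> H \<Longrightarrow> inserts u v \<Longrightarrow> inserts (a # u) (z @ a # v)"

lemma inserts_append:
  assumes "inserts u v" "set z \<subseteq> H" "mprod z = \<one>"
  shows "inserts u (z @ v)"
  using assms(1)
proof cases
  case inserts_Nil
  then show ?thesis using assms by (auto intro!: inserts.inserts_Nil simp: mprod_append)
next
  case (inserts_Cons x a u' v')
  have "inserts (a # u') ((z @ x) @ a # v')"
    using inserts_Cons assms by (intro inserts.inserts_Cons) (auto simp: mprod_append)
  then show ?thesis using inserts_Cons by simp
qed

lemma inserts_words: "inserts u v \<Longrightarrow> set u \<subseteq> H \<and> set v \<subseteq> H"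
  by (induction rule: inserts.induct) auto

text \<open>An inserted block is placed into the shuffle as a whole, where its value
  \<open>\<one>\<close> does not show. In general \<open>u'\<close> also has shuffles in which
  \<open>x\<close> tears a block apart, so new values may appear.\<close>

lemma inserts_shuffles:
  "inserts u u' \<Longrightarrow> set x \<subseteq> H \<Longrightarrow> y \<in> shuffles u x \<Longrightarrow> \<exists>y' \<in> shuffles u' x. mprod y' = mprod y"
proof (induction arbitrary: x y rule: inserts.induct)
  case (inserts_Nil z)
  then have "y = x" by simp
  moreover have "z @ x \<in> shuffles z x" using append_in_shuffles_left[of x "[]" x z] by simp
  moreover have "mprod (z @ x) = mprod x" using inserts_Nil by (simp add: mprod_append)
  ultimately show ?case by blast
next
  case (inserts_Cons z a u v)
  then obtain x\<^sub>1 x\<^sub>2 y\<^sub>0 where y: "x = x\<^sub>1 @ x\<^sub>2" "y = x\<^sub>1 @ a # y\<^sub>0" "y\<^sub>0 \<in> shuffles u x\<^sub>2"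
    unfolding shuffles_Cons_split by blast
  have xH: "set x\<^sub>1 \<subseteq> H" "set x\<^sub>2 \<subseteq> H" using inserts_Cons(6) y(1) by auto
  obtain y' where y': "y' \<in> shuffles v x\<^sub>2" "mprod y' = mprod y\<^sub>0"
    using inserts_Cons.IH[OF xH(2) y(3)] by blast
  have words: "set u \<subseteq> H" "set v \<subseteq> H" using inserts_words inserts_Cons(4) by auto
  have yH: "set y\<^sub>0 \<subseteq> H" "set y' \<subseteq> H"
    using words xH(2) set_shuffles[OF y(3)] set_shuffles[OF y'(1)] by auto
  have "z @ x\<^sub>1 @ a # y' \<in> shuffles (z @ a # v) (x\<^sub>1 @ x\<^sub>2)"
    using y'(1) by (intro append_in_shuffles_left append_in_shuffles_right Cons_in_shuffles_leftI)
  moreover have "mprod (z @ x\<^sub>1 @ a # y') = mprod (x\<^sub>1 @ a # y\<^sub>0)"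
    using inserts_Cons(1-3) xH yH y'(2) by (simp add: mprod_append)
  ultimately show ?case using y(1,2) by blast
qed

text \<open>Recording the product of the preceding letters turns the subword order into a refinement of
  \<^term>\<open>inserts\<close>: between two matched letters the value does not change.\<close>

fun code :: "'a \<Rightarrow> 'a list \<Rightarrow> ('a \<times> 'a) list" where
  "code p [] = []"
| "code p (a # u) = (p, a) # code (p \<otimes> a) u"

lemma code_splitE:
  assumes "code q v = ys @ (p, a) # zs" "set v \<subseteq> H" "q \<in> H"
  shows "\<exists>z v'. v = z @ a # v' \<and> q \<otimes> mprod z = p \<and> zs = code (p \<otimes> a) v'"
  using assms
proof (induction ys arbitrary: q v)
  case Nil
  then obtain v' where "v = a # v'" "q = p" "zs = code (p \<otimes> a) v'" by (cases v) auto
  then show ?case using Nil.prems by (intro exI[of _ "[]"] exI[of _ v']) simp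
next
  case (Cons y ys)
  then obtain b w where v: "v = b # w" "code (q \<otimes> b) w = ys @ (p, a) # zs" by (cases v) auto
  moreover have "set w \<subseteq> H" "q \<otimes> b \<in> H" using Cons.prems v(1) by auto
  ultimately obtain z v' where z: "w = z @ a # v'" "(q \<otimes> b) \<otimes> mprod z = p" "zs = code (p \<otimes> a) v'"
    using Cons.IH by blast
  moreover have "set z \<subseteq> H" "b \<in> H" using v(1) z(1) Cons.prems by auto
  ultimately show ?case using v(1) Cons.prems by (intro exI[of _ "b # z"] exI[of _ v']) (simp add: m_assoc)
qed

text \<open>The products \<open>p\<close> and \<open>q\<close> before the two words may differ, and
  the prefix \<open>z\<close> makes up for the difference. Equality of the total products takes care
  of the letters of \<open>v\<close> after the last match.\<close>

lemma subseq_code_inserts: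
  "subseq (code p u) (code q v) \<Longrightarrow> set u \<subseteq> H \<Longrightarrow> set v \<subseteq> H \<Longrightarrow> p \<in> H \<Longrightarrow> q \<in> H \<Longrightarrow>
    p \<otimes> mprod u = q \<otimes> mprod v \<Longrightarrow> \<exists>z v'. v = z @ v' \<and> q \<otimes> mprod z = p \<and> inserts u v'"
proof (induction u arbitrary: p q v)
  case Nil
  then show ?case by (intro exI[of _ v] exI[of _ "[]"]) (auto intro: inserts_Nil)
next
  case (Cons a u)
  from Cons.prems(1) obtain ys zs where yz: "code q v = ys @ (p, a) # zs" "subseq (code (p \<otimes> a) u) zs"
    by (auto dest: list_emb_ConsD)
  then obtain z v' where z: "v = z @ a # v'" "q \<otimes> mprod z = p" "zs = code (p \<otimes> a) v'"
    using code_splitE Cons.prems by blast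
  have H: "a \<in> H" "set u \<subseteq> H" "set v' \<subseteq> H" "set z \<subseteq> H" "p \<otimes> a \<in> H" using Cons.prems z(1) by auto
  have "q \<otimes> mprod v = (q \<otimes> mprod z) \<otimes> a \<otimes> mprod v'"
    using z(1) H Cons.prems(5) by (simp add: mprod_append m_assoc)
  then have "(p \<otimes> a) \<otimes> mprod u = (p \<otimes> a) \<otimes> mprod v'"
    using Cons.prems(4,6) H z(2) by (simp add: m_assoc)
  then obtain x v'' where x: "v' = x @ v''" "(p \<otimes> a) \<otimes> mprod x = p \<otimes> a" "inserts u v''"
    using Cons.IH[of "p \<otimes> a" "p \<otimes> a" v'] yz(2) z(3) H by blast
  have xH: "set x \<subseteq> H" using H(3) x(1) by simp
  \<comment> \<open>The product is \<open>p \<otimes> a\<close> before and after \<open>x\<close>,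
    so cancellation makes \<open>x\<close> an insertable block.\<close>
  then have "mprod x = \<one>" using cancel[OF H(5) mprod_H x(2)] by blast
  then have "inserts u v'" using inserts_append x(1,3) xH by blast
  then have "inserts (a # u) ([] @ a # v')" using H by (intro inserts_Cons) auto
  then show ?case using z by (intro exI[of _ z] exI[of _ "a # v'"]) simp
qed

lemma inserts_ascending:
  fixes f :: "nat \<Rightarrow> 'a list"
  assumes f: "\<And>i. set (f i) \<subseteq> H"
  shows "\<exists>\<phi>. ascending inserts f \<phi>"
proof -
  \<comment> \<open>Insertion preserves the total product, so the sequence is first thinned until
    this product is constant.\<close>
  have "finite (range (\<lambda>i. mprod (f i)))" by (rule finite_subset[OF _ finite_H]) (use f in auto)
  from constant_subsequence[OF this] obtain \<phi> :: "nat \<Rightarrow> nat" and c where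
    \<phi>: "strict_mono \<phi>" "\<forall>i. mprod (f (\<phi> i)) = c" by blast
  have code_lists: "p \<in> H \<Longrightarrow> set u \<subseteq> H \<Longrightarrow> code p u \<in> lists (H \<times> H)" for p u
    by (induction u arbitrary: p) auto
  have codes: "code \<one> (f (\<phi> i)) \<in> lists (H \<times> H)" for i
    by (rule code_lists[OF H.one_closed f])
  have "higman (lists (H \<times> H))" by (rule higman_lists) (simp add: finite_H)
  from this[unfolded higman_def, rule_format, OF codes]
  have "\<exists>\<psi>. ascending subseq (\<lambda>i. code \<one> (f (\<phi> i))) \<psi>" .
  then obtain \<psi> where \<psi>: "ascending subseq (\<lambda>i. code \<one> (f (\<phi> i))) \<psi>" by blast
  have "ascending inserts (f \<circ> \<phi>) \<psi>"
    unfolding ascending_def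
  proof (intro conjI allI impI)
    show "strict_mono \<psi>" using \<psi> by (simp add: ascending_def)
    fix i j :: nat assume "i < j"
    let ?u = "f (\<phi> (\<psi> i))" and ?v = "f (\<phi> (\<psi> j))"
    have "subseq (code \<one> ?u) (code \<one> ?v)" using \<psi> \<open>i < j\<close> by (simp add: ascending_def)
    then obtain z v' where z: "?v = z @ v'" "\<one> \<otimes> mprod z = \<one>" "inserts ?u v'"
      using subseq_code_inserts[of \<one> ?u \<one> ?v] f \<phi>(2) by auto
    have "set z \<subseteq> H" using z(1) f[of "\<phi> (\<psi> j)"] by simp
    then have "inserts ?u ?v" unfolding z(1) using inserts_append z(2,3) by simp
    then show "inserts ((f \<circ> \<phi>) (\<psi> i)) ((f \<circ> \<phi>) (\<psi> j))" by simp
  qed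
  then show ?thesis using ascending_comp \<phi>(1) by blast
qed

text \<open>\<open>x\<close> is a test word: it stands for the valences that the rest of a
  derivation interleaves with a word of \<open>K\<close>, like a context in a syntactic
  congruence.\<close>

definition behaviour :: "'a list set \<Rightarrow> ('a list \<times> 'a) set" where
  "behaviour K = {(x, h). set x \<subseteq> H \<and> (\<exists>y \<in> Shuffle K {x}. mprod y = h)}"

lemma behaviour_singleton_mono: "inserts u u' \<Longrightarrow> behaviour {u} \<subseteq> behaviour {u'}"
proof
  fix z assume u: "inserts u u'" and z: "z \<in> behaviour {u}"
  then obtain x y where y: "set x \<subseteq> H" "y \<in> shuffles u x" "z = (x, mprod y)"
    by (auto simp: behaviour_def Shuffle_iff)
  then obtain y' where "y' \<in> shuffles u' x" "mprod y' = mprod y" using inserts_shuffles[OF u] by blast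
  then show "z \<in> behaviour {u'}" using y by (auto simp: behaviour_def Shuffle_iff)
qed

text \<open>Shuffling is symmetric, so \<open>inserts_shuffles\<close> applies to the test word as
  well.\<close>

lemma behaviour_upward_closed:
  assumes "(x, h) \<in> behaviour {u}" "inserts x x'" "set u \<subseteq> H"
  shows "(x', h) \<in> behaviour {u}"
proof -
  obtain y where "y \<in> shuffles x u" "mprod y = h"
    using assms(1) by (auto simp: behaviour_def Shuffle_def shuffles_commutes)
  then obtain y' where "y' \<in> shuffles x' u" "mprod y' = h" using inserts_shuffles[OF assms(2,3)] by blast
  then show ?thesis
    using inserts_words[OF assms(2)] by (auto simp: behaviour_def Shuffle_def shuffles_commutes)
qed

text \<open>Along an ascending sequence of words the behaviours form an ascending chain of sets that are
  themselves upward closed with respect to a well-quasi-order, so they become stationary.\<close>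

lemma finite_behaviours_words: "finite ((\<lambda>u. behaviour {u}) ` {u. set u \<subseteq> H})"
proof (rule ccontr)
  let ?b = "\<lambda>u. behaviour {u}"
  assume "infinite (?b ` {u. set u \<subseteq> H})"
  then obtain g :: "nat \<Rightarrow> ('a list \<times> 'a) set" where g: "inj g" "range g \<subseteq> ?b ` {u. set u \<subseteq> H}"
    using infinite_countable_subset by blast
  then have "\<forall>i. \<exists>u. g i = ?b u \<and> set u \<subseteq> H" by blast
  then obtain u where u: "\<And>i. g i = ?b (u i)" "\<And>i. set (u i) \<subseteq> H" by metis
  obtain \<phi> where \<phi>: "ascending inserts u \<phi>" using inserts_ascending u(2) by blast
  define w where "w i = u (\<phi> i)" for i
  have wH: "set (w i) \<subseteq> H" for i by (simp add: w_def u(2))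
  have mono: "?b (w i) \<subseteq> ?b (w j)" if "i < j" for i j
    using behaviour_singleton_mono \<phi> that by (simp add: ascending_def w_def)
  have "?b (w i) \<noteq> ?b (w (Suc i))" for i
  proof -
    have "\<phi> i < \<phi> (Suc i)" using \<phi> by (simp add: ascending_def strict_mono_def)
    then have "g (\<phi> i) \<noteq> g (\<phi> (Suc i))" using g(1) by (auto dest: injD)
    then show ?thesis by (simp add: u(1) w_def)
  qed
  then have "\<exists>z. z \<in> ?b (w (Suc i)) \<and> z \<notin> ?b (w i)" for i using mono[of i "Suc i"] by blast
  then have "\<forall>i. \<exists>x h. (x, h) \<in> ?b (w (Suc i)) \<and> (x, h) \<notin> ?b (w i)" by (metis surj_pair)
  then obtain x h where xh: "\<And>i. (x i, h i) \<in> ?b (w (Suc i))" "\<And>i. (x i, h i) \<notin> ?b (w i)" by metis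
  have xH: "set (x i) \<subseteq> H" for i using xh(1)[of i] by (simp add: behaviour_def)
  have hH: "h i \<in> H" for i
  proof -
    obtain y where "y \<in> shuffles (w (Suc i)) (x i)" "mprod y = h i"
      using xh(1)[of i] by (auto simp: behaviour_def Shuffle_def)
    then show ?thesis using set_shuffles[of y] xH[of i] wH[of "Suc i"] mprod_H[of y] by auto
  qed
  have "finite (range h)" by (rule finite_subset[OF _ finite_H]) (use hH in auto)
  from constant_subsequence[OF this] obtain \<psi> :: "nat \<Rightarrow> nat" and c where
    \<psi>: "strict_mono \<psi>" "\<forall>i. h (\<psi> i) = c" by blast
  obtain \<chi> where \<chi>: "ascending inserts (x \<circ> \<psi>) \<chi>" using inserts_ascending[of "x \<circ> \<psi>"] xH by auto
  \<comment> \<open>The witness of stage \<open>?i\<close> persists up to stage \<open>?j\<close>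
    and, by upward closure, puts the witness of stage \<open>?j\<close> into a behaviour that should
    not yet contain it.\<close>
  let ?i = "\<psi> (\<chi> 0)" and ?j = "\<psi> (\<chi> 1)"
  have "\<chi> 0 < \<chi> 1" using \<chi> by (simp add: ascending_def strict_mono_def)
  then have ij: "?i < ?j" using \<psi>(1) by (simp add: strict_mono_def)
  have "(x ?i, c) \<in> ?b (w (Suc ?i))" using xh(1)[of ?i] \<psi>(2) by simp
  then have "(x ?i, c) \<in> ?b (w ?j)" using mono[of "Suc ?i" ?j] ij by (cases "Suc ?i = ?j") auto
  moreover have "inserts (x ?i) (x ?j)" using \<chi> by (simp add: ascending_def)
  ultimately have "(x ?j, c) \<in> ?b (w ?j)" using behaviour_upward_closed wH by blast
  then show False using xh(2)[of ?j] \<psi>(2) by simp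
qed

text \<open>\<open>behaviour\<close> is additive in \<open>K\<close>, so each of its values is a
  union of some of the finitely many behaviours of words.\<close>

lemma finite_behaviours: "finite (behaviour ` Pow {u. set u \<subseteq> H})"
proof (rule finite_subset)
  show "behaviour ` Pow {u. set u \<subseteq> H} \<subseteq> Union ` Pow ((\<lambda>u. behaviour {u}) ` {u. set u \<subseteq> H})"
  proof
    fix b assume "b \<in> behaviour ` Pow {u. set u \<subseteq> H}"
    then obtain K where K: "K \<in> Pow {u. set u \<subseteq> H}" "b = behaviour K" by (rule imageE)
    have "b = \<Union> ((\<lambda>u. behaviour {u}) ` K)" unfolding K(2) by (auto simp: behaviour_def Shuffle_def)
    moreover have "(\<lambda>u. behaviour {u}) ` K \<in> Pow ((\<lambda>u. behaviour {u}) ` {u. set u \<subseteq> H})"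
      using K(1) by (intro PowI image_mono) simp
    ultimately show "b \<in> Union ` Pow ((\<lambda>u. behaviour {u}) ` {u. set u \<subseteq> H})" by (rule image_eqI)
  qed
  show "finite (Union ` Pow ((\<lambda>u. behaviour {u}) ` {u. set u \<subseteq> H}))" using finite_behaviours_words by simp
qed

text \<open>By associativity, testing \<open>Shuffle K L\<close> with \<open>x\<close> is testing
  \<open>K\<close> with the words of \<open>Shuffle L {x}\<close>.\<close>

lemma behaviour_Shuffle_left:
  assumes "behaviour K = behaviour K'" "L \<subseteq> {u. set u \<subseteq> H}"
  shows "behaviour (Shuffle K L) = behaviour (Shuffle K' L)"
proof -
  have iff: "(x, h) \<in> behaviour (Shuffle J L) \<longleftrightarrow> set x \<subseteq> H \<and> (\<exists>z \<in> Shuffle L {x}. (z, h) \<in> behaviour J)" for J x h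
  proof -
    have "set z \<subseteq> H" if x: "set x \<subseteq> H" and z: "z \<in> Shuffle L {x}" for z
    proof -
      obtain l where "l \<in> L" "z \<in> shuffles l x" using z by (auto simp: Shuffle_iff)
      then show ?thesis using set_shuffles[of z l x] assms(2) x by auto
    qed
    moreover have "Shuffle J (Shuffle L {x}) = (\<Union>z \<in> Shuffle L {x}. Shuffle J {z})"
      unfolding Shuffle_def by blast
    then have "(\<exists>y \<in> Shuffle (Shuffle J L) {x}. mprod y = h) \<longleftrightarrow>
        (\<exists>z \<in> Shuffle L {x}. \<exists>y \<in> Shuffle J {z}. mprod y = h)"
      unfolding Shuffle_assoc by simp
    ultimately show ?thesis unfolding behaviour_def mem_Collect_eq prod.case by blast
  qed
  show ?thesis by (rule Set.set_eqI) (use iff assms(1) in \<open>simp add: split_paired_all\<close>)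
qed

lemma behaviour_Shuffle:
  assumes "behaviour K = behaviour K'" "behaviour L = behaviour L'"
    and "L \<subseteq> {u. set u \<subseteq> H}" "K' \<subseteq> {u. set u \<subseteq> H}"
  shows "behaviour (Shuffle K L) = behaviour (Shuffle K' L')"
proof -
  have "behaviour (Shuffle K L) = behaviour (Shuffle K' L)" by (rule behaviour_Shuffle_left[OF assms(1,3)])
  also have "\<dots> = behaviour (Shuffle L K')" by (subst Shuffle_commute) (rule refl)
  also have "\<dots> = behaviour (Shuffle L' K')" by (rule behaviour_Shuffle_left[OF assms(2,4)])
  also have "\<dots> = behaviour (Shuffle K' L')" by (subst Shuffle_commute) (rule refl)
  finally show ?thesis .
qed

text \<open>A shuffle of \<open>m # u\<close> with \<open>x\<close> starts with a prefix of
  \<open>x\<close> and then \<open>m\<close>; what follows is a test of \<open>u\<close> with the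
  remaining suffix of \<open>x\<close>.\<close>

lemma behaviour_Cons:
  assumes "behaviour K = behaviour K'" "m \<in> H" "K \<subseteq> {u. set u \<subseteq> H}" "K' \<subseteq> {u. set u \<subseteq> H}"
  shows "behaviour ((#) m ` K) = behaviour ((#) m ` K')"
proof -
  have "(x, h) \<in> behaviour ((#) m ` J) \<longleftrightarrow> set x \<subseteq> H \<and>
      (\<exists>x\<^sub>1 x\<^sub>2 k. x = x\<^sub>1 @ x\<^sub>2 \<and> (x\<^sub>2, k) \<in> behaviour J \<and> h = mprod x\<^sub>1 \<otimes> (m \<otimes> k))" (is "?l \<longleftrightarrow> ?r")
    if J: "J \<subseteq> {u. set u \<subseteq> H}" for J x h
  proof
    assume ?l
    then obtain u y where u: "set x \<subseteq> H" "u \<in> J" "y \<in> shuffles (m # u) x" "mprod y = h"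
      by (auto simp: behaviour_def Shuffle_iff)
    then obtain x\<^sub>1 x\<^sub>2 z where z: "x = x\<^sub>1 @ x\<^sub>2" "y = x\<^sub>1 @ m # z" "z \<in> shuffles u x\<^sub>2"
      unfolding shuffles_Cons_split by blast
    have "set x\<^sub>1 \<subseteq> H" "set x\<^sub>2 \<subseteq> H" "set z \<subseteq> H" using u(1,2) z J set_shuffles[OF z(3)] by auto
    moreover have "z \<in> Shuffle J {x\<^sub>2}" using u(2) z(3) by (auto simp: Shuffle_iff)
    ultimately have "h = mprod x\<^sub>1 \<otimes> (m \<otimes> mprod z)" "(x\<^sub>2, mprod z) \<in> behaviour J"
      using u(4) z(2) assms(2) by (auto simp: mprod_append behaviour_def)
    then show ?r using u(1) z(1) by blast
  next
    assume r: ?r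
    then obtain x\<^sub>1 x\<^sub>2 k where x: "x = x\<^sub>1 @ x\<^sub>2" "(x\<^sub>2, k) \<in> behaviour J" "h = mprod x\<^sub>1 \<otimes> (m \<otimes> k)" by blast
    then obtain u z where u: "u \<in> J" "z \<in> shuffles u x\<^sub>2" "mprod z = k" by (auto simp: behaviour_def Shuffle_iff)
    have "set x\<^sub>1 \<subseteq> H" "set z \<subseteq> H" using r x u J set_shuffles[OF u(2)] by auto
    then have "mprod (x\<^sub>1 @ m # z) = h" using x u assms(2) by (simp add: mprod_append)
    moreover have "x\<^sub>1 @ m # z \<in> shuffles (m # u) x" unfolding shuffles_Cons_split using x(1) u(2) by blast
    then have "x\<^sub>1 @ m # z \<in> Shuffle ((#) m ` J) {x}" using u(1) by (auto simp: Shuffle_iff)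
    ultimately show ?l using r unfolding behaviour_def by blast
  qed
  then show ?thesis using assms by auto
qed

section \<open>The annotated context-free grammar\<close>

lemma parse_words:
  assumes "\<And>A \<gamma> m. (A, \<gamma>, m) \<in> P \<Longrightarrow> m \<in> H"
  shows "parse P T \<alpha> w K \<Longrightarrow> K \<subseteq> {u. set u \<subseteq> H}"
proof (induction rule: parse.induct)
  case (parse_nonterminal A \<gamma> m w\<^sub>1 K\<^sub>1 \<alpha> w\<^sub>2 K\<^sub>2)
  show ?case
  proof
    fix v assume "v \<in> Shuffle ((#) m ` K\<^sub>1) K\<^sub>2"
    then obtain v\<^sub>1 v\<^sub>2 where "v\<^sub>1 \<in> K\<^sub>1" "v\<^sub>2 \<in> K\<^sub>2" "v \<in> shuffles (m # v\<^sub>1) v\<^sub>2" by (auto simp: Shuffle_iff)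
    then show "v \<in> {u. set u \<subseteq> H}"
      using parse_nonterminal.IH assms[OF parse_nonterminal(1)] set_shuffles[of v "m # v\<^sub>1" v\<^sub>2] by auto
  qed
qed auto

text \<open>\<open>\<alpha>'\<close> is \<open>\<alpha>\<close> with a guessed behaviour at every
  nonterminal; the last argument is the behaviour that these guesses imply for the whole word. The
  sets \<open>K\<close> and \<open>L\<close> are mere representatives: by
  \<open>behaviour_Shuffle\<close> the result depends on their behaviours only.\<close>

inductive annotated :: "(symbol \<times> ('a list \<times> 'a) set \<Rightarrow> symbol) \<Rightarrow> symbol set \<Rightarrow> symbol set \<Rightarrow>
    word \<Rightarrow> word \<Rightarrow> ('a list \<times> 'a) set \<Rightarrow> bool" for enc N T where
  annotated_Nil: "annotated enc N T [] [] (behaviour {[]})"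
| annotated_terminal: "a \<in> T \<Longrightarrow> annotated enc N T \<alpha> \<alpha>' b \<Longrightarrow> annotated enc N T (a # \<alpha>) (a # \<alpha>') b"
| annotated_nonterminal: "A \<in> N \<Longrightarrow> K \<subseteq> {u. set u \<subseteq> H} \<Longrightarrow> L \<subseteq> {u. set u \<subseteq> H} \<Longrightarrow>
    annotated enc N T \<alpha> \<alpha>' (behaviour L) \<Longrightarrow>
    annotated enc N T (A # \<alpha>) (enc (A, behaviour K) # \<alpha>') (behaviour (Shuffle K L))"

lemma annotated_letters:
  "annotated enc N T \<alpha> \<alpha>' b \<Longrightarrow>
    set \<alpha>' \<subseteq> T \<union> enc ` (N \<times> behaviour ` Pow {u. set u \<subseteq> H}) \<and> length \<alpha>' = length \<alpha>"
  by (induction rule: annotated.induct) auto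

text \<open>A nonterminal \<open>A\<close> of the new grammar is annotated with the behaviour of the set of valence sequences of
  the trees below \<open>A\<close>, which is finite information by \<^term>\<open>finite_behaviours\<close>.\<close>

lemma context_free_if_finite_valences:
  assumes fin: "finite N" "finite T" "finite P" and disj: "N \<inter> T = {}" and S: "S \<in> N"
    and P: "P \<subseteq> N \<times> lists (N \<union> T) \<times> H"
  shows "context_free_language {w. \<exists>v. derives P T [S] w v \<and> mprod v = \<one>}"
proof -
  let ?W = "{u. set u \<subseteq> H}"
  let ?\<Phi> = "behaviour ` Pow ?W"
  have PH: "(A, \<gamma>, m) \<in> P \<Longrightarrow> A \<in> N \<and> m \<in> H" for A \<gamma> m using P by auto
  have "finite (N \<times> ?\<Phi>)" using fin(1) finite_behaviours by simp
  from finite_imp_inj_to_nat_seg[OF this]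
  obtain g :: "symbol \<times> ('a list \<times> 'a) set \<Rightarrow> nat" where g: "inj_on g (N \<times> ?\<Phi>)"
    by (elim exE conjE)
  \<comment> \<open>\<open>st\<close> exceeds all terminals and every value of \<open>enc\<close>
    exceeds \<open>st\<close>, which keeps the new symbols fresh.\<close>
  define st where "st = Suc (Max (insert 0 T))"
  define enc where "enc c = Suc (st + g c)" for c
  have enc_inj: "enc (A, b) = enc (A', b') \<Longrightarrow> A \<in> N \<Longrightarrow> A' \<in> N \<Longrightarrow> b \<in> ?\<Phi> \<Longrightarrow> b' \<in> ?\<Phi> \<Longrightarrow> A = A' \<and> b = b'"
    for A A' b b'
    using inj_onD[OF g, of "(A, b)" "(A', b')"] unfolding enc_def by simp
  have T_less: "a < st" if "a \<in> T" for a
    using fin(2) that by (simp add: st_def less_Suc_eq_le)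
  have enc_st: "enc c \<noteq> st" "st < enc c" for c by (simp_all add: enc_def)
  have not_T: "enc c \<notin> T" "st \<notin> T" for c using T_less enc_st(2)[of c] by fastforce+
  let ?ann = "annotated enc N T"
  \<comment> \<open>A production verifies the guess at its head: this must be the behaviour computed
    from the annotated body by prefixing \<open>m\<close>. Although \<open>K\<close> ranges over
    infinitely many sets, finitely many productions arise, as heads and bodies mention behaviours
    only.\<close>
  define Q where "Q = {(enc (A, behaviour ((#) m ` K)), \<gamma>', ()) | A m K \<gamma>'.
      K \<subseteq> ?W \<and> (\<exists>\<gamma>. (A, \<gamma>, m) \<in> P \<and> ?ann \<gamma> \<gamma>' (behaviour K))}"
  \<comment> \<open>The start rule guesses a behaviour in which the empty test word has value
    \<open>\<one>\<close>, i.e. some valence sequence has product \<open>\<one>\<close>.\<close>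
  define R where "R = {(st, [enc (S, b)], ()) | b. b \<in> ?\<Phi> \<and> ([], \<one>) \<in> b}"
  define N' where "N' = insert st (enc ` (N \<times> ?\<Phi>))"
  define D where "D = \<lparr>nonterminals = N', terminals = T, productions = Q \<union> R, start_symbol = st\<rparr>"
  have finN': "finite N'" using fin(1) finite_behaviours by (simp add: N'_def)
  have Cons_W: "(#) m ` K \<subseteq> ?W" if "m \<in> H" "K \<subseteq> ?W" for m K
  proof
    fix u assume "u \<in> (#) m ` K"
    then obtain v where "v \<in> K" "u = m # v" by blast
    then show "u \<in> ?W" using that by (simp add: subset_iff)
  qed
  have Cons_\<Phi>: "behaviour ((#) m ` K) \<in> ?\<Phi>" if "m \<in> H" "K \<subseteq> ?W" for m K using Cons_W[OF that] by blast
  define d where "d = Suc (Max (insert 0 ((\<lambda>(A, \<gamma>, m). length \<gamma>) ` P)))"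
  have d: "length \<gamma> \<le> d" if "(A, \<gamma>, m) \<in> P" for A \<gamma> m
    using fin(3) that by (auto simp: d_def intro!: le_SucI Max_ge rev_image_eqI)
  have QR: "Q \<union> R \<subseteq> N' \<times> {\<gamma>. set \<gamma> \<subseteq> N' \<union> T \<and> length \<gamma> \<le> d} \<times> UNIV"
  proof
    fix z assume "z \<in> Q \<union> R"
    then show "z \<in> N' \<times> {\<gamma>. set \<gamma> \<subseteq> N' \<union> T \<and> length \<gamma> \<le> d} \<times> UNIV"
    proof
      assume "z \<in> Q"
      then obtain A m K \<gamma>' \<gamma> where z: "z = (enc (A, behaviour ((#) m ` K)), \<gamma>', ())" "K \<subseteq> ?W"
        "(A, \<gamma>, m) \<in> P" "?ann \<gamma> \<gamma>' (behaviour K)" unfolding Q_def by blast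
      have "enc (A, behaviour ((#) m ` K)) \<in> N'" using PH[OF z(3)] Cons_\<Phi>[OF _ z(2)] by (auto simp: N'_def)
      moreover have "set \<gamma>' \<subseteq> N' \<union> T" "length \<gamma>' \<le> d"
        using annotated_letters[OF z(4)] d[OF z(3)] by (auto simp: N'_def)
      ultimately show ?thesis using z(1) by simp
    next
      assume "z \<in> R"
      then obtain b where "z = (st, [enc (S, b)], ())" "b \<in> ?\<Phi>" unfolding R_def by blast
      then show ?thesis using S by (auto simp: N'_def d_def)
    qed
  qed
  have "finite {\<gamma>. set \<gamma> \<subseteq> N' \<union> T \<and> length \<gamma> \<le> d}"
    using finN' fin(2) by (intro finite_lists_length_le) simp
  then have "finite (Q \<union> R)" using finN' by (intro finite_subset[OF QR] finite_cartesian_product) simp_all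
  have N'T: "N' \<inter> T = {}" using not_T by (auto simp: N'_def)
  have D: "valence_grammar trivial_monoid D"
    unfolding valence_grammar_def D_def using finN' fin(2) N'T \<open>finite (Q \<union> R)\<close> QR
    by (auto simp: N'_def lists_eq_set singleton_group_def)
  have to_annotated: "\<exists>\<alpha>'. ?ann \<alpha> \<alpha>' (behaviour K) \<and> (\<exists>J. parse (Q \<union> R) T \<alpha>' w J)"
    if "parse P T \<alpha> w K" for \<alpha> w K
    using that
  proof (induction rule: parse.induct)
    case parse_Nil
    then show ?case using annotated_Nil[of enc N T] parse.parse_Nil[of "Q \<union> R" T] by blast
  next
    case (parse_terminal a \<alpha> w K)
    then obtain \<alpha>' J where "?ann \<alpha> \<alpha>' (behaviour K)" "parse (Q \<union> R) T \<alpha>' w J" by blast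
    with parse_terminal(1) have "?ann (a # \<alpha>) (a # \<alpha>') (behaviour K)" "parse (Q \<union> R) T (a # \<alpha>') (a # w) J"
      by (auto intro: annotated_terminal parse.parse_terminal)
    then show ?case by blast
  next
    case (parse_nonterminal A \<gamma> m w\<^sub>1 K\<^sub>1 \<alpha> w\<^sub>2 K\<^sub>2)
    obtain \<gamma>' J\<^sub>1 where 1: "?ann \<gamma> \<gamma>' (behaviour K\<^sub>1)" "parse (Q \<union> R) T \<gamma>' w\<^sub>1 J\<^sub>1"
      using parse_nonterminal.IH(1) by blast
    obtain \<alpha>' J\<^sub>2 where 2: "?ann \<alpha> \<alpha>' (behaviour K\<^sub>2)" "parse (Q \<union> R) T \<alpha>' w\<^sub>2 J\<^sub>2"
      using parse_nonterminal.IH(2) by blast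
    have W: "K\<^sub>1 \<subseteq> ?W" "K\<^sub>2 \<subseteq> ?W" using parse_words PH parse_nonterminal(2,3) by blast+
    have A: "A \<in> N" "m \<in> H" using PH parse_nonterminal(1) by auto
    let ?A = "enc (A, behaviour ((#) m ` K\<^sub>1))"
    have "(?A, \<gamma>', ()) \<in> Q" unfolding Q_def using parse_nonterminal(1) 1(1) W(1) by blast
    then have "parse (Q \<union> R) T (?A # \<alpha>') (w\<^sub>1 @ w\<^sub>2) (Shuffle ((#) () ` J\<^sub>1) J\<^sub>2)"
      by (intro parse.parse_nonterminal[OF _ 1(2) 2(2)]) simp
    moreover have "?ann (A # \<alpha>) (?A # \<alpha>') (behaviour (Shuffle ((#) m ` K\<^sub>1) K\<^sub>2))"
      by (rule annotated_nonterminal[OF A(1) Cons_W[OF A(2) W(1)] W(2) 2(1)])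
    ultimately show ?case by blast
  qed
  \<comment> \<open>The set of valence sequences found here need not be the one behind the
    annotation. It has the same behaviour, and \<open>behaviour_Cons\<close> and
    \<open>behaviour_Shuffle\<close> carry this up the tree.\<close>
  have from_annotated: "\<exists>K. parse P T \<alpha> w K \<and> behaviour K = b"
    if "parse (Q \<union> R) T \<beta> w J" "?ann \<alpha> \<beta> b" for \<beta> w J \<alpha> b
    using that
  proof (induction arbitrary: \<alpha> b rule: parse.induct)
    case parse_Nil
    from parse_Nil.prems have "\<alpha> = []" "b = behaviour {[]}" by (auto elim: annotated.cases)
    then show ?case using parse.parse_Nil by blast
  next
    case (parse_terminal a \<beta> w J)
    from parse_terminal.prems show ?case
    proof (cases rule: annotated.cases)
      case (annotated_terminal \<alpha>\<^sub>0)
      then obtain K where "parse P T \<alpha>\<^sub>0 w K" "behaviour K = b" using parse_terminal.IH by blast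
      then show ?thesis using annotated_terminal parse.parse_terminal by blast
    next
      case annotated_nonterminal
      then show ?thesis using parse_terminal(1) not_T(1) by blast
    qed
  next
    case (parse_nonterminal B \<gamma>' m' w\<^sub>1 J\<^sub>1 \<beta> w\<^sub>2 J\<^sub>2)
    from parse_nonterminal.prems show ?case
    proof (cases rule: annotated.cases)
      case annotated_terminal
      then have "B \<in> T" "B \<in> N'" using parse_nonterminal(1) QR by auto
      then show ?thesis using N'T by blast
    next
      case (annotated_nonterminal A K\<^sub>1 K\<^sub>2 \<alpha>\<^sub>0)
      have "(B, \<gamma>', m') \<in> Q"
        using parse_nonterminal(1) annotated_nonterminal(2) enc_st(1) by (auto simp: R_def)
      then obtain A' m K \<gamma> where Q: "B = enc (A', behaviour ((#) m ` K))" "K \<subseteq> ?W" "(A', \<gamma>, m) \<in> P"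
        "?ann \<gamma> \<gamma>' (behaviour K)" unfolding Q_def by blast
      have m: "m \<in> H" "A' \<in> N" using PH[OF Q(3)] by auto
      have "enc (A', behaviour ((#) m ` K)) = enc (A, behaviour K\<^sub>1)"
        using Q(1) annotated_nonterminal(2) by simp
      then have eq: "A' = A" "behaviour ((#) m ` K) = behaviour K\<^sub>1"
        using enc_inj[OF _ m(2) annotated_nonterminal(4) Cons_\<Phi>[OF m(1) Q(2)]] annotated_nonterminal(5) by blast+
      obtain K' where K': "parse P T \<gamma> w\<^sub>1 K'" "behaviour K' = behaviour K"
        using parse_nonterminal.IH(1)[OF Q(4)] by blast
      obtain L where L: "parse P T \<alpha>\<^sub>0 w\<^sub>2 L" "behaviour L = behaviour K\<^sub>2"
        using parse_nonterminal.IH(2)[OF annotated_nonterminal(7)] by blast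
      have W: "K' \<subseteq> ?W" "L \<subseteq> ?W" using parse_words PH K'(1) L(1) by blast+
      have "behaviour ((#) m ` K') = behaviour K\<^sub>1"
        using behaviour_Cons[OF K'(2) m(1) W(1) Q(2)] eq(2) by simp
      then have "behaviour (Shuffle ((#) m ` K') L) = b"
        using behaviour_Shuffle[OF _ L(2) W(2) annotated_nonterminal(5)] annotated_nonterminal(3) by simp
      moreover have "parse P T (A # \<alpha>\<^sub>0) (w\<^sub>1 @ w\<^sub>2) (Shuffle ((#) m ` K') L)"
        using parse.parse_nonterminal[OF Q(3) K'(1) L(1)] eq(1) by simp
      ultimately show ?thesis using annotated_nonterminal(1) by blast
    qed
  qed
  have accept: "([], \<one>) \<in> behaviour K \<longleftrightarrow> (\<exists>v \<in> K. mprod v = \<one>)" for K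
    by (auto simp: behaviour_def Shuffle_iff)
  have "{w. \<exists>v. derives P T [S] w v \<and> mprod v = \<one>} = {w. \<exists>J. parse (Q \<union> R) T [st] w J}"
  proof (intro Set.set_eqI iffI)
    fix w assume "w \<in> {w. \<exists>v. derives P T [S] w v \<and> mprod v = \<one>}"
    then obtain K where K: "parse P T [S] w K" "([], \<one>) \<in> behaviour K"
      unfolding derives_iff_parse accept by blast
    obtain \<alpha>' J where \<alpha>': "?ann [S] \<alpha>' (behaviour K)" "parse (Q \<union> R) T \<alpha>' w J" using to_annotated[OF K(1)] by blast
    from \<alpha>'(1) have "\<exists>b \<in> ?\<Phi>. \<alpha>' = [enc (S, b)] \<and> b = behaviour K"
    proof (cases rule: annotated.cases)
      case annotated_terminal
      then show ?thesis using S disj by blast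
    next
      case (annotated_nonterminal K\<^sub>1 K\<^sub>2 \<alpha>'')
      from annotated_nonterminal(6) have "\<alpha>'' = []" "behaviour K\<^sub>2 = behaviour {[]}" by (auto elim: annotated.cases)
      moreover from this(2) have "behaviour (Shuffle K\<^sub>1 K\<^sub>2) = behaviour K\<^sub>1"
        using behaviour_Shuffle[OF refl _ annotated_nonterminal(5,4)] Shuffle_commute[of K\<^sub>1 "{[]}"] by simp
      ultimately show ?thesis using annotated_nonterminal(1,2,4) by auto
    qed
    then have "(st, \<alpha>', ()) \<in> Q \<union> R" using K(2) unfolding R_def by blast
    from parse_nonterminal[OF this \<alpha>'(2) parse_Nil] show "w \<in> {w. \<exists>J. parse (Q \<union> R) T [st] w J}" by auto
  next
    fix w assume "w \<in> {w. \<exists>J. parse (Q \<union> R) T [st] w J}"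
    then obtain J where J: "parse (Q \<union> R) T [st] w J" by blast
    then obtain \<gamma> J' where \<gamma>: "(st, \<gamma>, ()) \<in> Q \<union> R" "parse (Q \<union> R) T \<gamma> w J'"
    proof (cases rule: parse.cases)
      case (parse_nonterminal \<gamma> m v J\<^sub>1 v' J\<^sub>2)
      then have "v' = []" by (auto elim: parse.cases)
      then show ?thesis using parse_nonterminal that by simp
    qed (use not_T in auto)
    then have "(st, \<gamma>, ()) \<in> R" using enc_st(1) by (auto simp: Q_def)
    then obtain b where b: "\<gamma> = [enc (S, b)]" "b \<in> ?\<Phi>" "([], \<one>) \<in> b" unfolding R_def by blast
    then obtain K where K: "K \<subseteq> ?W" "b = behaviour K" by auto
    have "?ann [S] \<gamma> (behaviour (Shuffle K {[]}))"
      unfolding b(1) K(2) by (rule annotated_nonterminal[OF S K(1) _ annotated_Nil]) simp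
    then have "?ann [S] \<gamma> b" using Shuffle_commute[of K "{[]}"] K(2) by simp
    then obtain K' where K': "parse P T [S] w K'" "behaviour K' = b" using from_annotated[OF \<gamma>(2)] by blast
    then obtain v where "v \<in> K'" "mprod v = \<one>" using b(3) accept by blast
    then show "w \<in> {w. \<exists>v. derives P T [S] w v \<and> mprod v = \<one>}"
      using K'(1) unfolding derives_iff_parse by blast
  qed
  also have "\<dots> = grammar_language trivial_monoid D"
    unfolding context_free_grammar_language_eq[OF D] by (simp add: D_def)
  finally show ?thesis using D unfolding context_free_language_def by blast
qed

end

section \<open>Reduction to valences from a finite group\<close>

lemma derives_restrict:
  "derives P T \<alpha> w v \<Longrightarrow> set v \<subseteq> H \<Longrightarrow> derives {(A, \<gamma>, m) \<in> P. m \<in> H} T \<alpha> w v"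
  by (induction rule: derives.induct) (auto intro: derives.intros)

lemma derives_mono: "derives P T \<alpha> w v \<Longrightarrow> P \<subseteq> P' \<Longrightarrow> derives P' T \<alpha> w v"
  by (induction rule: derives.induct) (auto intro: derives.intros)

text \<open>In a derivation with product \<open>\<one>\<close> every valence is a two-sided factor
  of \<open>\<one>\<close> in \<open>N\<close>, hence lies in \<open>H\<close>; productions with
  other valences can be removed without changing the language.\<close>

lemma (in monoid) context_free_grammar_language:
  assumes fin: "\<And>N. finitely_generated_submonoid N G \<Longrightarrow> finite (right_invertibles (G\<lparr>carrier := N\<rparr>))"
    and D: "valence_grammar G D"
  shows "context_free_language (grammar_language G D)"
proof -
  let ?P = "productions D" and ?T = "terminals D" and ?S = "start_symbol D"
  define B where "B = (\<lambda>(A, \<gamma>, m). m) ` ?P"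
  have B: "finite B" "B \<subseteq> carrier G" using D by (auto simp: B_def valence_grammar_def)
  define N where "N = mprod ` lists B"
  have fgN: "finitely_generated_submonoid N G" using B by (auto simp: N_def finitely_generated_submonoid_iff)
  interpret N: submonoid N G by (rule submonoid_if_finitely_generated[OF fgN])
  interpret S: monoid "G\<lparr>carrier := N\<rparr>" by (rule submonoid.submonoid_is_monoid[OF N.submonoid_axioms monoid_axioms])
  define H where "H = right_invertibles (G\<lparr>carrier := N\<rparr>)"
  have finH: "finite H" unfolding H_def by (rule fin[OF fgN])
  have H_iff: "h \<in> H \<longleftrightarrow> h \<in> N \<and> (\<exists>b \<in> N. h \<otimes> b = \<one>)" for h
    by (auto simp: H_def right_invertibles_def)
  have H_two_sided: "h \<in> H" if "h \<in> N" "a \<in> N" "b \<in> N" "a \<otimes> h \<otimes> b = \<one>" for a h b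
    using S.two_sided_factors_eq_right_invertibles finH that unfolding H_def two_sided_factors_def by auto
  have "submonoid H G"
  proof
    show "H \<subseteq> carrier G" using N.subset H_iff by blast
    show "\<one> \<in> H" unfolding H_iff by (intro conjI bexI[of _ \<one>]) auto
    fix x y assume "x \<in> H" "y \<in> H"
    then obtain x' y' where xy: "x \<in> N" "x' \<in> N" "x \<otimes> x' = \<one>" "y \<in> N" "y' \<in> N" "y \<otimes> y' = \<one>"
      unfolding H_iff by blast
    then have car: "x \<in> carrier G" "x' \<in> carrier G" "y \<in> carrier G" "y' \<in> carrier G" using N.subset by auto
    then have "(x \<otimes> y) \<otimes> (y' \<otimes> x') = x \<otimes> ((y \<otimes> y') \<otimes> x')" by (simp only: m_assoc m_closed)
    also have "\<dots> = \<one>" using xy(3,6) car by simp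
    finally show "x \<otimes> y \<in> H" unfolding H_iff using xy by blast
  qed
  moreover have "z = \<one>" if pz: "p \<in> H" "z \<in> H" "p \<otimes> z = p" for p z
  proof -
    obtain q where q: "p \<in> N" "q \<in> N" "p \<otimes> q = \<one>" using pz(1) unfolding H_iff by blast
    then have "q \<otimes> p = \<one>"
      using S.finite_right_invertibles_commute[of p q] finH unfolding H_def by simp
    moreover have "z \<in> carrier G" "p \<in> carrier G" "q \<in> carrier G" using pz(2) q N.subset H_iff by auto
    ultimately show ?thesis using pz(3) by (metis l_one m_assoc)
  qed
  ultimately interpret H: finite_cancellative_submonoid G H
    using finH by (simp add: finite_cancellative_submonoid_def finite_cancellative_submonoid_axioms_def monoid_axioms)
  let ?Q = "{(A, \<gamma>, m) \<in> ?P. m \<in> H}"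
  have in_H: "set v \<subseteq> H" if "set v \<subseteq> B" "mprod v = \<one>" for v
  proof
    fix m assume "m \<in> set v"
    then obtain x y where v: "v = x @ m # y" by (meson split_list)
    have "set x \<subseteq> B" "set y \<subseteq> B" "m \<in> B" using that(1) v by auto
    then have "mprod x \<in> N" "mprod y \<in> N" "m \<in> N" "mprod x \<otimes> m \<otimes> mprod y = \<one>"
      using that(2) v B(2) subset_mprod_lists[OF B(2)]
      by (auto simp: N_def mprod_append m_assoc lists_eq_set subset_iff)
    then show "m \<in> H" using H_two_sided by blast
  qed
  have "grammar_language G D = {w. \<exists>v. derives ?P ?T [?S] w v \<and> mprod v = \<one>}"
    by (rule grammar_language_eq[OF D])
  also have "\<dots> = {w. \<exists>v. derives ?Q ?T [?S] w v \<and> mprod v = \<one>}"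
  proof (intro Set.set_eqI iffI)
    fix w assume "w \<in> {w. \<exists>v. derives ?P ?T [?S] w v \<and> mprod v = \<one>}"
    then obtain v where v: "derives ?P ?T [?S] w v" "mprod v = \<one>" by blast
    then have "set v \<subseteq> H" using in_H derives_valences[OF v(1)] unfolding B_def by blast
    then show "w \<in> {w. \<exists>v. derives ?Q ?T [?S] w v \<and> mprod v = \<one>}" using derives_restrict[OF v(1)] v(2) by blast
  next
    fix w assume "w \<in> {w. \<exists>v. derives ?Q ?T [?S] w v \<and> mprod v = \<one>}"
    then obtain v where "derives ?Q ?T [?S] w v" "mprod v = \<one>" by blast
    moreover have "?Q \<subseteq> ?P" by blast
    ultimately show "w \<in> {w. \<exists>v. derives ?P ?T [?S] w v \<and> mprod v = \<one>}" using derives_mono by blast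
  qed
  finally have eq: "grammar_language G D = {w. \<exists>v. derives ?Q ?T [?S] w v \<and> mprod v = \<one>}" .
  have "finite (nonterminals D)" "finite ?T" "nonterminals D \<inter> ?T = {}" "?S \<in> nonterminals D"
    and P: "finite ?P" "?P \<subseteq> nonterminals D \<times> lists (nonterminals D \<union> ?T) \<times> carrier G"
    using D by (auto simp: valence_grammar_def)
  moreover have "finite ?Q" by (rule finite_subset[OF _ P(1)]) auto
  moreover have "?Q \<subseteq> nonterminals D \<times> lists (nonterminals D \<union> ?T) \<times> H" using P(2) by auto
  ultimately show ?thesis unfolding eq by (intro H.context_free_if_finite_valences)
qed

section \<open>The equivalence\<close>

text \<open>Finiteness of the sets of right invertible elements is the hub: three cycles of
  implications pass through \<open>P\<^sub>5\<close>.\<close>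

lemma all_equivalentI:
  assumes "P\<^sub>5 \<longrightarrow> P\<^sub>1" "P\<^sub>1 \<longrightarrow> P\<^sub>5" "P\<^sub>5 \<longrightarrow> P\<^sub>4" "P\<^sub>4 \<longrightarrow> P\<^sub>2" "P\<^sub>2 \<longrightarrow> P\<^sub>3" "P\<^sub>3 \<longrightarrow> P\<^sub>5"
    and "P\<^sub>5 \<longrightarrow> P\<^sub>7" "P\<^sub>7 \<longrightarrow> P\<^sub>6" "P\<^sub>6 \<longrightarrow> P\<^sub>5"
  shows "all_equivalent [P\<^sub>1, P\<^sub>2, P\<^sub>3, P\<^sub>4, P\<^sub>5, P\<^sub>6, P\<^sub>7]"
  using assms unfolding all_equivalent_def by (cases P\<^sub>5) auto

theorem theorem12:
  fixes M :: "('m, 'r) monoid_scheme"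
  assumes "monoid M"
  shows "all_equivalent
    [\<forall>G. valence_grammar M G \<longrightarrow> context_free_language (grammar_language M G),
     \<forall>X A. valence_automaton X M A \<longrightarrow> regular_language (automaton_language X M A),
     \<forall>X A. valence_automaton X M A \<longrightarrow>
       (\<exists>Y B. deterministic_valence_automaton Y M B \<and>
          automaton_language Y M B = automaton_language X M A),
     \<forall>X Y A. valence_transducer X Y M A \<longrightarrow> rational_transduction (transduction X Y M A),
     \<forall>N. finitely_generated_submonoid N M \<longrightarrow> finite (right_invertibles (M\<lparr>carrier := N\<rparr>)),
     \<forall>N. finitely_generated_submonoid N M \<longrightarrow> finite (left_invertibles (M\<lparr>carrier := N\<rparr>)),
     \<forall>N. finitely_generated_submonoid N M \<longrightarrow> finite (two_sided_factors (M\<lparr>carrier := N\<rparr>))]"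
proof -
  interpret monoid M by (rule assms)
  let ?fin = "\<lambda>F. \<forall>N. finitely_generated_submonoid N M \<longrightarrow> finite (F (M\<lparr>carrier := N\<rparr>) :: 'm set)"
  let ?grammars = "\<forall>G. valence_grammar M G \<longrightarrow> context_free_language (grammar_language M G)"
  let ?automata = "\<forall>X A. valence_automaton X M A \<longrightarrow> regular_language (automaton_language X M A)"
  let ?determinizable = "\<forall>X A. valence_automaton X M A \<longrightarrow>
    (\<exists>Y B. deterministic_valence_automaton Y M B \<and> automaton_language Y M B = automaton_language X M A)"
  let ?transducers = "\<forall>X Y A. valence_transducer X Y M A \<longrightarrow> rational_transduction (transduction X Y M A)"
  have sub: "monoid (M\<lparr>carrier := N\<rparr>)" if "finitely_generated_submonoid N M" for N
    using submonoid_if_finitely_generated[OF that] submonoid.submonoid_is_monoid monoid_axioms by blast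
  have "?fin right_invertibles \<longrightarrow> ?grammars" using context_free_grammar_language by blast
  moreover have "?grammars \<longrightarrow> ?fin right_invertibles" using finite_right_invertibles_if_context_free by blast
  moreover have "?fin right_invertibles \<longrightarrow> ?transducers" using rational_transduction by blast
  moreover have "?transducers \<longrightarrow> ?automata" using regular_if_transductions_rational by blast
  moreover have "?automata \<longrightarrow> ?determinizable" using deterministic_automaton_of_regular by blast
  moreover have "?determinizable \<longrightarrow> ?fin right_invertibles"
    using finite_right_invertibles_if_determinizable by blast
  moreover have "?fin right_invertibles \<longrightarrow> ?fin two_sided_factors"
    using monoid.two_sided_factors_eq_right_invertibles[OF sub] by auto
  moreover have "?fin two_sided_factors \<longrightarrow> ?fin left_invertibles"
    using monoid.left_invertibles_subset_two_sided_factors[OF sub] finite_subset by blast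
  moreover have "?fin left_invertibles \<longrightarrow> ?fin right_invertibles"
    using monoid.right_invertibles_subset_left_invertibles[OF sub] finite_subset by blast
  ultimately show ?thesis by (rule all_equivalentI)
qed

end
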